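(* Let $\mathbb F=\mathbb R,\mathbb C$ or $\mathbb H$, $k\ge2$, $V=\operatorname{Herm}(k,\mathbb F)$, $d=\dim_{\mathbb R}\mathbb F$, $\lambda=\frac d2$. Let $p:\mathbb F^k\setminus\{0\}\to\Xi$, $x\mapsto xx^*$, and $p_{\mathbb C}:\mathbb F^k_{\mathbb C}=\mathbb F^k\otimes_{\mathbb R}\mathbb C\to V_{\mathbb C}$, $z\mapsto zz^*$, be the folding map and its complexification, with pullbacks $p^*,p_{\mathbb C}^*$. Let $\mathbb B_\Xi$ be the Segal–Bargmann transform of $V$ and $\mathbb B:L^2(\mathbb R^{dk})\to\mathcal F(\mathbb C^{dk})$ the classical Segal–Bargmann transform, where $\mathbb F^k\simeq\mathbb R^{dk}$, $\mathbb F_{\mathbb C}^k\simeq\mathbb C^{dk}$. Then $p_{\mathbb C}^*\circ\mathbb B_\Xi$ is a scalar multiple of $\mathbb B\circ p^*$ (as operators on $L^2(\Xi,d\mu)$).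
   Context: $V=\operatorname{Herm}(k,\mathbb F)$ with Jordan product $\frac12(xy+yx)$, Jordan trace $\operatorname{tr}$, rank $r=k$, trace form $(x|y)=\operatorname{Re}\operatorname{tr}(xy)$, extended $\mathbb C$-bilinearly to $V_{\mathbb C}$. $x^*={}^t\overline x$ with conjugation in $\mathbb F$ (extended $\mathbb C$-linearly to $\mathbb F_{\mathbb C}=\mathbb F\otimes_{\mathbb R}\mathbb C$; it is not the conjugation of the complexification). $\Xi=\operatorname{Str}(V)_0\cdot c_1$ ($c_1$ a primitive idempotent) is the set $\{xx^*:x\in\mathbb F^k\setminus\{0\}\}$ of positive semidefinite rank-one matrices, $\mathbb X=\operatorname{Str}(V_{\mathbb C})_0\cdot c_1$. $\int_\Xi f\,d\mu=\frac{2^{r\lambda}}{\Gamma(r\lambda)}\int_{K^L}\int_0^\infty f(htc_1)t^{r\lambda-1}dt\,dh$, where $K^L$ is the stabilizer of the identity matrix in $\operatorname{Str}(V)_0$ with normalized Haar measure $dh$. $\mathbb B_\Xi f(z)=\Gamma(\lambda)e^{-\frac12\operatorname{tr}(z)}\int_\Xi\widetilde I_{\lambda-1}(2\sqrt{(z|x)})e^{-\operatorname{tr}(x)}f(x)\,d\mu(x)$ for $f\in L^2(\Xi,d\mu)$, $z\in V_{\mathbb C}$ (an entire function of $z$), with $\widetilde I_\alpha(t)=(t/2)^{-\alpha}I_\alpha(t)$. The classical transform is $\mathbb Bu(z)=e^{-\frac12z^2}\int_{\mathbb R^N}e^{2z\cdot x}e^{-x^2}u(x)\,dx$, $z\in\mathbb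 C^N$, where $z\cdot x$ is the bilinear extension of the Euclidean inner product and $z^2=z\cdot z$, and $\mathcal F(\mathbb C^N)$ is the space of entire functions square integrable with respect to $e^{-|z|^2}dz$. The pullback $p^*f=f\circ p$ maps $L^2(\Xi,d\mu)$ to $L^2(\mathbb F^k)$ and $p_{\mathbb C}^*F=F\circ p_{\mathbb C}$. *)

theory Defs
  imports "HOL-Analysis.Analysis" "HOL-Probability.Probability_Measure"
begin

section \<open>The scalars: real numbers, complex numbers, quaternions\<close>

text \<open>The class only serves to give one definition for the three cases; it is instantiated by
  \<^typ>\<open>real\<close>, \<^typ>\<open>complex\<close> and the quaternions, with their usual conjugation and with the
  standard Euclidean structure.\<close>

class conj_algebra = real_algebra_1 + euclidean_space +
  fixes fcnj :: "'a \<Rightarrow> 'a"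
  assumes fcnj_add: "fcnj (x + y) = fcnj x + fcnj y"
    and fcnj_scaleR: "fcnj (r *\<^sub>R x) = r *\<^sub>R fcnj x"
    and fcnj_mult: "fcnj (x * y) = fcnj y * fcnj x"
    and fcnj_fcnj [simp]: "fcnj (fcnj x) = x"
    and mult_fcnj_self: "x * fcnj x = (x \<bullet> x) *\<^sub>R 1"
    and inner_one_one: "1 \<bullet> 1 = 1"

instantiation real :: conj_algebra
begin
definition fcnj_real :: "real \<Rightarrow> real" where "fcnj_real x = x"
instance by standard (auto simp: fcnj_real_def)
end

instantiation complex :: conj_algebra
begin
definition fcnj_complex :: "complex \<Rightarrow> complex" where "fcnj_complex x = cnj x"
instance
  by standard (auto simp: fcnj_complex_def complex_eq_iff inner_complex_def)
end

datatype quat = Quat (qre: real) (qi: real) (qj: real) (qk: real)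

lemma quat_eq_iff: "x = y \<longleftrightarrow> qre x = qre y \<and> qi x = qi y \<and> qj x = qj y \<and> qk x = qk y"
  by (cases x; cases y) simp

instantiation quat :: real_algebra_1
begin

definition "0 = Quat 0 0 0 0"
definition "1 = Quat 1 0 0 0"
definition "x + y = Quat (qre x + qre y) (qi x + qi y) (qj x + qj y) (qk x + qk y)"
definition "x - y = Quat (qre x - qre y) (qi x - qi y) (qj x - qj y) (qk x - qk y)"
definition "- x = Quat (- qre x) (- qi x) (- qj x) (- qk x)"
definition "r *\<^sub>R x = Quat (r * qre x) (r * qi x) (r * qj x) (r * qk x)"
definition "x * y = Quat
  (qre x * qre y - qi x * qi y - qj x * qj y - qk x * qk y)
  (qre x * qi y + qi x * qre y + qj x * qk y - qk x * qj y)
  (qre x * qj y - qi x * qk y + qj x * qre y + qk x * qi y)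
  (qre x * qk y + qi x * qj y - qj x * qi y + qk x * qre y)"

instance
  by standard
    (auto simp: zero_quat_def one_quat_def plus_quat_def minus_quat_def uminus_quat_def
      scaleR_quat_def times_quat_def quat_eq_iff algebra_simps)

end

lemma quat_sel [simp]:
  "qre 0 = 0" "qi 0 = 0" "qj 0 = 0" "qk 0 = 0"
  "qre 1 = 1" "qi 1 = 0" "qj 1 = 0" "qk 1 = 0"
  "qre (x + y) = qre x + qre y" "qi (x + y) = qi x + qi y"
  "qj (x + y) = qj x + qj y" "qk (x + y) = qk x + qk y"
  "qre (x - y) = qre x - qre y" "qi (x - y) = qi x - qi y"
  "qj (x - y) = qj x - qj y" "qk (x - y) = qk x - qk y"
  "qre (- x) = - qre x" "qi (- x) = - qi x" "qj (- x) = - qj x" "qk (- x) = - qk x"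
  "qre (r *\<^sub>R x) = r * qre x" "qi (r *\<^sub>R x) = r * qi x"
  "qj (r *\<^sub>R x) = r * qj x" "qk (r *\<^sub>R x) = r * qk x"
  by (auto simp: zero_quat_def one_quat_def plus_quat_def minus_quat_def uminus_quat_def
      scaleR_quat_def)

instantiation quat :: real_inner
begin

definition "x \<bullet> y = qre x * qre y + qi x * qi y + qj x * qj y + qk x * qk y"
definition norm_quat :: "quat \<Rightarrow> real" where "norm_quat x = sqrt (x \<bullet> x)"
definition sgn_quat :: "quat \<Rightarrow> quat" where "sgn_quat x = x /\<^sub>R norm x"
definition dist_quat :: "quat \<Rightarrow> quat \<Rightarrow> real" where "dist_quat x y = norm (x - y)"
definition uniformity_quat :: "(quat \<times> quat) filter" where
  "uniformity_quat = (INF e\<in>{0 <..}. principal {(x, y). dist x y < e})"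
definition open_quat :: "quat set \<Rightarrow> bool" where
  "open_quat U \<longleftrightarrow> (\<forall>x\<in>U. eventually (\<lambda>(x', y). x' = x \<longrightarrow> y \<in> U) uniformity)"

instance
proof
  fix x y z :: quat and r :: real and U :: "quat set"
  show "x \<bullet> y = y \<bullet> x" "(x + y) \<bullet> z = x \<bullet> z + y \<bullet> z" "(r *\<^sub>R x) \<bullet> y = r * (x \<bullet> y)"
    by (simp_all add: inner_quat_def algebra_simps)
  show "0 \<le> x \<bullet> x" by (simp add: inner_quat_def)
  show "(x \<bullet> x = 0) = (x = 0)"
    by (auto simp add: inner_quat_def quat_eq_iff add_nonneg_eq_0_iff)
qed (rule norm_quat_def sgn_quat_def dist_quat_def uniformity_quat_def open_quat_def)+

end

instantiation quat :: euclidean_space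
begin

definition Basis_quat :: "quat set" where
  "Basis_quat = {Quat 1 0 0 0, Quat 0 1 0 0, Quat 0 0 1 0, Quat 0 0 0 1}"

instance
proof
  show "(Basis :: quat set) \<noteq> {}" "finite (Basis :: quat set)" by (simp_all add: Basis_quat_def)
  show "u \<bullet> v = (if u = v then 1 else 0)" if "u \<in> Basis" "v \<in> Basis" for u v :: quat
    using that unfolding Basis_quat_def by (elim insertE emptyE) (simp_all add: inner_quat_def)
  show "(\<forall>u\<in>Basis. x \<bullet> u = 0) \<longleftrightarrow> x = 0" for x :: quat
  proof -
    have "(\<forall>u\<in>Basis. x \<bullet> u = 0) \<longleftrightarrow> qre x = 0 \<and> qi x = 0 \<and> qj x = 0 \<and> qk x = 0"
      by (simp add: Basis_quat_def inner_quat_def)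
    thus ?thesis by (simp add: quat_eq_iff)
  qed
qed

end

instantiation quat :: conj_algebra
begin
definition fcnj_quat :: "quat \<Rightarrow> quat" where
  "fcnj_quat x = Quat (qre x) (- qi x) (- qj x) (- qk x)"
instance
  by standard
    (simp_all add: fcnj_quat_def quat_eq_iff inner_quat_def times_quat_def algebra_simps)
end

lemma DIM_quat: "DIM(quat) = 4"
  by (simp add: Basis_quat_def)

definition fre :: "'f::conj_algebra \<Rightarrow> real" where
  "fre x = x \<bullet> 1"

lemma fre_simps: "fre (x::real) = x" "fre (z::complex) = Re z" "fre (q::quat) = qre q"
  by (simp_all add: fre_def inner_complex_def inner_quat_def)

lemma fcnj_minus: "fcnj (- x) = - fcnj x" for x :: "'f::conj_algebra"
  using fcnj_scaleR[of "-1" x] by simp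

lemma fcnj_diff: "fcnj (x - y) = fcnj x - fcnj y" for x :: "'f::conj_algebra"
  using fcnj_add[of x "- y"] by (simp add: fcnj_minus)

lemma fcnj_0 [simp]: "fcnj 0 = (0::'f::conj_algebra)"
  using fcnj_scaleR[of 0 0] by simp

lemma fcnj_1 [simp]: "fcnj 1 = (1::'f::conj_algebra)"
proof -
  have "fcnj (fcnj (1::'f)) = fcnj (fcnj 1 * 1)" by simp
  also have "\<dots> = fcnj 1 * fcnj (fcnj 1)" by (rule fcnj_mult)
  finally show ?thesis by simp
qed

lemma inner_eq_fre: "x \<bullet> y = fre (x * fcnj y)" for x y :: "'f::conj_algebra"
proof -
  have a: "fre (z * fcnj z) = z \<bullet> z" for z :: 'f
    by (simp add: mult_fcnj_self fre_def inner_one_one)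
  have b: "fre (fcnj z) = fre z" for z :: 'f
  proof -
    have "(z + 1) * fcnj (z + 1) = ((z + 1) \<bullet> (z + 1)) *\<^sub>R 1" by (rule mult_fcnj_self)
    moreover have "(z + 1) * fcnj (z + 1) = z * fcnj z + (z + fcnj z) + 1"
      by (simp add: fcnj_add distrib_left distrib_right add.assoc)
    moreover have "(z + 1) \<bullet> (z + 1) = z \<bullet> z + 2 * (z \<bullet> 1) + 1"
      by (simp add: inner_add_left inner_add_right inner_commute[of 1 z] inner_one_one)
    ultimately have "z + fcnj z = (2 * (z \<bullet> 1)) *\<^sub>R 1"
      by (simp add: mult_fcnj_self scaleR_add_left)
    hence "(z + fcnj z) \<bullet> 1 = 2 * (z \<bullet> 1)" by (simp add: inner_one_one)
    thus ?thesis by (simp add: fre_def inner_add_left)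
  qed
  have c: "fre (y * fcnj x) = fre (x * fcnj y)"
    using b[of "x * fcnj y"] by (simp add: fcnj_mult)
  have "fre ((x + y) * fcnj (x + y)) = (x + y) \<bullet> (x + y)" by (rule a)
  hence "fre (x * fcnj x) + fre (x * fcnj y) + fre (y * fcnj x) + fre (y * fcnj y)
     = x \<bullet> x + 2 * (x \<bullet> y) + y \<bullet> y"
    by (simp add: fcnj_add algebra_simps inner_add_left inner_add_right inner_commute fre_def)
  thus ?thesis by (simp add: a c)
qed

section \<open>The Euclidean Jordan algebra of Hermitian matrices\<close>

definition ctranspose :: "('f::conj_algebra)^'k^'k \<Rightarrow> 'f^'k^'k" where
  "ctranspose A = (\<chi> i j. fcnj (A $ j $ i))"

typedef (overloaded) ('f, 'k) herm = "{A :: ('f::conj_algebra)^'k^('k::finite). ctranspose A = A}"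
  morphisms mat_of herm_of
  by (rule exI[of _ 0]) (simp add: ctranspose_def vec_eq_iff)

lemma mat_of_herm: "ctranspose (mat_of x) = mat_of x"
  using mat_of[of x] by simp

lemma mat_of_herm_of: "ctranspose A = A \<Longrightarrow> mat_of (herm_of A) = A"
  by (simp add: herm_of_inverse)

lemma ctranspose_linear:
  "ctranspose (A + B) = ctranspose A + ctranspose B"
  "ctranspose (A - B) = ctranspose A - ctranspose B"
  "ctranspose (- A) = - ctranspose A"
  "ctranspose (r *\<^sub>R A) = r *\<^sub>R ctranspose A"
  "ctranspose 0 = 0"
  by (simp_all add: ctranspose_def vec_eq_iff fcnj_add fcnj_diff fcnj_minus fcnj_scaleR)

lemma ctranspose_mult: "ctranspose (A ** B) = ctranspose B ** ctranspose A"
proof -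
  have "fcnj (sum f S) = (\<Sum>i\<in>S. fcnj (f i))" if "finite S"
    for f :: "'c \<Rightarrow> 'f::conj_algebra" and S
    using that by induction (simp_all add: fcnj_add)
  note * = this[OF finite]
  show ?thesis
    by (simp add: * ctranspose_def matrix_matrix_mult_def vec_eq_iff fcnj_mult)
qed

lemma ctranspose_mat_1: "ctranspose (mat 1) = mat 1"
  by (simp add: ctranspose_def mat_def vec_eq_iff)

instantiation herm :: (conj_algebra, finite) real_vector
begin

definition "0 = herm_of 0"
definition "x + y = herm_of (mat_of x + mat_of y)"
definition "x - y = herm_of (mat_of x - mat_of y)"
definition "- x = herm_of (- mat_of x)"
definition "r *\<^sub>R x = herm_of (r *\<^sub>R mat_of x)"

lemma mat_of_simps [simp]:
  "mat_of 0 = (0 :: 'a^'b^'b)"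
  "mat_of (x + y) = mat_of x + (mat_of y :: 'a^'b^'b)"
  "mat_of (x - y) = mat_of x - (mat_of y :: 'a^'b^'b)"
  "mat_of (- x) = - (mat_of x :: 'a^'b^'b)"
  "mat_of (r *\<^sub>R x) = r *\<^sub>R (mat_of x :: 'a^'b^'b)"
  by (simp_all add: zero_herm_def plus_herm_def minus_herm_def uminus_herm_def scaleR_herm_def
      mat_of_herm_of ctranspose_linear mat_of_herm)

instance
  by standard (simp_all add: mat_of_inject[symmetric] algebra_simps)

end

instantiation herm :: (conj_algebra, finite) real_inner
begin

definition inner_herm :: "('a, 'b) herm \<Rightarrow> ('a, 'b) herm \<Rightarrow> real" where
  "inner_herm x y = mat_of x \<bullet> mat_of y"
definition norm_herm :: "('a, 'b) herm \<Rightarrow> real" where "norm_herm x = sqrt (x \<bullet> x)"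
definition sgn_herm :: "('a, 'b) herm \<Rightarrow> ('a, 'b) herm" where "sgn_herm x = x /\<^sub>R norm x"
definition dist_herm :: "('a, 'b) herm \<Rightarrow> ('a, 'b) herm \<Rightarrow> real" where
  "dist_herm x y = norm (x - y)"
definition uniformity_herm :: "(('a, 'b) herm \<times> ('a, 'b) herm) filter" where
  "uniformity_herm = (INF e\<in>{0 <..}. principal {(x, y). dist x y < e})"
definition open_herm :: "('a, 'b) herm set \<Rightarrow> bool" where
  "open_herm U \<longleftrightarrow> (\<forall>x\<in>U. eventually (\<lambda>(x', y). x' = x \<longrightarrow> y \<in> U) uniformity)"

instance
proof
  fix x y z :: "('a, 'b) herm" and r :: real and U :: "('a, 'b) herm set"
  show "x \<bullet> y = y \<bullet> x" "(x + y) \<bullet> z = x \<bullet> z + y \<bullet> z" "(r *\<^sub>R x) \<bullet> y = r * (x \<bullet> y)" "0 \<le> x \<bullet> x"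
    by (simp_all add: inner_herm_def inner_add_left inner_commute[of "mat_of x" "mat_of y"])
  show "(x \<bullet> x = 0) = (x = 0)"
    by (simp add: inner_herm_def mat_of_inject[symmetric])
qed (rule norm_herm_def sgn_herm_def dist_herm_def uniformity_herm_def open_herm_def)+

end

lemma subspace_hermitian: "subspace {A :: ('f::conj_algebra)^'k^'k. ctranspose A = A}"
  by (simp add: subspace_def ctranspose_linear)

instantiation herm :: (conj_algebra, finite) euclidean_space
begin

text \<open>No particular orthonormal basis is singled out.\<close>

definition Basis_herm :: "('a, 'b) herm set" where
  "Basis_herm = herm_of ` (SOME B. B \<subseteq> {A. ctranspose A = A} \<and> pairwise orthogonal B \<and>
     (\<forall>A\<in>B. norm A = 1) \<and> independent B \<and> span B = {A. ctranspose A = A})"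

instance
proof -
  define S where "S = {A :: 'a^'b^'b. ctranspose A = A}"
  define P where "P B \<longleftrightarrow> B \<subseteq> S \<and> pairwise orthogonal B \<and> (\<forall>A\<in>B. norm A = 1) \<and>
    independent B \<and> span B = S" for B
  define B where "B = (SOME B. P B)"
  have "\<exists>B. P B"
    unfolding P_def S_def
    by (rule orthonormal_basis_subspace[OF subspace_hermitian]) blast
  hence PB: "P B" unfolding B_def by (rule someI_ex)
  hence B: "B \<subseteq> S" "pairwise orthogonal B" "\<And>A. A \<in> B \<Longrightarrow> norm A = 1" "independent B" "span B = S"
    by (auto simp: P_def)
  have Basis: "(Basis :: ('a, 'b) herm set) = herm_of ` B"
    by (simp add: Basis_herm_def B_def P_def S_def)
  have inv: "mat_of (herm_of A) = A" if "A \<in> B" for A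
    using that B(1) by (auto simp: S_def intro: mat_of_herm_of)
  show "OFCLASS(('a, 'b) herm, euclidean_space_class)"
  proof
    have "(mat 1 :: 'a^'b^'b) \<in> S" by (simp add: S_def ctranspose_mat_1)
    moreover have "(mat 1 :: 'a^'b^'b) \<noteq> 0" by (simp add: mat_def vec_eq_iff)
    ultimately have "B \<noteq> {}" using B(5) by auto
    thus "(Basis :: ('a, 'b) herm set) \<noteq> {}" by (simp add: Basis)
    show "finite (Basis :: ('a, 'b) herm set)"
      using B(4) by (simp add: Basis independent_imp_finite)
    show "u \<bullet> v = (if u = v then 1 else 0)"
      if uv: "u \<in> Basis" "v \<in> Basis" for u v :: "('a, 'b) herm"
    proof -
      obtain A C where AC: "A \<in> B" "C \<in> B" "u = herm_of A" "v = herm_of C"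
        using uv by (auto simp: Basis)
      have e: "u \<bullet> v = A \<bullet> C" using AC by (simp add: inner_herm_def inv)
      have u: "u = v \<longleftrightarrow> A = C" using AC inv by metis
      show ?thesis
      proof (cases "A = C")
        case True
        hence "u \<bullet> v = norm A ^ 2" using e by (simp add: power2_norm_eq_inner)
        thus ?thesis using True u B(3)[OF AC(1)] by simp
      next
        case False
        hence "A \<bullet> C = 0" using B(2) AC by (auto simp: pairwise_def orthogonal_def)
        thus ?thesis using e u False by simp
      qed
    qed
    show "(\<forall>u\<in>Basis. x \<bullet> u = 0) \<longleftrightarrow> x = 0" for x :: "('a, 'b) herm"
    proof
      assume "\<forall>u\<in>Basis. x \<bullet> u = 0"
      hence "mat_of x \<bullet> A = 0" if "A \<in> B" for A
        using that by (auto simp: Basis inner_herm_def inv dest!: bspec)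
      hence "orthogonal (mat_of x) A" if "A \<in> B" for A using that by (simp add: orthogonal_def)
      moreover have "mat_of x \<in> span B" unfolding B(5) by (simp add: S_def mat_of_herm)
      ultimately have "orthogonal (mat_of x) (mat_of x)"
        by (rule orthogonal_to_span[rotated])
      thus "x = 0" by (simp add: orthogonal_def mat_of_inject[symmetric])
    qed simp
  qed
qed

end

definition jordan_prod :: "('f::conj_algebra, 'k::finite) herm \<Rightarrow> ('f, 'k) herm \<Rightarrow> ('f, 'k) herm"
    (infixl "\<bullet>\<^sub>J" 70) where
  "x \<bullet>\<^sub>J y = herm_of ((1/2) *\<^sub>R (mat_of x ** mat_of y + mat_of y ** mat_of x))"

definition herm_one :: "('f::conj_algebra, 'k::finite) herm" where
  "herm_one = herm_of (mat 1)"

lemma mat_of_jordan_prod: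
  "mat_of (x \<bullet>\<^sub>J y) = (1/2) *\<^sub>R (mat_of x ** mat_of y + mat_of y ** mat_of x)"
  unfolding jordan_prod_def
  by (rule mat_of_herm_of) (simp add: ctranspose_linear ctranspose_mult mat_of_herm add.commute)

lemma mat_of_herm_one: "mat_of herm_one = mat 1"
  unfolding herm_one_def by (rule mat_of_herm_of) (rule ctranspose_mat_1)

text \<open>The diagonal entries of a Hermitian matrix are real; taking \<^const>\<open>fre\<close> turns them into
  real numbers.\<close>

definition jordan_tr :: "('f::conj_algebra, 'k::finite) herm \<Rightarrow> real" where
  "jordan_tr x = (\<Sum>i\<in>UNIV. fre (mat_of x $ i $ i))"

definition trace_form :: "('f::conj_algebra, 'k::finite) herm \<Rightarrow> ('f, 'k) herm \<Rightarrow> real" where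
  "trace_form x y = (\<Sum>i\<in>UNIV. fre ((mat_of x ** mat_of y) $ i $ i))"

lemma trace_form_eq_inner: "trace_form x y = x \<bullet> y"
proof -
  have sum: "fre (sum f S) = (\<Sum>i\<in>S. fre (f i))" for f :: "'c \<Rightarrow> 'f::conj_algebra" and S
    by (simp add: fre_def inner_sum_left)
  have "fcnj (mat_of y $ i $ j) = mat_of y $ j $ i" for i j
    using mat_of_herm[of y] by (simp add: ctranspose_def vec_eq_iff)
  thus ?thesis
    by (simp add: trace_form_def inner_herm_def inner_vec_def matrix_matrix_mult_def sum inner_eq_fre)
qed

definition primitive_idempotent :: "('f::conj_algebra, 'k::finite) herm \<Rightarrow> bool" where
  "primitive_idempotent c \<longleftrightarrow> c \<noteq> 0 \<and> c \<bullet>\<^sub>J c = c \<and>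
     \<not> (\<exists>a b. a \<noteq> 0 \<and> b \<noteq> 0 \<and> a \<bullet>\<^sub>J a = a \<and> b \<bullet>\<^sub>J b = b \<and> a \<bullet>\<^sub>J b = 0 \<and> c = a + b)"

section \<open>Structure group and the orbit of a primitive idempotent\<close>

definition quadratic_rep :: "('f::conj_algebra, 'k::finite) herm \<Rightarrow> ('f, 'k) herm \<Rightarrow> ('f, 'k) herm" where
  "quadratic_rep x y = 2 *\<^sub>R (x \<bullet>\<^sub>J (x \<bullet>\<^sub>J y)) - (x \<bullet>\<^sub>J x) \<bullet>\<^sub>J y"

text \<open>The structure group consists of the invertible linear maps g with P(gx) = g P(x) g', where
  P is the quadratic representation and g' the adjoint of g for the trace form.\<close>

definition Str :: "(('f::conj_algebra, 'k::finite) herm \<Rightarrow>\<^sub>L ('f, 'k) herm) set" where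
  "Str = {g. bij (blinfun_apply g) \<and>
     (\<exists>g'. (\<forall>x y. trace_form (blinfun_apply g x) y = trace_form x (g' y)) \<and>
        (\<forall>x y. quadratic_rep (blinfun_apply g x) y = blinfun_apply g (quadratic_rep x (g' y))))}"

definition Str0 :: "(('f::conj_algebra, 'k::finite) herm \<Rightarrow>\<^sub>L ('f, 'k) herm) set" where
  "Str0 = connected_component_set Str id_blinfun"

definition K_L :: "(('f::conj_algebra, 'k::finite) herm \<Rightarrow>\<^sub>L ('f, 'k) herm) set" where
  "K_L = {g \<in> Str0. blinfun_apply g herm_one = herm_one}"

definition orbit_Xi :: "('f::conj_algebra, 'k::finite) herm \<Rightarrow> ('f, 'k) herm set" where
  "orbit_Xi c\<^sub>1 = (\<lambda>g. blinfun_apply g c\<^sub>1) ` Str0"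

text \<open>The normalized Haar measure of a compact group of linear maps: the left-invariant Borel
  probability measure (such a measure is also right-invariant, and unique).\<close>

definition normalized_haar ::
    "('v::euclidean_space \<Rightarrow>\<^sub>L 'v) set \<Rightarrow> ('v \<Rightarrow>\<^sub>L 'v) measure \<Rightarrow> bool" where
  "normalized_haar K dh \<longleftrightarrow> prob_space dh \<and> space dh = K \<and> sets dh = sets (restrict_space borel K) \<and>
     (\<forall>g\<in>K. distr dh dh (\<lambda>h. g o\<^sub>L h) = dh)"

definition lam :: "'f::conj_algebra itself \<Rightarrow> real" where
  "lam _ = real DIM('f) / 2"

text \<open>The measure on the orbit given by
  f \<mapsto> 2^(r \<lambda>) / \<Gamma>(r \<lambda>) * \<integral> \<integral>_0^\<infinity> f (h (t c1)) t^(r \<lambda> - 1) dt dh; see \<open>nn_integral_orbit_measure\<close>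
  below. The rank r is \<^term>\<open>CARD('k)\<close>.\<close>

definition orbit_measure :: "('f::conj_algebra, 'k::finite) herm \<Rightarrow>
    (('f, 'k) herm \<Rightarrow>\<^sub>L ('f, 'k) herm) measure \<Rightarrow> ('f, 'k) herm measure" where
  "orbit_measure c\<^sub>1 dh = (let s = real CARD('k) * lam TYPE('f) in
     distr
       (dh \<Otimes>\<^sub>M density (restrict_space lborel {0<..})
          (\<lambda>t. ennreal (2 powr s / Gamma s * t powr (s - 1))))
       (restrict_space borel (orbit_Xi c\<^sub>1))
       (\<lambda>(h, t). blinfun_apply h (t *\<^sub>R c\<^sub>1)))"

definition L2 :: "'a measure \<Rightarrow> ('a \<Rightarrow> complex) set" where
  "L2 M = {f \<in> borel_measurable M. integrable M (\<lambda>x. (cmod (f x))\<^sup>2)}"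

section \<open>Complexification\<close>

text \<open>The complexification of a real vector space V is V \<times> V, the pair (x, y) standing for x + i y.
  The maps below are the complex-linear and complex-bilinear extensions.\<close>

type_synonym 'v cplx = "'v \<times> 'v"

definition clinear_form :: "('v \<Rightarrow> real) \<Rightarrow> 'v cplx \<Rightarrow> complex" where
  "clinear_form l z = Complex (l (fst z)) (l (snd z))"

definition cbilinear_form :: "('v \<Rightarrow> 'v \<Rightarrow> real) \<Rightarrow> 'v cplx \<Rightarrow> 'v cplx \<Rightarrow> complex" where
  "cbilinear_form b z w = Complex
     (b (fst z) (fst w) - b (snd z) (snd w)) (b (fst z) (snd w) + b (snd z) (fst w))"

definition cbilinear :: "('v \<Rightarrow> 'v \<Rightarrow> 'w::real_vector) \<Rightarrow> 'v cplx \<Rightarrow> 'v cplx \<Rightarrow> 'w cplx" where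
  "cbilinear b z w =
     (b (fst z) (fst w) - b (snd z) (snd w), b (fst z) (snd w) + b (snd z) (fst w))"

definition cplx_of :: "'v::real_vector \<Rightarrow> 'v cplx" where
  "cplx_of x = (x, 0)"

section \<open>The folding map\<close>

text \<open>The matrix x y* with entries x_i * cnj (y_j).\<close>

definition outer :: "('f::conj_algebra)^'k \<Rightarrow> 'f^'k \<Rightarrow> 'f^'k^'k" where
  "outer x y = (\<chi> i j. x $ i * fcnj (y $ j))"

lemma ctranspose_outer: "ctranspose (outer x y) = outer y x"
  by (simp add: ctranspose_def outer_def fcnj_mult vec_eq_iff)

text \<open>The folding map is only of interest away from 0, a null set.\<close>

definition fold_map :: "('f::conj_algebra)^('k::finite) \<Rightarrow> ('f, 'k) herm" where
  "fold_map x = herm_of (outer x x)"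

definition fold_map_C :: "(('f::conj_algebra)^('k::finite)) cplx \<Rightarrow> (('f, 'k) herm) cplx" where
  "fold_map_C z = map_prod herm_of herm_of (cbilinear outer z z)"

lemma mat_of_fold_map: "mat_of (fold_map x) = outer x x"
  unfolding fold_map_def by (rule mat_of_herm_of) (rule ctranspose_outer)

lemma mat_of_fold_map_C: "map_prod mat_of mat_of (fold_map_C z) = cbilinear outer z z"
  by (simp add: fold_map_C_def cbilinear_def mat_of_herm_of ctranspose_linear ctranspose_outer
      add.commute)

text \<open>Entrywise this is z z* over the complexified scalars, with the complex-linearly extended
  conjugation and the complex-bilinearly extended product.\<close>

lemma fold_map_C_entry:
  "map_prod (\<lambda>A. mat_of A $ i $ j) (\<lambda>A. mat_of A $ i $ j) (fold_map_C z) =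
   cbilinear (*) (fst z $ i, snd z $ i) (map_prod fcnj fcnj (fst z $ j, snd z $ j))"
proof -
  have "map_prod (\<lambda>A. mat_of A $ i $ j) (\<lambda>A. mat_of A $ i $ j) (fold_map_C z) =
    map_prod (\<lambda>A. A $ i $ j) (\<lambda>A. A $ i $ j) (map_prod mat_of mat_of (fold_map_C z))"
    by (simp add: prod.map_comp o_def)
  thus ?thesis
    by (simp add: mat_of_fold_map_C cbilinear_def outer_def)
qed

lemma fold_map_C_of_real: "fold_map_C (cplx_of x) = cplx_of (fold_map x)"
proof -
  have "outer x 0 = 0" "outer 0 x = 0" "outer 0 0 = (0 :: 'a^'b^'b)"
    by (simp_all add: outer_def vec_eq_iff)
  thus ?thesis
    by (simp add: fold_map_C_def cbilinear_def fold_map_def cplx_of_def zero_herm_def)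
qed

section \<open>The Segal--Bargmann transforms\<close>

definition Bessel_I :: "real \<Rightarrow> complex \<Rightarrow> complex" where
  "Bessel_I \<alpha> t = (t / 2) powr of_real \<alpha> *
     (\<Sum>n. (t / 2) ^ (2 * n) * rGamma (of_real \<alpha> + of_nat n + 1) / fact n)"

text \<open>The entire function (t/2)^(-\<alpha>) I_\<alpha>(t); the singularity at t = 0 is removable. The function
  is even, so that in t = 2 sqrt w the choice of the square root does not matter.\<close>

definition Bessel_I_tilde :: "real \<Rightarrow> complex \<Rightarrow> complex" where
  "Bessel_I_tilde \<alpha> t =
     (if t = 0 then rGamma (of_real \<alpha> + 1) else (t / 2) powr (- of_real \<alpha>) * Bessel_I \<alpha> t)"

lemma Bessel_I_tilde_series:
  "Bessel_I_tilde \<alpha> t =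
     (\<Sum>n. (t / 2) ^ (2 * n) * rGamma (of_real \<alpha> + of_nat n + 1) / fact n)"
proof (cases "t = 0")
  case True
  have "(\<Sum>n. (t / 2) ^ (2 * n) * rGamma (of_real \<alpha> + of_nat n + 1) / fact n)
    = (\<Sum>n\<in>{0}. (t / 2) ^ (2 * n) * rGamma (of_real \<alpha> + of_nat n + 1) / fact n)"
    by (rule suminf_finite) (use True in auto)
  thus ?thesis using True by (simp add: Bessel_I_tilde_def)
next
  case False
  thus ?thesis
    by (simp add: Bessel_I_tilde_def Bessel_I_def powr_minus field_simps)
qed

definition segal_bargmann_Xi :: "('f::conj_algebra, 'k::finite) herm measure \<Rightarrow>
    (('f, 'k) herm \<Rightarrow> complex) \<Rightarrow> (('f, 'k) herm) cplx \<Rightarrow> complex" where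
  "segal_bargmann_Xi \<mu> f z =
     of_real (Gamma (lam TYPE('f))) * exp (- clinear_form jordan_tr z / 2) *
     (\<integral>x. Bessel_I_tilde (lam TYPE('f) - 1) (2 * csqrt (cbilinear_form trace_form z (cplx_of x)))
        * of_real (exp (- jordan_tr x)) * f x \<partial>\<mu>)"

text \<open>The classical transform on an N-dimensional Euclidean space. For \<^typ>\<open>'f^'k\<close> the inner product
  is the sum of the inner products of the entries, so this space is R^(dk) with d the real
  dimension of the scalars.\<close>

definition segal_bargmann :: "('e::euclidean_space \<Rightarrow> complex) \<Rightarrow> 'e cplx \<Rightarrow> complex" where
  "segal_bargmann u z =
     exp (- cbilinear_form (\<bullet>) z z / 2) *
     (\<integral>x. exp (2 * cbilinear_form (\<bullet>) z (cplx_of x)) * of_real (exp (- (x \<bullet> x))) * u x \<partial>lborel)"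

section \<open>The integral formula defining the measure\<close>

lemma jordan_prod_scaleR:
  fixes x y :: "('a::conj_algebra, 'b::finite) herm"
  shows
  "(t *\<^sub>R x) \<bullet>\<^sub>J y = t *\<^sub>R (x \<bullet>\<^sub>J y)" "x \<bullet>\<^sub>J (t *\<^sub>R y) = t *\<^sub>R (x \<bullet>\<^sub>J y)"
proof -
  have *: "(t *\<^sub>R A) ** B = t *\<^sub>R (A ** B)" "A ** (t *\<^sub>R B) = t *\<^sub>R (A ** B)"
    for A B :: "'a^'b^'b"
    by (simp_all add: matrix_matrix_mult_def vec_eq_iff scaleR_sum_right)
  show "(t *\<^sub>R x) \<bullet>\<^sub>J y = t *\<^sub>R (x \<bullet>\<^sub>J y)" "x \<bullet>\<^sub>J (t *\<^sub>R y) = t *\<^sub>R (x \<bullet>\<^sub>J y)"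
    by (simp_all add: mat_of_inject[symmetric] mat_of_jordan_prod * scaleR_add_right)
qed

lemma quadratic_rep_scaleR:
  "quadratic_rep (t *\<^sub>R x) y = t\<^sup>2 *\<^sub>R quadratic_rep x y"
  "quadratic_rep x (t *\<^sub>R y) = t *\<^sub>R quadratic_rep x y"
  by (simp_all add: quadratic_rep_def jordan_prod_scaleR scaleR_diff_right power2_eq_square)

lemma Str_scaleR:
  assumes "g \<in> Str" "t \<noteq> 0"
  shows "t *\<^sub>R g \<in> Str"
proof -
  obtain g' where g: "bij (blinfun_apply g)"
    "\<And>x y. trace_form (blinfun_apply g x) y = trace_form x (g' y)"
    "\<And>x y. quadratic_rep (blinfun_apply g x) y = blinfun_apply g (quadratic_rep x (g' y))"
    using assms(1) by (auto simp: Str_def)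
  have "bij (\<lambda>x. t *\<^sub>R blinfun_apply g x)"
  proof -
    have "bij ((*\<^sub>R) t :: ('a, 'b) herm \<Rightarrow> _)"
      by (rule bij_betw_byWitness[where f' = "(*\<^sub>R) (inverse t)"]) (use assms(2) in auto)
    from bij_comp[OF g(1) this] show ?thesis by (simp add: o_def)
  qed
  moreover have "blinfun_apply (t *\<^sub>R g) = (\<lambda>x. t *\<^sub>R blinfun_apply g x)"
    by (simp add: fun_eq_iff blinfun.scaleR_left)
  ultimately have "bij (blinfun_apply (t *\<^sub>R g))" by simp
  thus ?thesis
    unfolding Str_def
    by (auto simp: blinfun.scaleR_left trace_form_eq_inner quadratic_rep_scaleR blinfun.scaleR_right
        g(3) g(2)[unfolded trace_form_eq_inner] power2_eq_square intro!: exI[of _ "\<lambda>y. t *\<^sub>R g' y"])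
qed

lemma Str0_scaleR:
  assumes "g \<in> Str0" "t > 0"
  shows "t *\<^sub>R g \<in> Str0"
proof -
  have cc: "connected_component Str id_blinfun g"
    using assms(1) by (simp add: Str0_def)
  hence "g \<in> Str" by (auto dest: connected_component_in)
  have "connected ((\<lambda>s. s *\<^sub>R g) ` {0<..})"
    by (intro connected_continuous_image continuous_intros) auto
  moreover have "(\<lambda>s. s *\<^sub>R g) ` {0<..} \<subseteq> Str"
    using Str_scaleR[OF \<open>g \<in> Str\<close>] by auto
  moreover have "g \<in> (\<lambda>s. s *\<^sub>R g) ` {0<..}" by (rule image_eqI[of _ _ 1]) auto
  moreover have "t *\<^sub>R g \<in> (\<lambda>s. s *\<^sub>R g) ` {0<..}" using assms(2) by auto
  ultimately have "connected_component Str g (t *\<^sub>R g)"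
    unfolding connected_component_def by blast
  with cc show ?thesis
    unfolding Str0_def by (auto intro: connected_component_trans)
qed

lemma nn_integral_orbit_measure:
  fixes c\<^sub>1 :: "('f::conj_algebra, 'k::finite) herm"
  defines "s \<equiv> real CARD('k) * lam TYPE('f)"
  assumes dh: "normalized_haar K_L dh"
    and f [measurable]: "f \<in> borel_measurable (restrict_space borel (orbit_Xi c\<^sub>1))"
  shows "(\<integral>\<^sup>+x. f x \<partial>orbit_measure c\<^sub>1 dh) = ennreal (2 powr s / Gamma s) *
    (\<integral>\<^sup>+h. (\<integral>\<^sup>+t\<in>{0<..}. f (blinfun_apply h (t *\<^sub>R c\<^sub>1)) * ennreal (t powr (s - 1)) \<partial>lborel) \<partial>dh)"
proof -
  define D :: "real measure" where "D = restrict_space lborel {0<..}"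
  define w where "w = (\<lambda>t. ennreal (2 powr s / Gamma s * t powr (s - 1)))"
  define \<Phi> where "\<Phi> = (\<lambda>(h :: ('f, 'k) herm \<Rightarrow>\<^sub>L ('f, 'k) herm, t). blinfun_apply h (t *\<^sub>R c\<^sub>1))"
  have spos: "s > 0" by (simp add: s_def lam_def)
  have [measurable_cong]: "sets dh = sets (restrict_space borel K_L)" and spdh: "space dh = K_L"
    using dh by (auto simp: normalized_haar_def)
  have [measurable_cong]: "sets D = sets (restrict_space borel {0<..})"
    by (simp add: D_def sets_restrict_space)
  have spD: "space D = {0<..}" by (simp add: D_def space_restrict_space)
  have [measurable]: "(\<lambda>t. t) \<in> D \<rightarrow>\<^sub>M borel"
    by (rule measurable_compose[of _ _ borel]) (simp_all add: D_def measurable_restrict_space1)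
  have w [measurable]: "w \<in> borel_measurable D"
    unfolding w_def by measurable
  have ev [measurable]: "(\<lambda>h. blinfun_apply h c\<^sub>1) \<in> dh \<rightarrow>\<^sub>M borel"
  proof -
    have "(\<lambda>h. blinfun_apply h c\<^sub>1) \<in> borel \<rightarrow>\<^sub>M borel"
      by (intro borel_measurable_continuous_onI continuous_intros)
    hence "(\<lambda>h. blinfun_apply h c\<^sub>1) \<in> restrict_space borel K_L \<rightarrow>\<^sub>M borel"
      by (rule measurable_restrict_space1)
    thus ?thesis by measurable
  qed
  have sf: "sigma_finite_measure D" unfolding D_def
    by (rule sigma_finite_measure_restrict_space) (auto intro: lborel.sigma_finite_measure_axioms)
  interpret D: sigma_finite_measure "density D w"
  proof -
    show "sigma_finite_measure (density D w)"
      by (rule sigma_finite_measure.sigma_finite_iff_density_finite[THEN iffD2, OF sf])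
         (auto simp: w_def)
  qed
  have "(\<lambda>p. snd p *\<^sub>R blinfun_apply (fst p) c\<^sub>1) \<in> dh \<Otimes>\<^sub>M density D w \<rightarrow>\<^sub>M borel"
    by measurable
  hence "\<Phi> \<in> dh \<Otimes>\<^sub>M density D w \<rightarrow>\<^sub>M borel"
    by (simp add: \<Phi>_def case_prod_beta blinfun.scaleR_right)
  moreover have "\<Phi> \<in> space (dh \<Otimes>\<^sub>M density D w) \<rightarrow> orbit_Xi c\<^sub>1"
  proof
    fix p assume "p \<in> space (dh \<Otimes>\<^sub>M density D w)"
    hence "fst p \<in> K_L" "snd p > 0" by (auto simp: space_pair_measure spdh spD)
    hence "snd p *\<^sub>R fst p \<in> Str0" by (auto simp: K_L_def intro: Str0_scaleR)
    thus "\<Phi> p \<in> orbit_Xi c\<^sub>1"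
      by (auto simp: orbit_Xi_def \<Phi>_def case_prod_beta blinfun.scaleR_left blinfun.scaleR_right
          intro!: image_eqI[of _ _ "snd p *\<^sub>R fst p"])
  qed
  ultimately have \<Phi> [measurable]: "\<Phi> \<in> dh \<Otimes>\<^sub>M density D w \<rightarrow>\<^sub>M restrict_space borel (orbit_Xi c\<^sub>1)"
    by (rule measurable_restrict_space2[rotated])
  have om: "orbit_measure c\<^sub>1 dh = distr (dh \<Otimes>\<^sub>M density D w) (restrict_space borel (orbit_Xi c\<^sub>1)) \<Phi>"
    by (simp add: orbit_measure_def Let_def D_def w_def s_def \<Phi>_def)
  have fP: "(\<lambda>p. f (\<Phi> p)) \<in> borel_measurable (dh \<Otimes>\<^sub>M density D w)" by measurable
  have "(\<integral>\<^sup>+x. f x \<partial>orbit_measure c\<^sub>1 dh) = (\<integral>\<^sup>+p. f (\<Phi> p) \<partial>(dh \<Otimes>\<^sub>M density D w))"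
    unfolding om by (rule nn_integral_distr) measurable
  also have "\<dots> = (\<integral>\<^sup>+h. (\<integral>\<^sup>+t. f (\<Phi> (h, t)) \<partial>density D w) \<partial>dh)"
    by (rule D.nn_integral_fst[symmetric, OF fP])
  finally have fubini: "(\<integral>\<^sup>+x. f x \<partial>orbit_measure c\<^sub>1 dh) = \<dots>" .
  have restr: "(\<integral>\<^sup>+t. ennreal (t powr (s - 1)) * f (\<Phi> (h, t)) \<partial>D) =
      (\<integral>\<^sup>+t\<in>{0<..}. f (blinfun_apply h (t *\<^sub>R c\<^sub>1)) * ennreal (t powr (s - 1)) \<partial>lborel)" for h
    unfolding D_def by (subst nn_integral_restrict_space) (auto simp: \<Phi>_def mult_ac)
  have "(\<lambda>h. \<integral>\<^sup>+t. ennreal (t powr (s - 1)) * f (\<Phi> (h, t)) \<partial>D) \<in> borel_measurable dh"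
  proof -
    have "(\<lambda>p. f (\<Phi> p)) \<in> borel_measurable (dh \<Otimes>\<^sub>M D)"
      using fP by (simp cong: measurable_cong_sets sets_pair_measure_cong)
    hence "(\<lambda>p. ennreal (snd p powr (s - 1)) * f (\<Phi> p)) \<in> borel_measurable (dh \<Otimes>\<^sub>M D)"
      by measurable
    from sigma_finite_measure.borel_measurable_nn_integral_fst[OF sf this] show ?thesis by simp
  qed
  hence meas: "(\<lambda>h. \<integral>\<^sup>+t\<in>{0<..}. f (blinfun_apply h (t *\<^sub>R c\<^sub>1)) * ennreal (t powr (s - 1)) \<partial>lborel)
      \<in> borel_measurable dh"
    by (simp add: restr)
  have "(\<integral>\<^sup>+x. f x \<partial>orbit_measure c\<^sub>1 dh) = (\<integral>\<^sup>+h. (\<integral>\<^sup>+t. f (\<Phi> (h, t)) \<partial>density D w) \<partial>dh)"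
    by (rule fubini)
  also have "\<dots> = (\<integral>\<^sup>+h. ennreal (2 powr s / Gamma s) *
      (\<integral>\<^sup>+t\<in>{0<..}. f (blinfun_apply h (t *\<^sub>R c\<^sub>1)) * ennreal (t powr (s - 1)) \<partial>lborel) \<partial>dh)"
  proof (rule nn_integral_cong)
    fix h assume h: "h \<in> space dh"
    have fh: "(\<lambda>t. f (\<Phi> (h, t))) \<in> borel_measurable D"
      using measurable_Pair2[OF fP h] by simp
    have "(\<integral>\<^sup>+t. f (\<Phi> (h, t)) \<partial>density D w) = (\<integral>\<^sup>+t. w t * f (\<Phi> (h, t)) \<partial>D)"
      by (rule nn_integral_density[OF w fh])
    also have "\<dots> = (\<integral>\<^sup>+t. ennreal (2 powr s / Gamma s) * (ennreal (t powr (s - 1)) * f (\<Phi> (h, t))) \<partial>D)"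
      using spos unfolding w_def
      by (subst ennreal_mult) (auto simp: mult.assoc Gamma_real_pos less_imp_le)
    also have "\<dots> = ennreal (2 powr s / Gamma s) * (\<integral>\<^sup>+t. ennreal (t powr (s - 1)) * f (\<Phi> (h, t)) \<partial>D)"
      by (rule nn_integral_cmult) (use fh in measurable)
    also note restr
    finally show "(\<integral>\<^sup>+t. f (\<Phi> (h, t)) \<partial>density D w) = ennreal (2 powr s / Gamma s) *
      (\<integral>\<^sup>+t\<in>{0<..}. f (blinfun_apply h (t *\<^sub>R c\<^sub>1)) * ennreal (t powr (s - 1)) \<partial>lborel)" .
  qed
  also have "\<dots> = ennreal (2 powr s / Gamma s) *
    (\<integral>\<^sup>+h. (\<integral>\<^sup>+t\<in>{0<..}. f (blinfun_apply h (t *\<^sub>R c\<^sub>1)) * ennreal (t powr (s - 1)) \<partial>lborel) \<partial>dh)"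
    by (rule nn_integral_cmult[OF meas])
  finally show ?thesis .
qed

end

theory Submission
  imports Defs "HOL-Computational_Algebra.Polynomial"
begin

text \<open>The folding map sends Lebesgue measure on F^k to a multiple of the measure on the orbit: in polar
  coordinates both have the same radial part, and the angular parts are two probability measures on
  the rank-one projections that are invariant under a transitive group of isometries, hence equal.
  After this change of variables, the integrands of the two transforms still differ: one contains
  the Bessel function at (z z*|x x*) = w \<bullet> w, with w = x* z, the other the exponential of
  2 z \<bullet> x. As f (x x*) does not change when x is replaced by x q with |q| = 1, and
  z \<bullet> (x q) = w \<bullet> q, the exponential may be averaged over the unit sphere of F. The average is
  computed from the moments of the sphere, and it is the Bessel function.\<close>

section \<open>Lebesgue measure and isometries\<close>

text \<open>Two obstacles shape the proof. The measure \<open>dh\<close> is known only through left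
  invariance on \<open>K_L\<close>, a stabilizer inside an identity component, so elements that
  carry one projection to another have to be exhibited there: they are congruences by products of
  two reflections, and moving the two unit vectors together joins such a product to the identity.
  Over the quaternions the order of factors matters, so scalars act from the right and adjoints
  replace commutation. The constants fit as follows. With t = |x|^2, Lebesgue measure on F^k has
  radial density proportional to t^(dk/2 - 1), and dk/2 is the exponent r lambda of the orbit
  measure. The unit sphere of F sits in dimension d, so its average produces the Bessel function of
  index d/2 - 1 = lambda - 1, multiplied by the Gamma(lambda) that normalizes the transform. The
  traces of x x* and z z* are |x|^2 and z . z, so Gaussian weights and prefactors agree. The scalar
  is (2/pi)^(dk/2).\<close>

lemma nn_integral_lborel_translate:
  fixes c :: "'a::euclidean_space"
  assumes [measurable]: "g \<in> borel_measurable borel"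
  shows "(\<integral>\<^sup>+x. g (c + x) \<partial>lborel) = (\<integral>\<^sup>+x. g x \<partial>lborel)"
proof -
  have "(\<integral>\<^sup>+x. g x \<partial>lborel) = (\<integral>\<^sup>+x. g x \<partial>distr lborel borel ((+) c))"
    by (simp add: lborel_distr_plus)
  also have "\<dots> = (\<integral>\<^sup>+x. g (c + x) \<partial>lborel)"
    by (subst nn_integral_distr) auto
  finally show ?thesis ..
qed

lemma nn_integral_lborel_scaleR:
  assumes [measurable]: "g \<in> borel_measurable borel" and c: "c \<noteq> 0"
  shows "(\<integral>\<^sup>+x. g x \<partial>lborel) =
    ennreal (\<bar>c\<bar> ^ DIM('a)) * (\<integral>\<^sup>+x. g (c *\<^sub>R x) \<partial>(lborel :: 'a::euclidean_space measure))"
  by (subst lborel_affine[OF c, of 0])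
     (simp add: nn_integral_density nn_integral_distr nn_integral_cmult)

lemma emeasure_lborel_ball_01:
  "emeasure lborel (ball 0 1 :: 'a::euclidean_space set) \<noteq> 0"
  "emeasure lborel (ball 0 1 :: 'a::euclidean_space set) < \<infinity>"
proof -
  show "emeasure lborel (ball 0 1 :: 'a set) < \<infinity>"
    by (rule emeasure_bounded_finite) simp
  have "measure lborel (ball (0::'a) 1) > 0"
    using content_ball_pos[of 1 "0::'a"] by simp
  thus "emeasure lborel (ball 0 1 :: 'a set) \<noteq> 0"
    by (auto simp: measure_def)
qed

text \<open>The image of Lebesgue measure under an isometry is translation invariant; comparing the two
  measures on the unit ball by Fubini shows that they agree.\<close>

lemma nn_integral_lborel_isometry:
  fixes T :: "'a::euclidean_space \<Rightarrow> 'a"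
  assumes T: "linear T" "\<And>x. norm (T x) = norm x"
    and [measurable]: "g \<in> borel_measurable borel"
  shows "(\<integral>\<^sup>+x. g (T x) \<partial>lborel) = (\<integral>\<^sup>+x. g x \<partial>lborel)"
proof -
  define f :: "'a \<Rightarrow> ennreal" where "f = indicator (ball 0 1)"
  define V where "V = (\<integral>\<^sup>+x. f x \<partial>lborel)"
  have fm: "f \<in> borel_measurable borel" unfolding f_def by (rule borel_measurable_indicator) simp
  note fm[measurable]
  have "T x = 0 \<Longrightarrow> x = 0" for x using T(2)[of x] by simp
  hence "inj T" using T(1) linear_injective_0 by blast
  hence "surj T" using T(1) linear_injective_imp_surjective by blast
  hence S: "\<exists>y. T y = z" for z by (metis surjD)
  have [measurable]: "T \<in> borel_measurable borel"
    using T(1) by (intro borel_measurable_continuous_onI linear_continuous_on)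
      (simp add: linear_conv_bounded_linear)
  have fT: "f (T x) = f x" for x using T(2)[of x] by (simp add: f_def indicator_def)
  have f_even: "f (a - b) = f (b - a)" for a b
    by (simp add: f_def indicator_def dist_norm norm_minus_commute)
  have V: "V \<noteq> 0" "V < \<infinity>"
    using emeasure_lborel_ball_01[where 'a = 'a] by (auto simp: V_def f_def)
  have "V * (\<integral>\<^sup>+x. g x \<partial>lborel) = (\<integral>\<^sup>+x. f (T x) * (\<integral>\<^sup>+y. g y \<partial>lborel) \<partial>lborel)"
    by (simp add: fT V_def nn_integral_multc)
  also have "\<dots> = (\<integral>\<^sup>+x. (\<integral>\<^sup>+y. f (T x) * g (T x + y) \<partial>lborel) \<partial>lborel)"
    by (subst nn_integral_cmult) (simp_all add: nn_integral_lborel_translate)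
  also have "\<dots> = (\<integral>\<^sup>+y. (\<integral>\<^sup>+x. f (T x) * g (T x + y) \<partial>lborel) \<partial>lborel)"
    by (rule lborel_pair.Fubini'[symmetric]) measurable
  \<comment> \<open>For fixed y a point c with T c = - y exists because T is onto; translating x by
    it moves y from the argument of g into that of f. Integration over y then sees only f and gives
    V.\<close>
  also have "\<dots> = (\<integral>\<^sup>+y. (\<integral>\<^sup>+x. f (T x - y) * g (T x) \<partial>lborel) \<partial>lborel)"
  proof (rule nn_integral_cong)
    fix y
    obtain c where c: "T c = - y" using S by blast
    have "(\<integral>\<^sup>+x. f (T x) * g (T x + y) \<partial>lborel) = (\<integral>\<^sup>+x. f (T (c + x)) * g (T (c + x) + y) \<partial>lborel)"
      by (subst nn_integral_lborel_translate) auto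
    thus "(\<integral>\<^sup>+x. f (T x) * g (T x + y) \<partial>lborel) = (\<integral>\<^sup>+x. f (T x - y) * g (T x) \<partial>lborel)"
      by (simp add: linear_add[OF T(1)] c)
  qed
  also have "\<dots> = (\<integral>\<^sup>+x. (\<integral>\<^sup>+y. f (T x - y) * g (T x) \<partial>lborel) \<partial>lborel)"
    by (rule lborel_pair.Fubini') measurable
  also have "\<dots> = (\<integral>\<^sup>+x. V * g (T x) \<partial>lborel)"
  proof (rule nn_integral_cong)
    fix x
    have "(\<integral>\<^sup>+y. f (T x - y) * g (T x) \<partial>lborel) = (\<integral>\<^sup>+y. f (- T x + y) \<partial>lborel) * g (T x)"
      by (subst nn_integral_multc) (simp_all add: f_even[of "T x"])
    thus "(\<integral>\<^sup>+y. f (T x - y) * g (T x) \<partial>lborel) = V * g (T x)"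
      by (subst (asm) nn_integral_lborel_translate) (simp_all add: V_def)
  qed
  also have "\<dots> = V * (\<integral>\<^sup>+x. g (T x) \<partial>lborel)"
    by (rule nn_integral_cmult) measurable
  finally show ?thesis using V by (auto simp add: ennreal_mult_cancel_left)
qed

text \<open>The form needed for complex-valued integrals, where the substitution is made through the
  image measure.\<close>

lemma lborel_distr_isometry:
  fixes T :: "'a::euclidean_space \<Rightarrow> 'a"
  assumes T: "linear T" "\<And>x. norm (T x) = norm x"
  shows "distr lborel borel T = lborel"
proof (rule measure_eqI)
  have [measurable]: "T \<in> borel_measurable borel"
    using T(1) by (intro borel_measurable_continuous_onI linear_continuous_on)
      (simp add: linear_conv_bounded_linear)
  fix A assume "A \<in> sets (distr lborel borel T)"
  hence [measurable]: "A \<in> sets borel" by simp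
  have "emeasure (distr lborel borel T) A = (\<integral>\<^sup>+x. indicator A x \<partial>distr lborel borel T)"
    by simp
  also have "\<dots> = (\<integral>\<^sup>+x. indicator A (T x) \<partial>lborel)"
    by (subst nn_integral_distr) auto
  also have "\<dots> = (\<integral>\<^sup>+x. indicator A x \<partial>lborel)"
    by (rule nn_integral_lborel_isometry[OF T]) auto
  finally show "emeasure (distr lborel borel T) A = emeasure lborel A" by simp
qed simp

section \<open>Measures with equal balls\<close>

text \<open>Integrating the indicator of \<open>dist x y < r\<close> over M and N in both orders
  gives a r = b r. Restricting x to the points whose r-ball lies in U gives the inequality for a
  shrunken copy of U, and these copies exhaust U as r tends to 0.\<close>

lemma emeasure_le_of_equal_balls:
  fixes M N :: "'a::{metric_space, second_countable_topology} measure"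
  assumes M: "prob_space M" "sets M = sets borel" "AE x in M. x \<in> X"
    and N: "prob_space N" "sets N = sets borel" "AE x in N. x \<in> X"
    and a: "\<And>x r. x \<in> X \<Longrightarrow> emeasure M (ball x r) = a r"
    and b: "\<And>x r. x \<in> X \<Longrightarrow> emeasure N (ball x r) = b r"
    and U: "open U"
  shows "emeasure M U \<le> emeasure N U"
proof -
  interpret M: prob_space M by fact
  interpret N: prob_space N by fact
  interpret pair_sigma_finite M N ..
  note [measurable_cong] = M(2) N(2)
  have spM: "space M = UNIV" and spN: "space N = UNIV"
    using sets_eq_imp_space_eq[OF M(2)] sets_eq_imp_space_eq[OF N(2)] by auto
  have ab: "a r = b r" for r
  proof -
    have [measurable]: "(\<lambda>(x, y). indicator {p. dist (fst p) (snd p) < r} (x, y) :: ennreal) \<in>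
        borel_measurable (M \<Otimes>\<^sub>M N)"
      unfolding indicator_def by measurable
    have "a r = (\<integral>\<^sup>+y. a r \<partial>N)" by (simp add: N.emeasure_space_1)
    also have "\<dots> = (\<integral>\<^sup>+y. emeasure M (ball y r) \<partial>N)"
      by (rule nn_integral_cong_AE) (use N(3) a in auto)
    also have "\<dots> = (\<integral>\<^sup>+y. \<integral>\<^sup>+x. indicator {p. dist (fst p) (snd p) < r} (x, y) \<partial>M \<partial>N)"
      by (auto intro!: nn_integral_cong simp: M(2) dist_commute indicator_def
          simp flip: nn_integral_indicator)
    also have "\<dots> = (\<integral>\<^sup>+x. \<integral>\<^sup>+y. indicator {p. dist (fst p) (snd p) < r} (x, y) \<partial>N \<partial>M)"
      by (rule Fubini') measurable
    also have "\<dots> = (\<integral>\<^sup>+x. emeasure N (ball x r) \<partial>M)"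
      by (auto intro!: nn_integral_cong simp: N(2) indicator_def
          simp flip: nn_integral_indicator)
    also have "\<dots> = (\<integral>\<^sup>+x. b r \<partial>M)"
      by (rule nn_integral_cong_AE) (use M(3) b in auto)
    finally show ?thesis by (simp add: M.emeasure_space_1)
  qed
  \<comment> \<open>By Lindelof countably many r-balls centred in X cover X; if they were null sets,
    M would be zero.\<close>
  have pos: "a r \<noteq> 0" if "r > 0" for r
  proof
    assume 0: "a r = 0"
    obtain F where F: "F \<subseteq> (\<lambda>x. ball x r) ` X" "countable F" "\<Union>F = \<Union>((\<lambda>x. ball x r) ` X)"
      by (rule Lindelof[of "(\<lambda>x. ball x r) ` X"]) auto
    have "emeasure M (\<Union>F) = 0"
    proof -
      have "\<Union>F \<in> null_sets M"
        using F(1,2) a 0 by (intro null_sets_UN'[of F id, simplified]) (auto simp: null_sets_def M(2))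
      thus ?thesis by (rule null_setsD1)
    qed
    moreover have "X \<subseteq> \<Union>F" using F(3) that by auto
    moreover have "\<Union>F \<in> sets M" using F(1,2) by (intro sets.countable_Union) (auto simp: M(2))
    ultimately have "AE x in M. x \<notin> \<Union>F" by (intro AE_not_in) (auto simp: null_sets_def)
    with M(3) have "AE x in M. False"
      by eventually_elim (use \<open>X \<subseteq> \<Union>F\<close> in blast)
    thus False using M.AE_False by simp
  qed
  have fin: "a r < \<infinity>" if "x \<in> X" for x r
    using a[OF that, of r, symmetric] M.emeasure_finite[of "ball x r"] by (simp add: less_top[symmetric])
  \<comment> \<open>If x lies in \<open>U' r\<close> and dist x y < r, then y lies in U. This passes
    from a condition on x to one on y after Fubini. The set is closed, hence measurable.\<close>
  define U' where "U' r = {x. ball x r \<subseteq> U}" for r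
  have cl: "closed (U' r)" for r
  proof -
    have "- U' r = (\<Union>y\<in>- U. ball y r)" by (auto simp: U'_def dist_commute)
    hence "open (- U' r)" by auto
    thus ?thesis by (simp add: closed_def)
  qed
  have le: "emeasure M (U' r) \<le> emeasure N U" if "r > 0" for r
  proof -
    have [measurable]: "U' r \<in> sets borel" "U \<in> sets borel" using cl U by auto
    have [measurable]: "(\<lambda>(x, y). indicator (U' r) x * indicator {p. dist (fst p) (snd p) < r} (x, y) :: ennreal) \<in>
        borel_measurable (M \<Otimes>\<^sub>M N)"
      unfolding indicator_def by measurable
    have "emeasure M (U' r) * a r = (\<integral>\<^sup>+x. indicator (U' r) x * b r \<partial>M)"
      by (simp add: ab nn_integral_multc M(2))
    also have "\<dots> = (\<integral>\<^sup>+x. indicator (U' r) x * emeasure N (ball x r) \<partial>M)"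
      by (rule nn_integral_cong_AE) (use M(3) b in auto)
    also have "\<dots> = (\<integral>\<^sup>+x. \<integral>\<^sup>+y. indicator (U' r) x * indicator {p. dist (fst p) (snd p) < r} (x, y) \<partial>N \<partial>M)"
      by (auto intro!: nn_integral_cong simp: N(2) indicator_def
          simp flip: nn_integral_indicator)
    also have "\<dots> = (\<integral>\<^sup>+y. \<integral>\<^sup>+x. indicator (U' r) x * indicator {p. dist (fst p) (snd p) < r} (x, y) \<partial>M \<partial>N)"
      by (rule Fubini'[symmetric]) measurable
    also have "\<dots> \<le> (\<integral>\<^sup>+y. \<integral>\<^sup>+x. indicator U y * indicator (ball y r) x \<partial>M \<partial>N)"
      by (intro nn_integral_mono) (auto simp: indicator_def U'_def dist_commute)
    also have "\<dots> = (\<integral>\<^sup>+y. indicator U y * emeasure M (ball y r) \<partial>N)"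
    proof (rule nn_integral_cong)
      fix y
      have "ball y r \<in> sets M" by (simp add: M(2))
      thus "(\<integral>\<^sup>+x. indicator U y * indicator (ball y r) x \<partial>M) = indicator U y * emeasure M (ball y r)"
        by (subst nn_integral_cmult_indicator) auto
    qed
    also have "\<dots> = (\<integral>\<^sup>+y. indicator U y * a r \<partial>N)"
      by (rule nn_integral_cong_AE) (use N(3) a in auto)
    also have "\<dots> = emeasure N U * a r"
      by (simp add: nn_integral_multc N(2))
    finally have *: "emeasure M (U' r) * a r \<le> emeasure N U * a r" .
    have "X \<noteq> {}" using M(3) M.AE_False by auto
    then obtain x where "x \<in> X" by auto
    hence "a r \<noteq> \<infinity>" using fin[of x r] by simp
    with * pos[OF that] show ?thesis
      by (subst ennreal_mult_le_mult_iff[of "a r", symmetric]) (simp_all add: mult.commute)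
  qed
  have inc: "incseq (\<lambda>n. U' (inverse (real (Suc n))))"
  proof (rule incseq_SucI)
    fix n
    have "inverse (real (Suc (Suc n))) \<le> inverse (real (Suc n))" by (simp add: field_simps)
    thus "U' (inverse (real (Suc n))) \<subseteq> U' (inverse (real (Suc (Suc n))))"
      unfolding U'_def using subset_ball by blast
  qed
  have UN: "(\<Union>n. U' (inverse (real (Suc n)))) = U"
  proof
    show "(\<Union>n. U' (inverse (real (Suc n)))) \<subseteq> U"
    proof (clarify)
      fix n x assume "x \<in> U' (inverse (real (Suc n)))"
      moreover have "x \<in> ball x (inverse (real (Suc n)))" by simp
      ultimately show "x \<in> U" unfolding U'_def by blast
    qed
    show "U \<subseteq> (\<Union>n. U' (inverse (real (Suc n))))"
    proof
      fix x assume "x \<in> U"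
      then obtain e where e: "e > 0" "ball x e \<subseteq> U" using U open_contains_ball by blast
      obtain n where "inverse (real (Suc n)) < e" using reals_Archimedean[OF e(1)] by blast
      hence "ball x (inverse (real (Suc n))) \<subseteq> ball x e" by (intro subset_ball) simp
      with e(2) have "x \<in> U' (inverse (real (Suc n)))" unfolding U'_def by blast
      thus "x \<in> (\<Union>n. U' (inverse (real (Suc n))))" by blast
    qed
  qed
  have "(SUP n. emeasure M (U' (inverse (real (Suc n))))) = emeasure M U"
    unfolding UN[symmetric] by (rule SUP_emeasure_incseq) (use inc cl M(2) in auto)
  moreover have "(SUP n. emeasure M (U' (inverse (real (Suc n))))) \<le> emeasure N U"
    by (rule SUP_least) (simp add: le)
  ultimately show ?thesis by simp
qed

text \<open>Christensen's uniqueness argument for measures in which all balls of the same radius have the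
  same measure. It spares the Haar measure of a group acting transitively by isometries.\<close>

lemma measure_eq_of_equal_balls:
  fixes M N :: "'a::{metric_space, second_countable_topology} measure"
  assumes M: "prob_space M" "sets M = sets borel" "AE x in M. x \<in> X"
    and N: "prob_space N" "sets N = sets borel" "AE x in N. x \<in> X"
    and a: "\<And>x y r. x \<in> X \<Longrightarrow> y \<in> X \<Longrightarrow> emeasure M (ball x r) = emeasure M (ball y r)"
    and b: "\<And>x y r. x \<in> X \<Longrightarrow> y \<in> X \<Longrightarrow> emeasure N (ball x r) = emeasure N (ball y r)"
  shows "M = N"
proof (rule measure_eqI_generator_eq[where E = "{U. open U}" and A = "\<lambda>_. UNIV" and \<Omega> = UNIV])
  interpret M: prob_space M by fact
  have "X \<noteq> {}" using M(3) M.AE_False by auto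
  then obtain x0 where x0: "x0 \<in> X" by auto
  show "Int_stable {U :: 'a set. open U}" by (auto simp: Int_stable_def)
  show "emeasure M U = emeasure N U" if "U \<in> {U. open U}" for U
  proof -
    have U: "open U" using that by simp
    show ?thesis
    proof (rule antisym)
      show "emeasure M U \<le> emeasure N U"
        by (rule emeasure_le_of_equal_balls[OF M N a[OF _ x0] b[OF _ x0] U])
      show "emeasure N U \<le> emeasure M U"
        by (rule emeasure_le_of_equal_balls[OF N M b[OF _ x0] a[OF _ x0] U])
    qed
  qed
  show "emeasure M UNIV \<noteq> \<infinity>" by simp
  show "sets M = sigma_sets UNIV {U. open U}" "sets N = sigma_sets UNIV {U. open U}"
    by (simp_all add: M(2) N(2) sets_borel)
qed simp_all

section \<open>Polar coordinates\<close>

abbreviation uniform_ball :: "'a::euclidean_space measure" where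
  "uniform_ball \<equiv> uniform_measure lborel (cball 0 1)"

lemma emeasure_lborel_cball_01:
  "emeasure lborel (cball 0 1 :: 'a::euclidean_space set) \<noteq> 0"
  "emeasure lborel (cball 0 1 :: 'a::euclidean_space set) \<noteq> \<infinity>"
proof -
  have "emeasure lborel (cball 0 1 :: 'a set) < \<infinity>"
    by (rule emeasure_bounded_finite) simp
  thus "emeasure lborel (cball 0 1 :: 'a set) \<noteq> \<infinity>" by simp
  have "emeasure lborel (ball 0 1 :: 'a set) \<le> emeasure lborel (cball 0 1 :: 'a set)"
    by (rule emeasure_mono) auto
  thus "emeasure lborel (cball 0 1 :: 'a set) \<noteq> 0"
    using emeasure_lborel_ball_01(1)[where 'a = 'a] by auto
qed

lemma measure_lborel_cball_01: "measure lborel (cball 0 1 :: 'a::euclidean_space set) > 0"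
  using emeasure_lborel_cball_01[where 'a = 'a]
  by (simp add: measure_def enn2real_positive_iff top.not_eq_extremum zero_less_iff_neq_zero)

lemma prob_space_uniform_ball: "prob_space (uniform_ball :: 'a::euclidean_space measure)"
  using emeasure_lborel_cball_01[where 'a = 'a] by (rule prob_space_uniform_measure)

text \<open>At q = 0 the direction \<open>sgn q\<close> is 0 and not a unit vector; this null set is
  discarded wherever a unit direction is needed.\<close>

lemma AE_uniform_ball_nonzero: "AE q in (uniform_ball :: 'a::euclidean_space measure). q \<noteq> 0"
proof (rule AE_uniform_measureI)
  have "AE q in lborel. (q :: 'a) \<noteq> 0" by (rule AE_lborel_singleton)
  thus "AE q in lborel. (q :: 'a) \<in> cball 0 1 \<longrightarrow> q \<noteq> 0" by eventually_elim simp
qed simp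

lemma nn_integral_uniform_ball_isometry:
  fixes T :: "'a::euclidean_space \<Rightarrow> 'a"
  assumes T: "linear T" "\<And>x. norm (T x) = norm x"
    and [measurable]: "g \<in> borel_measurable borel"
  shows "(\<integral>\<^sup>+x. g (T x) \<partial>uniform_ball) = (\<integral>\<^sup>+x. g x \<partial>uniform_ball)"
proof -
  have [measurable]: "T \<in> borel_measurable borel"
    using T(1) by (intro borel_measurable_continuous_onI linear_continuous_on)
      (simp add: linear_conv_bounded_linear)
  have [measurable]: "cball (0::'a) 1 \<in> sets borel" by simp
  have "(\<integral>\<^sup>+x. g (T x) * indicator (cball 0 1) (T x) \<partial>lborel) = (\<integral>\<^sup>+x. g x * indicator (cball 0 1) x \<partial>lborel)"
    by (rule nn_integral_lborel_isometry[OF T]) measurable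
  moreover have "indicator (cball 0 1) (T x) = (indicator (cball 0 1) x :: ennreal)" for x
    using T(2)[of x] by (simp add: indicator_def)
  ultimately show ?thesis by (simp add: nn_integral_uniform_measure)
qed

lemma distr_uniform_ball_isometry:
  fixes T :: "'a::euclidean_space \<Rightarrow> 'a"
  assumes T: "linear T" "\<And>x. norm (T x) = norm x"
  shows "distr uniform_ball borel T = uniform_ball"
proof (rule measure_eqI)
  have [measurable]: "T \<in> borel_measurable borel"
    using T(1) by (intro borel_measurable_continuous_onI linear_continuous_on)
      (simp add: linear_conv_bounded_linear)
  fix A assume "A \<in> sets (distr uniform_ball borel T)"
  hence [measurable]: "A \<in> sets borel" by simp
  have "emeasure (distr uniform_ball borel T) A = (\<integral>\<^sup>+x. indicator A x \<partial>distr uniform_ball borel T)"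
    by (subst nn_integral_indicator) simp_all
  also have "\<dots> = (\<integral>\<^sup>+x. indicator A (T x) \<partial>uniform_ball)"
    by (subst nn_integral_distr) auto
  also have "\<dots> = (\<integral>\<^sup>+x. indicator A x \<partial>uniform_ball)"
    by (rule nn_integral_uniform_ball_isometry[OF T]) auto
  also have "\<dots> = emeasure uniform_ball A"
    by (subst nn_integral_indicator) simp_all
  finally show "emeasure (distr uniform_ball borel T) A = emeasure uniform_ball A" .
qed simp

text \<open>Polar coordinates, with t the square of the radius. The direction \<^term>\<open>sgn q\<close> of a uniformly
  distributed point q of the ball replaces the surface measure of the sphere.\<close>

lemma nn_integral_polar:
  fixes F :: "'a::euclidean_space \<Rightarrow> ennreal"
  assumes [measurable]: "F \<in> borel_measurable borel"
  defines "s \<equiv> real DIM('a) / 2"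
  shows "(\<integral>\<^sup>+q. (\<integral>\<^sup>+t. indicator {0<..} t * (F (sqrt t *\<^sub>R sgn q) * ennreal (t powr (s - 1))) \<partial>lborel) \<partial>uniform_ball)
    = ennreal (1 / (s * measure lborel (cball (0::'a) 1))) * (\<integral>\<^sup>+x. F x \<partial>lborel)"
proof -
  define V where "V = measure lborel (cball (0::'a) 1)"
  have V: "V > 0" "emeasure lborel (cball (0::'a) 1) = ennreal V"
    using measure_lborel_cball_01 emeasure_lborel_cball_01(2)[where 'a = 'a]
    by (auto simp: V_def emeasure_eq_ennreal_measure)
  have s: "s > 0" by (simp add: s_def)
  have [measurable]: "cball (0::'a) 1 \<in> sets borel" by simp
  define N where "N = DIM('a)"
  have N: "x powr s = sqrt x ^ N" if "x > 0" for x
    using that by (simp add: s_def N_def powr_half_sqrt[symmetric] powr_powr flip: powr_realpow)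
  \<comment> \<open>Substituting |q|^2 t for t turns the direction \<open>sgn q\<close> back into q.
    The density contributes |q|^(2s-2) and dt contributes |q|^2, together |q|^N, as N = 2 s.\<close>
  have inner: "(\<integral>\<^sup>+t. indicator {0<..} t * (F (sqrt t *\<^sub>R sgn q) * ennreal (t powr (s - 1))) \<partial>lborel)
      = (\<integral>\<^sup>+t. indicator {0<..} t * (F (sqrt t *\<^sub>R q) * ennreal (norm q ^ N * t powr (s - 1))) \<partial>lborel)"
    if q: "q \<noteq> 0" for q :: 'a
  proof -
    have n: "(norm q)\<^sup>2 > 0" using q by simp
    have "(\<integral>\<^sup>+t. indicator {0<..} t * (F (sqrt t *\<^sub>R sgn q) * ennreal (t powr (s - 1))) \<partial>lborel) =
      ennreal ((norm q)\<^sup>2) * (\<integral>\<^sup>+t. indicator {0<..} (0 + (norm q)\<^sup>2 * t) *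
        (F (sqrt (0 + (norm q)\<^sup>2 * t) *\<^sub>R sgn q) * ennreal ((0 + (norm q)\<^sup>2 * t) powr (s - 1))) \<partial>lborel)"
      using n by (subst nn_integral_real_affine[where t = 0 and c = "(norm q)\<^sup>2"]) simp_all
    also have "\<dots> = (\<integral>\<^sup>+t. ennreal ((norm q)\<^sup>2) * (indicator {0<..} (0 + (norm q)\<^sup>2 * t) *
        (F (sqrt (0 + (norm q)\<^sup>2 * t) *\<^sub>R sgn q) * ennreal ((0 + (norm q)\<^sup>2 * t) powr (s - 1)))) \<partial>lborel)"
      by (rule nn_integral_cmult[symmetric]) measurable
    also have "\<dots> = (\<integral>\<^sup>+t. indicator {0<..} t * (F (sqrt t *\<^sub>R q) * ennreal (norm q ^ N * t powr (s - 1))) \<partial>lborel)"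
    proof (rule nn_integral_cong)
      fix t :: real
      show "ennreal ((norm q)\<^sup>2) * (indicator {0<..} (0 + (norm q)\<^sup>2 * t) *
          (F (sqrt (0 + (norm q)\<^sup>2 * t) *\<^sub>R sgn q) * ennreal ((0 + (norm q)\<^sup>2 * t) powr (s - 1)))) =
        indicator {0<..} t * (F (sqrt t *\<^sub>R q) * ennreal (norm q ^ N * t powr (s - 1)))"
      proof (cases "t > 0")
        case True
        have "sqrt ((norm q)\<^sup>2 * t) *\<^sub>R sgn q = sqrt t *\<^sub>R q"
          using q by (simp add: real_sqrt_mult sgn_div_norm)
        moreover have "(norm q)\<^sup>2 * ((norm q)\<^sup>2 * t) powr (s - 1) = norm q ^ N * t powr (s - 1)"
        proof -
          have "(norm q)\<^sup>2 * ((norm q)\<^sup>2 * t) powr (s - 1) =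
              ((norm q)\<^sup>2 powr 1 * (norm q)\<^sup>2 powr (s - 1)) * t powr (s - 1)"
            using n by (simp add: powr_mult)
          also have "(norm q)\<^sup>2 powr 1 * (norm q)\<^sup>2 powr (s - 1) = (norm q)\<^sup>2 powr s"
            by (subst powr_add[symmetric]) simp
          also have "\<dots> = norm q ^ N" using n by (subst N) auto
          finally show ?thesis .
        qed
        ultimately show ?thesis
          using True n by (simp add: mult.left_commute zero_less_mult_iff flip: ennreal_mult)
      qed (use n in \<open>simp add: zero_less_mult_iff\<close>)
    qed
    finally show ?thesis .
  qed
  \<comment> \<open>This remains for fixed y = sqrt t q after the integrals are exchanged; the
    factor t^(-s) is the Jacobian. The ball condition says t >= |y|^2, and the tail integral of
    t^(-s-1) is |y|^(-2s) / s, which cancels |y|^N.\<close>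
  have radial: "(\<integral>\<^sup>+t. indicator {0<..} t * (indicator (cball 0 1) (y /\<^sub>R sqrt t) *
      ennreal (norm (y /\<^sub>R sqrt t) ^ N * t powr (s - 1) * t powr (- s))) \<partial>lborel) = ennreal (1 / s)"
    if y: "y \<noteq> 0" for y :: 'a
  proof -
    have n: "(norm y)\<^sup>2 > 0" using y by simp
    have "(\<integral>\<^sup>+t. indicator {0<..} t * (indicator (cball 0 1) (y /\<^sub>R sqrt t) *
      ennreal (norm (y /\<^sub>R sqrt t) ^ N * t powr (s - 1) * t powr (- s))) \<partial>lborel) =
      (\<integral>\<^sup>+t. ennreal (norm y ^ N * t powr (- s - 1)) * indicator {(norm y)\<^sup>2..} t \<partial>lborel)"
    proof (rule nn_integral_cong)
      fix t :: real
      show "indicator {0<..} t * (indicator (cball 0 1) (y /\<^sub>R sqrt t) *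
          ennreal (norm (y /\<^sub>R sqrt t) ^ N * t powr (s - 1) * t powr (- s))) =
        ennreal (norm y ^ N * t powr (- s - 1)) * indicator {(norm y)\<^sup>2..} t"
      proof (cases "t > 0")
        case True
        have "y /\<^sub>R sqrt t \<in> cball 0 1 \<longleftrightarrow> norm y \<le> sqrt t"
          using True by (simp add: field_simps)
        also have "\<dots> \<longleftrightarrow> (norm y)\<^sup>2 \<le> t"
          using True by (metis norm_ge_zero real_le_rsqrt real_sqrt_le_iff real_sqrt_abs abs_norm_cancel)
        finally have a: "y /\<^sub>R sqrt t \<in> cball 0 1 \<longleftrightarrow> t \<in> {(norm y)\<^sup>2..}" by simp
        have "norm (y /\<^sub>R sqrt t) ^ N = norm y ^ N / sqrt t ^ N"
          using True by (simp add: power_divide divide_inverse_commute[symmetric] power_mult_distrib field_simps)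
        also have "\<dots> = norm y ^ N * t powr (- s)"
          using True by (simp add: N[symmetric] powr_minus divide_inverse)
        finally have "norm (y /\<^sub>R sqrt t) ^ N * t powr (s - 1) * t powr (- s) =
            norm y ^ N * (t powr (- s) * t powr (s - 1) * t powr (- s))" by simp
        also have "t powr (- s) * t powr (s - 1) * t powr (- s) = t powr (- s - 1)"
        proof -
          have "- s + (s - 1) + - s = - s - 1" by simp
          thus ?thesis by (simp only: powr_add[symmetric])
        qed
        finally have b: "norm (y /\<^sub>R sqrt t) ^ N * t powr (s - 1) * t powr (- s) = norm y ^ N * t powr (- s - 1)" .
        show ?thesis unfolding b using True a by (simp add: indicator_def del: mem_cball_0)
      next
        case False
        hence "\<not> (norm y)\<^sup>2 \<le> t" using n by linarith
        thus ?thesis using False by simp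
      qed
    qed
    also have "\<dots> = ennreal (0 - (- (norm y ^ N) / s * (norm y)\<^sup>2 powr (- s)))"
    proof (rule nn_integral_FTC_atLeast)
      show "((\<lambda>t. - (norm y ^ N) / s * t powr (- s)) \<longlongrightarrow> 0) at_top"
        by (intro tendsto_mult_right_zero tendsto_neg_powr filterlim_ident) (use s in auto)
      fix t assume "(norm y)\<^sup>2 \<le> t"
      hence t: "t > 0" using n by linarith
      show "((\<lambda>t. - (norm y ^ N) / s * t powr (- s)) has_real_derivative norm y ^ N * t powr (- s - 1)) (at t)"
        using t s by (auto intro!: derivative_eq_intros)
    qed auto
    also have "0 - (- (norm y ^ N) / s * (norm y)\<^sup>2 powr (- s)) = 1 / s"
    proof -
      have "(norm y)\<^sup>2 powr (- s) = 1 / norm y ^ N"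
        using n by (simp add: powr_minus N divide_inverse)
      thus ?thesis using y by simp
    qed
    finally show ?thesis .
  qed
  have [measurable]: "(\<lambda>t. indicator {0<..} t :: ennreal) \<in> borel_measurable (borel :: real measure)" by simp
  have "(\<integral>\<^sup>+q. (\<integral>\<^sup>+t. indicator {0<..} t * (F (sqrt t *\<^sub>R sgn q) * ennreal (t powr (s - 1))) \<partial>lborel) \<partial>uniform_ball)
    = (\<integral>\<^sup>+q. (\<integral>\<^sup>+t. indicator {0<..} t * (F (sqrt t *\<^sub>R q) * ennreal (norm q ^ N * t powr (s - 1))) \<partial>lborel) \<partial>uniform_ball)"
    using AE_uniform_ball_nonzero by (intro nn_integral_cong_AE) (auto simp: inner)
  also have "\<dots> = (\<integral>\<^sup>+q. (\<integral>\<^sup>+t. indicator {0<..} t * (F (sqrt t *\<^sub>R q) * ennreal (norm q ^ N * t powr (s - 1))) \<partial>lborel)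
      * indicator (cball 0 1) q \<partial>lborel) / V"
    by (subst nn_integral_uniform_measure) (simp_all add: V)
  also have "(\<integral>\<^sup>+q. (\<integral>\<^sup>+t. indicator {0<..} t * (F (sqrt t *\<^sub>R q) * ennreal (norm q ^ N * t powr (s - 1))) \<partial>lborel)
      * indicator (cball 0 1) q \<partial>lborel) =
    (\<integral>\<^sup>+q. (\<integral>\<^sup>+t. indicator {0<..} t * (F (sqrt t *\<^sub>R q) * ennreal (norm q ^ N * t powr (s - 1)))
      * indicator (cball 0 1) q \<partial>lborel) \<partial>lborel)"
    by (intro nn_integral_cong nn_integral_multc[symmetric]) measurable
  also have "\<dots> = (\<integral>\<^sup>+t. (\<integral>\<^sup>+q. indicator {0<..} t * (F (sqrt t *\<^sub>R q) * ennreal (norm q ^ N * t powr (s - 1)))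
      * indicator (cball 0 1) q \<partial>lborel) \<partial>lborel)"
    by (rule lborel_pair.Fubini'[symmetric]) measurable
  also have "\<dots> = (\<integral>\<^sup>+t. (\<integral>\<^sup>+y. indicator {0<..} t * (F y * ennreal (norm (y /\<^sub>R sqrt t) ^ N * t powr (s - 1) * t powr (- s)))
      * indicator (cball 0 1) (y /\<^sub>R sqrt t) \<partial>lborel) \<partial>lborel)"
  proof (rule nn_integral_cong)
    fix t :: real
    show "(\<integral>\<^sup>+q. indicator {0<..} t * (F (sqrt t *\<^sub>R q) * ennreal (norm q ^ N * t powr (s - 1)))
          * indicator (cball 0 1) q \<partial>lborel) =
      (\<integral>\<^sup>+y. indicator {0<..} t * (F y * ennreal (norm (y /\<^sub>R sqrt t) ^ N * t powr (s - 1) * t powr (- s)))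
          * indicator (cball 0 1) (y /\<^sub>R sqrt t) \<partial>lborel)"
    proof (cases "t > 0")
      case True
      have "(\<integral>\<^sup>+y. indicator {0<..} t * (F y * ennreal (norm (y /\<^sub>R sqrt t) ^ N * t powr (s - 1) * t powr (- s)))
          * indicator (cball 0 1) (y /\<^sub>R sqrt t) \<partial>lborel) =
        ennreal (\<bar>sqrt t\<bar> ^ N) * (\<integral>\<^sup>+q. indicator {0<..} t * (F (sqrt t *\<^sub>R q) * ennreal (norm ((sqrt t *\<^sub>R q) /\<^sub>R sqrt t) ^ N * t powr (s - 1) * t powr (- s)))
          * indicator (cball 0 1) ((sqrt t *\<^sub>R q) /\<^sub>R sqrt t) \<partial>lborel)"
        unfolding N_def using True by (subst nn_integral_lborel_scaleR[where c = "sqrt t"]) simp_all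
      also have "\<dots> = (\<integral>\<^sup>+q. ennreal (\<bar>sqrt t\<bar> ^ N) * (indicator {0<..} t * (F (sqrt t *\<^sub>R q) * ennreal (norm q ^ N * t powr (s - 1) * t powr (- s)))
          * indicator (cball 0 1) q) \<partial>lborel)"
        using True by (subst nn_integral_cmult) simp_all
      also have "\<dots> = (\<integral>\<^sup>+q. indicator {0<..} t * (F (sqrt t *\<^sub>R q) * ennreal (norm q ^ N * t powr (s - 1)))
          * indicator (cball 0 1) q \<partial>lborel)"
      proof (rule nn_integral_cong)
        fix q :: 'a
        have "\<bar>sqrt t\<bar> ^ N = t powr s" using True by (simp add: N)
        hence "\<bar>sqrt t\<bar> ^ N * t powr (- s) = 1" using True by (simp add: powr_minus)
        hence "ennreal (\<bar>sqrt t\<bar> ^ N) * ennreal (norm q ^ N * t powr (s - 1) * t powr (- s)) = ennreal (norm q ^ N * t powr (s - 1))"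
          by (simp add: mult_ac flip: ennreal_mult)
        thus "ennreal (\<bar>sqrt t\<bar> ^ N) * (indicator {0<..} t * (F (sqrt t *\<^sub>R q) * ennreal (norm q ^ N * t powr (s - 1) * t powr (- s)))
            * indicator (cball 0 1) q) = indicator {0<..} t * (F (sqrt t *\<^sub>R q) * ennreal (norm q ^ N * t powr (s - 1)))
            * indicator (cball 0 1) q"
          by (metis mult.assoc mult.left_commute)
      qed
      finally show ?thesis ..
    qed simp
  qed
  also have "\<dots> = (\<integral>\<^sup>+y. (\<integral>\<^sup>+t. indicator {0<..} t * (F y * ennreal (norm (y /\<^sub>R sqrt t) ^ N * t powr (s - 1) * t powr (- s)))
      * indicator (cball 0 1) (y /\<^sub>R sqrt t) \<partial>lborel) \<partial>lborel)"
    by (rule lborel_pair.Fubini'[symmetric]) measurable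
  also have "\<dots> = (\<integral>\<^sup>+y. F y * ennreal (1 / s) \<partial>lborel)"
  proof (rule nn_integral_cong_AE)
    have "AE y in lborel. (y :: 'a) \<noteq> 0" by (rule AE_lborel_singleton)
    thus "AE y in lborel. (\<integral>\<^sup>+t. indicator {0<..} t * (F y * ennreal (norm (y /\<^sub>R sqrt t) ^ N * t powr (s - 1) * t powr (- s)))
      * indicator (cball 0 1) (y /\<^sub>R sqrt t) \<partial>lborel) = F y * ennreal (1 / s)"
    proof eventually_elim
      case (elim y)
      show ?case
        by (subst radial[OF elim, symmetric], subst nn_integral_cmult[symmetric]) (simp_all add: mult_ac)
    qed
  qed
  also have "\<dots> = ennreal (1 / s) * (\<integral>\<^sup>+y. F y \<partial>lborel)"
    by (simp add: nn_integral_multc mult.commute)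
  also have "\<dots> / V = ennreal (1 / (s * V)) * (\<integral>\<^sup>+y. F y \<partial>lborel)"
  proof -
    have "ennreal (1 / (s * V)) = ennreal (1 / s) / ennreal V"
      using s V by (simp add: divide_ennreal)
    thus ?thesis by (simp add: divide_ennreal_def mult_ac)
  qed
  finally show ?thesis by (simp add: V_def)
qed

section \<open>Averages over the sphere\<close>

lemma nn_integral_Gamma_powr:
  fixes s :: real
  assumes "s > 0"
  shows "(\<integral>\<^sup>+t. indicator {0<..} t * ennreal (exp (- t) * t powr (s - 1)) \<partial>lborel) = ennreal (Gamma s)"
proof -
  have "AE t in lborel. t \<noteq> (0::real)" by (rule AE_lborel_singleton)
  hence "(\<integral>\<^sup>+t. indicator {0<..} t * ennreal (exp (- t) * t powr (s - 1)) \<partial>lborel) =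
    (\<integral>\<^sup>+t. ennreal (indicator {0..} t * t powr (s - 1) / exp t) \<partial>lborel)"
    by (intro nn_integral_cong_AE) (auto elim!: eventually_mono simp: indicator_def exp_minus field_simps)
  thus ?thesis by (simp add: Gamma_conv_nn_integral_real[OF assms])
qed

lemma inner_sgn_self: "x \<noteq> 0 \<Longrightarrow> sgn x \<bullet> sgn x = 1" for x :: "'a::real_inner"
  by (simp add: dot_square_norm norm_sgn)

text \<open>Half of the Gaussian absorbs the exponential growth, by (|x| - c)^2 >= 0. The result is
  the majorant for the Gaussian moments and for the kernel of the classical transform.\<close>

lemma integrable_gaussian:
  fixes c :: real
  shows "integrable lborel (\<lambda>x::'a::euclidean_space. exp (c * norm x - x \<bullet> x))"
proof -
  define s where "s = real DIM('a) / 2"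
  define F :: "'a \<Rightarrow> ennreal" where "F x = ennreal (exp (- (x \<bullet> x) / 2))" for x
  define V where "V = measure lborel (cball (0::'a) 1)"
  have V: "V > 0" using measure_lborel_cball_01 by (simp add: V_def)
  have s: "s > 0" by (simp add: s_def)
  have [measurable]: "F \<in> borel_measurable borel" unfolding F_def by measurable
  have "ennreal (1 / (s * V)) * (\<integral>\<^sup>+x. F x \<partial>lborel) =
    (\<integral>\<^sup>+q. (\<integral>\<^sup>+t. indicator {0<..} t * (F (sqrt t *\<^sub>R sgn q) * ennreal (t powr (s - 1))) \<partial>lborel) \<partial>uniform_ball)"
    unfolding s_def V_def by (rule nn_integral_polar[symmetric]) measurable
  also have "\<dots> = (\<integral>\<^sup>+q. (\<integral>\<^sup>+t. indicator {0<..} t * ennreal (exp (- t / 2) * t powr (s - 1)) \<partial>lborel) \<partial>(uniform_ball :: 'a measure))"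
    using AE_uniform_ball_nonzero[where 'a = 'a]
    by (intro nn_integral_cong_AE)
       (auto elim!: eventually_mono intro!: nn_integral_cong
        simp: F_def indicator_def inner_sgn_self ennreal_mult)
  also have "\<dots> = (\<integral>\<^sup>+t. indicator {0<..} t * ennreal (exp (- t / 2) * t powr (s - 1)) \<partial>lborel)"
    by (subst nn_integral_const)
       (simp add: prob_space.emeasure_space_1[OF prob_space_uniform_ball] del: emeasure_uniform_measure space_uniform_measure)
  also have "\<dots> = 2 * (\<integral>\<^sup>+t. indicator {0<..} (0 + 2 * t) * ennreal (exp (- (0 + 2 * t) / 2) * (0 + 2 * t) powr (s - 1)) \<partial>lborel)"
    by (subst nn_integral_real_affine[where t = 0 and c = 2]) simp_all
  also have "\<dots> = 2 * (\<integral>\<^sup>+t. ennreal (2 powr (s - 1)) * (indicator {0<..} t * ennreal (exp (- t) * t powr (s - 1))) \<partial>lborel)"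
    by (intro arg_cong[where f = "\<lambda>x. 2 * x"] nn_integral_cong)
       (auto simp: indicator_def powr_mult mult_ac simp flip: ennreal_mult)
  also have "\<dots> = 2 * (ennreal (2 powr (s - 1)) * ennreal (Gamma s))"
    by (subst nn_integral_cmult) (simp_all add: nn_integral_Gamma_powr[OF s])
  also have "\<dots> < \<infinity>" by (simp add: ennreal_mult_less_top flip: ennreal_mult)
  finally have fin: "(\<integral>\<^sup>+x. F x \<partial>lborel) < \<infinity>"
    using s V by (auto simp: ennreal_mult_less_top)
  have "integrable lborel (\<lambda>x::'a. exp (- (x \<bullet> x) / 2))"
    by (rule integrableI_nonneg) (use fin in \<open>auto simp: F_def\<close>)
  hence "integrable lborel (\<lambda>x::'a. exp (c\<^sup>2 / 2) * exp (- (x \<bullet> x) / 2))" by simp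
  thus ?thesis
  proof (rule Bochner_Integration.integrable_bound)
    show "AE x in lborel. norm (exp (c * norm x - x \<bullet> (x::'a))) \<le> norm (exp (c\<^sup>2 / 2) * exp (- (x \<bullet> x) / 2))"
    proof (rule AE_I2)
      fix x :: 'a
      have "0 \<le> (norm x - c)\<^sup>2" by simp
      hence "c * norm x - x \<bullet> x \<le> c\<^sup>2 / 2 + - (x \<bullet> x) / 2"
        by (simp add: power2_eq_square algebra_simps dot_square_norm)
      thus "norm (exp (c * norm x - x \<bullet> x)) \<le> norm (exp (c\<^sup>2 / 2) * exp (- (x \<bullet> x) / 2))"
        by (simp flip: exp_add)
    qed
  qed simp
qed

text \<open>Once the coefficients of the difference below n vanish, its series can be divided by
  x^n; the quotient is zero away from 0, and its limit at 0 is the coefficient d n.\<close>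

lemma power_series_unique:
  fixes a b :: "nat \<Rightarrow> real"
  assumes "\<And>x. (\<lambda>n. a n * x ^ n) sums f x" "\<And>x. (\<lambda>n. b n * x ^ n) sums f x"
  shows "a = b"
proof -
  define d where "d n = a n - b n" for n
  have d: "(\<lambda>n. d n * x ^ n) sums 0" for x
    using sums_diff[OF assms(1)[of x] assms(2)[of x]] by (simp add: d_def left_diff_distrib)
  have "d n = 0" for n
  proof (induction n rule: less_induct)
    case (less n)
    have "(\<lambda>k. d (k + n) * x ^ k) sums 0" if "x \<noteq> 0" for x
    proof -
      have "(\<lambda>k. d (k + n) * x ^ (k + n)) sums (0 - (\<Sum>i<n. d i * x ^ i))"
        using d[of x] by (subst sums_iff_shift) simp
      hence "(\<lambda>k. d (k + n) * x ^ (k + n) / x ^ n) sums (0 / x ^ n)"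
        using less by (intro sums_divide) simp
      thus ?thesis using that by (simp add: power_add)
    qed
    from powser_limit_0_strong[of 1 "\<lambda>k. d (k + n)" "\<lambda>_. 0", OF _ this]
    have "((\<lambda>_::real. 0::real) \<longlongrightarrow> d n) (at 0)" by simp
    moreover have "((\<lambda>_::real. 0::real) \<longlongrightarrow> 0) (at 0)" by simp
    ultimately show "d n = 0" using tendsto_unique trivial_limit_at by blast
  qed
  thus ?thesis by (simp add: d_def fun_eq_iff)
qed

lemma power_div_fact_le_exp:
  fixes x :: real
  assumes "x \<ge> 0"
  shows "x ^ n / fact n \<le> exp x"
proof -
  have "(\<lambda>k. x ^ k / fact k) sums exp x" using exp_converges[of x] by (simp add: field_simps)
  from sums_le[OF _ sums_finite[of "{n}" "\<lambda>k. if k = n then x ^ k / fact k else 0"] this]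
  show ?thesis using assms by simp
qed

text \<open>Completing the square computes the generating function of these moments.\<close>

lemma gaussian_moment:
  fixes w :: "'a::euclidean_space"
  shows "integrable lborel (\<lambda>x. (w \<bullet> x) ^ n * exp (- (x \<bullet> x)))" (is ?A)
    and "(\<integral>x. (w \<bullet> x) ^ (2 * n) * exp (- (x \<bullet> x)) \<partial>lborel) =
      fact (2 * n) / (4 ^ n * fact n) * (w \<bullet> w) ^ n * (\<integral>x. exp (- (x \<bullet> x)) \<partial>(lborel :: 'a measure))" (is ?B)
proof -
  define A where "A = (\<integral>x. exp (- (x \<bullet> x)) \<partial>(lborel :: 'a measure))"
  have bound: "\<bar>w \<bullet> x\<bar> ^ n * c ^ n / fact n \<le> exp (c * norm w * norm x)" if "c \<ge> 0" for n x c
  proof -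
    have "\<bar>w \<bullet> x\<bar> ^ n * c ^ n / fact n = (c * \<bar>w \<bullet> x\<bar>) ^ n / fact n" by (simp add: power_mult_distrib)
    also have "\<dots> \<le> exp (c * \<bar>w \<bullet> x\<bar>)" using that by (intro power_div_fact_le_exp) simp
    also have "\<dots> \<le> exp (c * norm w * norm x)"
      using Cauchy_Schwarz_ineq2[of w x] that by (simp add: mult.assoc mult_left_mono)
    finally show ?thesis .
  qed
  have int: "integrable lborel (\<lambda>x. (w \<bullet> x) ^ n * exp (- (x \<bullet> x)))" for n
  proof (rule Bochner_Integration.integrable_bound)
    show "integrable lborel (\<lambda>x::'a. fact n * exp (norm w * norm x - x \<bullet> x))"
      by (intro integrable_mult_right integrable_gaussian)
    show "AE x in lborel. norm ((w \<bullet> x) ^ n * exp (- (x \<bullet> x))) \<le> norm (fact n * exp (norm w * norm x - x \<bullet> x))"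
      using bound[of 1 _ n] by (intro AE_I2) (auto simp: abs_mult power_abs exp_diff exp_minus field_simps)
  qed simp
  thus ?A .
  define g where "g n = (\<integral>x. (w \<bullet> x) ^ n * exp (- (x \<bullet> x)) \<partial>lborel)" for n
  \<comment> \<open>Translation by r w: expanding |x - r w|^2 in the exponent produces exp (2 r (w .
    x)) and the constant exp (- r^2 |w|^2).\<close>
  have sq: "(\<integral>x. exp (2 * r * (w \<bullet> x)) * exp (- (x \<bullet> x)) \<partial>lborel) = exp (r\<^sup>2 * (w \<bullet> w)) * A" for r
  proof -
    have "A = (\<integral>x. exp (- (x \<bullet> x)) \<partial>distr lborel borel ((+) (- r *\<^sub>R w)))"
      by (simp add: A_def lborel_distr_plus)
    also have "\<dots> = (\<integral>x. exp (- ((- r *\<^sub>R w + x) \<bullet> (- r *\<^sub>R w + x))) \<partial>lborel)"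
      by (subst integral_distr) auto
    finally have "exp (r\<^sup>2 * (w \<bullet> w)) * A =
        (\<integral>x. exp (r\<^sup>2 * (w \<bullet> w)) * exp (- ((- r *\<^sub>R w + x) \<bullet> (- r *\<^sub>R w + x))) \<partial>lborel)" by simp
    also have "\<dots> = (\<integral>x. exp (2 * r * (w \<bullet> x)) * exp (- (x \<bullet> x)) \<partial>lborel)"
      by (intro Bochner_Integration.integral_cong refl)
         (simp add: inner_add_left inner_add_right inner_diff_left inner_diff_right inner_commute power2_eq_square algebra_simps flip: exp_add)
    finally show ?thesis ..
  qed
  have ser1: "(\<lambda>n. (2 ^ n / fact n * g n) * r ^ n) sums (exp (r\<^sup>2 * (w \<bullet> w)) * A)" for r
  proof -
    define f where "f n x = (2 * r * (w \<bullet> x)) ^ n / fact n * exp (- (x \<bullet> x))" for n and x :: 'a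
    have fi: "f n x = ((2 * r) ^ n / fact n) * ((w \<bullet> x) ^ n * exp (- (x \<bullet> x)))" for n x
      by (simp add: f_def power_mult_distrib)
    have sm: "(\<lambda>n. f n x) sums (exp (2 * r * (w \<bullet> x)) * exp (- (x \<bullet> x)))" for x
      unfolding f_def using sums_mult2[OF exp_converges[of "2 * r * (w \<bullet> x)"], of "exp (- (x \<bullet> x))"] by (simp add: field_simps)
    have f_int: "integrable lborel (f n)" for n
    proof -
      have "f n = (\<lambda>x. ((2 * r) ^ n / fact n) * ((w \<bullet> x) ^ n * exp (- (x \<bullet> x))))"
        by (rule ext) (rule fi)
      thus ?thesis using int[of n] by simp
    qed
    have "(\<lambda>n. integral\<^sup>L lborel (f n)) sums (\<integral>x. (\<Sum>n. f n x) \<partial>lborel)"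
    proof (rule sums_integral)
      show "integrable lborel (f n)" for n
        by (rule f_int)
      have n: "(\<lambda>n. norm (f n x)) sums (exp (\<bar>2 * r * (w \<bullet> x)\<bar>) * exp (- (x \<bullet> x)))" for x
        unfolding f_def using sums_mult2[OF exp_converges[of "\<bar>2 * r * (w \<bullet> x)\<bar>"], of "exp (- (x \<bullet> x))"]
        by (simp add: field_simps abs_mult power_abs)
      show "AE x in lborel. summable (\<lambda>n. norm (f n x))"
        by (intro AE_I2 sums_summable[OF n])
      \<comment> \<open>Applying \<open>bound\<close> with 4 |r|, twice the coefficient 2 |r| of the
        series, leaves a factor (1/2)^n, which makes the integrals of the norms summable.\<close>
      have bnd: "norm (f n x) \<le> (1/2) ^ n * exp (4 * \<bar>r\<bar> * norm w * norm x - x \<bullet> x)" for n x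
      proof -
        have "norm (f n x) = (1/2) ^ n * (\<bar>w \<bullet> x\<bar> ^ n * (4 * \<bar>r\<bar>) ^ n / fact n) * exp (- (x \<bullet> x))"
        proof -
          have e: "(1/2) ^ n * (4 * \<bar>r\<bar>) ^ n = (2 * \<bar>r\<bar>) ^ n" by (subst power_mult_distrib[symmetric]) simp
          have "norm (f n x) = (2 * \<bar>r\<bar>) ^ n * (\<bar>w \<bullet> x\<bar> ^ n / fact n) * exp (- (x \<bullet> x))"
            by (simp add: f_def abs_mult power_abs power_mult_distrib)
          thus ?thesis unfolding e[symmetric] by (simp add: mult_ac)
        qed
        also have "\<dots> \<le> (1/2) ^ n * exp (4 * \<bar>r\<bar> * norm w * norm x) * exp (- (x \<bullet> x))"
          by (rule mult_right_mono[OF mult_left_mono[OF bound]]) auto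
        also have "\<dots> = (1/2) ^ n * exp (4 * \<bar>r\<bar> * norm w * norm x - x \<bullet> x)"
          unfolding mult.assoc exp_add[symmetric] by simp
        finally show ?thesis .
      qed
      have "(\<integral>x. norm (f n x) \<partial>lborel) \<le> (1/2) ^ n * (\<integral>x. exp (4 * \<bar>r\<bar> * norm w * norm x - x \<bullet> x) \<partial>(lborel :: 'a measure))" for n
      proof -
        have "(\<integral>x. norm (f n x) \<partial>lborel) \<le> (\<integral>x. (1/2) ^ n * exp (4 * \<bar>r\<bar> * norm w * norm x - x \<bullet> x) \<partial>(lborel :: 'a measure))"
        proof (rule integral_mono)
          show "integrable lborel (\<lambda>x. norm (f n x))" by (rule integrable_norm[OF f_int])
          show "integrable lborel (\<lambda>x::'a. (1/2) ^ n * exp (4 * \<bar>r\<bar> * norm w * norm x - x \<bullet> x))"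
            by (rule integrable_mult_right[OF integrable_gaussian])
        qed (rule bnd)
        thus ?thesis by simp
      qed
      hence le: "norm (\<integral>x. norm (f n x) \<partial>lborel) \<le> (1/2) ^ n * (\<integral>x. exp (4 * \<bar>r\<bar> * norm w * norm x - x \<bullet> x) \<partial>(lborel :: 'a measure))" for n
        by (subst real_norm_def, subst abs_of_nonneg) (simp_all add: integral_nonneg)
      have "summable (\<lambda>n. (1/2::real) ^ n * (\<integral>x. exp (4 * \<bar>r\<bar> * norm w * norm x - x \<bullet> x) \<partial>(lborel :: 'a measure)))"
        by (rule summable_mult2, rule summable_geometric) simp
      from summable_comparison_test'[OF this le]
      show "summable (\<lambda>n. \<integral>x. norm (f n x) \<partial>lborel)" .
    qed
    moreover have "(\<integral>x. (\<Sum>n. f n x) \<partial>lborel) = exp (r\<^sup>2 * (w \<bullet> w)) * A"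
      unfolding sq[symmetric] sums_unique[OF sm, symmetric] ..
    moreover have "integral\<^sup>L lborel (f n) = (2 ^ n / fact n * g n) * r ^ n" for n
      unfolding g_def fi[abs_def] by (subst integral_mult_right_zero) (simp add: power_mult_distrib)
    ultimately show ?thesis by simp
  qed
  \<comment> \<open>The Taylor coefficients of exp (r^2 |w|^2) A in the variable r, with zeros at
    the odd places; comparison with \<open>ser1\<close> yields the moments.\<close>
  define h where "h m = (if even m then A * (w \<bullet> w) ^ (m div 2) / fact (m div 2) else 0)" for m
  have ser2: "(\<lambda>n. h n * r ^ n) sums (exp (r\<^sup>2 * (w \<bullet> w)) * A)" for r
  proof -
    have "(\<lambda>n. h (2 * n) * r ^ (2 * n)) sums (exp (r\<^sup>2 * (w \<bullet> w)) * A)"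
    proof -
      have "(r\<^sup>2) ^ n = r ^ (2 * n)" for n by (simp add: power_mult)
      hence "(\<lambda>n. h (2 * n) * r ^ (2 * n)) = (\<lambda>n. (r\<^sup>2 * (w \<bullet> w)) ^ n /\<^sub>R fact n * A)"
        by (simp add: h_def power_mult_distrib divide_inverse mult_ac)
      thus ?thesis using sums_mult2[OF exp_converges[of "r\<^sup>2 * (w \<bullet> w)"], of A] by simp
    qed
    thus ?thesis
    proof (subst (asm) sums_mono_reindex)
      show "strict_mono (\<lambda>n::nat. 2 * n)" by (simp add: strict_mono_def)
      show "h m * r ^ m = 0" if "m \<notin> range (\<lambda>n. 2 * n)" for m
        using that by (auto simp: h_def elim!: evenE)
    qed
  qed
  have "(\<lambda>n. 2 ^ n / fact n * g n) = h" by (rule power_series_unique[OF ser1 ser2])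
  from fun_cong[OF this, of "2 * n"] have "4 ^ n / fact (2 * n) * g (2 * n) = A * (w \<bullet> w) ^ n / fact n"
    by (simp add: h_def power_mult)
  thus ?B by (simp add: g_def A_def field_simps)
qed

text \<open>Polar coordinates split the Gaussian integral of (w . x)^(2n) into the average over
  directions and a radial integral Gamma (s + n), up to a constant that involves the volume of the
  ball. The case n = 0 eliminates this constant.\<close>

lemma sphere_moment:
  fixes w :: "'a::euclidean_space"
  defines "s \<equiv> real DIM('a) / 2"
  shows "(\<integral>q. (w \<bullet> sgn q) ^ (2 * n) \<partial>uniform_ball) =
    Gamma s / Gamma (s + n) * (fact (2 * n) / (4 ^ n * fact n)) * (w \<bullet> w) ^ n"
proof -
  define \<kappa> where "\<kappa> = 1 / (s * measure lborel (cball (0::'a) 1))"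
  have s: "s > 0" by (simp add: s_def)
  have k: "\<kappa> > 0" using measure_lborel_cball_01[where 'a = 'a] s by (simp add: \<kappa>_def)
  have moments: "Gamma (s + n) * (\<integral>q. (w \<bullet> sgn q) ^ (2 * n) \<partial>uniform_ball) =
    \<kappa> * (\<integral>x. (w \<bullet> x) ^ (2 * n) * exp (- (x \<bullet> x)) \<partial>lborel)" for n and w :: 'a
  proof -
    define F where "F x = ennreal ((w \<bullet> x) ^ (2 * n) * exp (- (x \<bullet> x)))" for x :: 'a
    have [measurable]: "F \<in> borel_measurable borel" unfolding F_def by measurable
    have nn: "(w \<bullet> x) ^ (2 * n) \<ge> 0" for x by (simp add: zero_le_even_power)
    have [measurable]: "(\<lambda>q::'a. (w \<bullet> sgn q) ^ (2 * n)) \<in> borel_measurable borel" by measurable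
    have radial: "(\<integral>\<^sup>+t. indicator {0<..} t * (F (sqrt t *\<^sub>R sgn q) * ennreal (t powr (s - 1))) \<partial>lborel) =
        ennreal (Gamma (s + n) * (w \<bullet> sgn q) ^ (2 * n))" if q: "q \<noteq> 0" for q :: 'a
    proof -
      have "(\<integral>\<^sup>+t. indicator {0<..} t * (F (sqrt t *\<^sub>R sgn q) * ennreal (t powr (s - 1))) \<partial>lborel) =
        (\<integral>\<^sup>+t. ennreal ((w \<bullet> sgn q) ^ (2 * n)) * (indicator {0<..} t * ennreal (exp (- t) * t powr (s + n - 1))) \<partial>lborel)"
      proof (rule nn_integral_cong)
        fix t :: real
        show "indicator {0<..} t * (F (sqrt t *\<^sub>R sgn q) * ennreal (t powr (s - 1))) =
          ennreal ((w \<bullet> sgn q) ^ (2 * n)) * (indicator {0<..} t * ennreal (exp (- t) * t powr (s + n - 1)))"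
        proof (cases "t > 0")
          case True
          have e1: "(w \<bullet> (sqrt t *\<^sub>R sgn q)) ^ (2 * n) = t ^ n * (w \<bullet> sgn q) ^ (2 * n)"
            using True by (simp add: power_mult_distrib power_mult)
          have e2: "(sqrt t *\<^sub>R sgn q) \<bullet> (sqrt t *\<^sub>R sgn q) = t"
            using True inner_sgn_self[OF q] by simp
          \<comment> \<open>The power (w . x)^(2n) is homogeneous of degree n in t = |x|^2, which
            shifts the Gamma parameter from s to s + n.\<close>
          have e3: "t ^ n * t powr (s - 1) = t powr (s + n - 1)"
            using True by (simp add: powr_realpow[symmetric] powr_add[symmetric] algebra_simps)
          have "(w \<bullet> (sqrt t *\<^sub>R sgn q)) ^ (2 * n) * exp (- ((sqrt t *\<^sub>R sgn q) \<bullet> (sqrt t *\<^sub>R sgn q))) * t powr (s - 1)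
              = (w \<bullet> sgn q) ^ (2 * n) * (exp (- t) * t powr (s + n - 1))"
            unfolding e1 e2 e3[symmetric] by (simp only: mult_ac)
          thus ?thesis using True nn
            by (simp add: F_def ennreal_mult'[symmetric] nn del: inner_scaleR_right inner_scaleR_left)
        qed simp
      qed
      also have "\<dots> = ennreal ((w \<bullet> sgn q) ^ (2 * n)) * ennreal (Gamma (s + n))"
        using s by (subst nn_integral_cmult) (simp_all add: nn_integral_Gamma_powr)
      also have "\<dots> = ennreal (Gamma (s + n) * (w \<bullet> sgn q) ^ (2 * n))"
        using s nn by (subst ennreal_mult) (auto simp: mult.commute intro!: less_imp_le[OF Gamma_real_pos])
      finally show ?thesis .
    qed
    have "(\<integral>\<^sup>+q. ennreal (Gamma (s + n) * (w \<bullet> sgn q) ^ (2 * n)) \<partial>uniform_ball) =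
      (\<integral>\<^sup>+q. (\<integral>\<^sup>+t. indicator {0<..} t * (F (sqrt t *\<^sub>R sgn q) * ennreal (t powr (s - 1))) \<partial>lborel) \<partial>uniform_ball)"
    proof (rule nn_integral_cong_AE)
      show "AE q in uniform_ball. ennreal (Gamma (s + n) * (w \<bullet> sgn q) ^ (2 * n)) =
          (\<integral>\<^sup>+t. indicator {0<..} t * (F (sqrt t *\<^sub>R sgn q) * ennreal (t powr (s - 1))) \<partial>lborel)"
        using AE_uniform_ball_nonzero by eventually_elim (rule radial[symmetric])
    qed
    also have "\<dots> = ennreal \<kappa> * (\<integral>\<^sup>+x. F x \<partial>lborel)"
      unfolding \<kappa>_def s_def by (rule nn_integral_polar) measurable
    also have "(\<integral>\<^sup>+x. F x \<partial>lborel) = ennreal (\<integral>x. (w \<bullet> x) ^ (2 * n) * exp (- (x \<bullet> x)) \<partial>lborel)"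
      unfolding F_def using nn by (intro nn_integral_eq_integral gaussian_moment(1)) auto
    also have "ennreal \<kappa> * \<dots> = ennreal (\<kappa> * (\<integral>x. (w \<bullet> x) ^ (2 * n) * exp (- (x \<bullet> x)) \<partial>lborel))"
      using k by (simp add: ennreal_mult')
    finally have eq: "(\<integral>\<^sup>+q. ennreal (Gamma (s + n) * (w \<bullet> sgn q) ^ (2 * n)) \<partial>uniform_ball) = \<dots>" .
    have "(\<integral>q. Gamma (s + n) * (w \<bullet> sgn q) ^ (2 * n) \<partial>uniform_ball) =
      enn2real (\<integral>\<^sup>+q. ennreal (Gamma (s + n) * (w \<bullet> sgn q) ^ (2 * n)) \<partial>uniform_ball)"
      using s nn by (intro integral_eq_nn_integral) (auto intro!: mult_nonneg_nonneg less_imp_le[OF Gamma_real_pos])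
    also have "\<dots> = \<kappa> * (\<integral>x. (w \<bullet> x) ^ (2 * n) * exp (- (x \<bullet> x)) \<partial>lborel)"
      unfolding eq using k nn by (intro enn2real_ennreal mult_nonneg_nonneg integral_nonneg) auto
    finally show ?thesis by simp
  qed
  define A where "A = (\<integral>x. exp (- (x \<bullet> x)) \<partial>(lborel :: 'a measure))"
  \<comment> \<open>For n = 0 and w = 0 the power is 1 on both sides, which evaluates the product of
    \<open>\<kappa>\<close> and A.\<close>
  have "Gamma s = \<kappa> * A"
    using moments[of 0 0] prob_space.prob_space[OF prob_space_uniform_ball[where 'a = 'a]]
    by (simp add: A_def del: measure_uniform_measure space_uniform_measure)
  moreover have "Gamma (s + n) * (\<integral>q. (w \<bullet> sgn q) ^ (2 * n) \<partial>uniform_ball) =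
      \<kappa> * A * (fact (2 * n) / (4 ^ n * fact n) * (w \<bullet> w) ^ n)"
    unfolding moments gaussian_moment(2) A_def by simp
  moreover have "Gamma (s + n) > 0" using s by (intro Gamma_real_pos) simp
  ultimately show ?thesis by (simp add: field_simps)
qed

lemma integrable_uniform_ball_bounded:
  fixes f :: "'a::euclidean_space \<Rightarrow> 'b::{banach, second_countable_topology}"
  assumes "f \<in> borel_measurable borel" "\<And>q. norm (f q) \<le> B"
  shows "integrable uniform_ball f"
proof -
  interpret prob_space "uniform_ball :: 'a measure" by (rule prob_space_uniform_ball)
  show ?thesis by (rule integrable_const_bound[of _ B]) (use assms in auto)
qed

text \<open>For real w this is the previous lemma; along a real line w = a + r b both sides are polynomials
  in r, which therefore also agree at r = i.\<close>

lemma sphere_moment_complex: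
  fixes a b :: "'a::euclidean_space"
  defines "s \<equiv> real DIM('a) / 2"
  shows "(\<integral>q. (complex_of_real (a \<bullet> sgn q) + \<i> * of_real (b \<bullet> sgn q)) ^ (2 * n) \<partial>uniform_ball) =
    of_real (Gamma s / Gamma (s + n) * (fact (2 * n) / (4 ^ n * fact n))) *
      (of_real (a \<bullet> a - b \<bullet> b) + 2 * \<i> * of_real (a \<bullet> b)) ^ n"
proof -
  define C where "C = Gamma s / Gamma (s + n) * (fact (2 * n) / (4 ^ n * fact n))"
  define m where "m j = (\<integral>q. (b \<bullet> sgn q) ^ j * (a \<bullet> sgn q) ^ (2 * n - j) \<partial>uniform_ball)" for j
  have le: "\<bar>w \<bullet> sgn q\<bar> \<le> norm w" for w q :: 'a
    using Cauchy_Schwarz_ineq2[of w "sgn q"] by (simp add: norm_sgn split: if_splits)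
  have int: "integrable uniform_ball (\<lambda>q. (b \<bullet> sgn q) ^ j * (a \<bullet> sgn q) ^ i)" for i j
  proof (rule integrable_uniform_ball_bounded)
    show "norm ((b \<bullet> sgn q) ^ j * (a \<bullet> sgn q) ^ i) \<le> norm b ^ j * norm a ^ i" for q
      using le[of a q] le[of b q] by (auto simp: abs_mult power_abs intro!: mult_mono power_mono)
  qed measurable
  \<comment> \<open>The binomial theorem makes the average a polynomial in z, with the mixed moments
    of a and b in its coefficients.\<close>
  define P where "P = (\<Sum>j\<le>2 * n. monom (complex_of_real (real ((2 * n) choose j) * m j)) j)"
  \<comment> \<open>The quadratic polynomial is |a + r b|^2 for real r; at r = i it takes the value
    |a|^2 - |b|^2 + 2 i (a . b).\<close>
  define Q where "Q = smult (complex_of_real C)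
    ([:complex_of_real (a \<bullet> a), complex_of_real (2 * (a \<bullet> b)), complex_of_real (b \<bullet> b):] ^ n)"
  have P: "poly P z = (\<integral>q. (complex_of_real (a \<bullet> sgn q) + z * of_real (b \<bullet> sgn q)) ^ (2 * n) \<partial>uniform_ball)" for z
  proof -
    have int': "integrable uniform_ball (\<lambda>q. complex_of_real ((b \<bullet> sgn q) ^ j * (a \<bullet> sgn q) ^ i))" for i j
      by (rule integrable_of_real[OF int])
    have "(\<integral>q. (complex_of_real (a \<bullet> sgn q) + z * of_real (b \<bullet> sgn q)) ^ (2 * n) \<partial>uniform_ball) =
      (\<integral>q. (\<Sum>j\<le>2 * n. (of_nat ((2 * n) choose j) * z ^ j) * complex_of_real ((b \<bullet> sgn q) ^ j * (a \<bullet> sgn q) ^ (2 * n - j))) \<partial>uniform_ball)"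
      by (subst add.commute, subst binomial_ring) (simp add: power_mult_distrib mult_ac)
    also have "\<dots> = (\<Sum>j\<le>2 * n. \<integral>q. (of_nat ((2 * n) choose j) * z ^ j) * complex_of_real ((b \<bullet> sgn q) ^ j * (a \<bullet> sgn q) ^ (2 * n - j)) \<partial>uniform_ball)"
      by (intro Bochner_Integration.integral_sum integrable_mult_right int')
    also have "\<dots> = (\<Sum>j\<le>2 * n. (of_nat ((2 * n) choose j) * z ^ j) * complex_of_real (m j))"
      unfolding m_def by (simp only: integral_mult_right_zero integral_complex_of_real)
    also have "\<dots> = poly P z"
      by (simp add: P_def poly_sum poly_monom mult_ac)
    finally show ?thesis ..
  qed
  have "poly (P - Q) (of_real r) = 0" for r
  proof -
    have "poly P (of_real r) = (\<integral>q. complex_of_real (((a + r *\<^sub>R b) \<bullet> sgn q) ^ (2 * n)) \<partial>uniform_ball)"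
      unfolding P by (simp add: inner_add_left)
    also have "\<dots> = of_real (C * ((a + r *\<^sub>R b) \<bullet> (a + r *\<^sub>R b)) ^ n)"
      unfolding integral_complex_of_real sphere_moment C_def s_def ..
    also have "\<dots> = poly Q (of_real r)"
      by (simp add: Q_def inner_add_left inner_add_right inner_commute[of b a] algebra_simps)
    finally show ?thesis by simp
  qed
  hence "range complex_of_real \<subseteq> {z. poly (P - Q) z = 0}" by auto
  moreover have "infinite (range complex_of_real)"
    by (subst finite_image_iff) (auto simp: inj_def infinite_UNIV_char_0)
  ultimately have "P - Q = 0" using poly_roots_finite finite_subset by blast
  hence "poly P \<i> = poly Q \<i>" by simp
  thus ?thesis unfolding P by (simp add: Q_def C_def algebra_simps)
qed

text \<open>The map q -> -q preserves the uniform distribution and changes the sign of an odd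
  power.\<close>

lemma sphere_moment_odd:
  fixes a b :: "'a::euclidean_space"
  assumes "odd m"
  shows "(\<integral>q. (complex_of_real (a \<bullet> sgn q) + \<i> * of_real (b \<bullet> sgn q)) ^ m \<partial>uniform_ball) = 0"
    (is "?I = 0")
proof -
  have lin: "linear (uminus :: 'a \<Rightarrow> 'a)" by (simp add: linear_iff)
  have "?I = (\<integral>q. (complex_of_real (a \<bullet> sgn q) + \<i> * of_real (b \<bullet> sgn q)) ^ m \<partial>distr uniform_ball borel uminus)"
    by (subst distr_uniform_ball_isometry[OF lin]) simp_all
  also have "\<dots> = (\<integral>q. (- (complex_of_real (a \<bullet> sgn q) + \<i> * of_real (b \<bullet> sgn q))) ^ m \<partial>uniform_ball)"
    by (subst integral_distr) (simp_all add: sgn_minus)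
  also have "\<dots> = - ?I"
    by (simp only: power_minus_odd[OF assms] Bochner_Integration.integral_minus)
  finally show ?thesis by simp
qed

text \<open>Expand the exponential. Odd powers average to zero; in the even terms 2^(2n) / (2n)!
  cancels the factor (2n)! / 4^n of the moment and leaves Gamma s W^n / (n! Gamma (s + n)), where W
  = w . w for w = a + i b. Up to the factor Gamma s this is the n-th term of the Bessel series of
  index s - 1 at 2 sqrt W.\<close>

lemma spherical_average_exp:
  fixes a b :: "'a::euclidean_space"
  defines "s \<equiv> real DIM('a) / 2"
  shows "(\<integral>q. exp (2 * (complex_of_real (a \<bullet> sgn q) + \<i> * of_real (b \<bullet> sgn q))) \<partial>uniform_ball) =
    of_real (Gamma s) *
      Bessel_I_tilde (s - 1) (2 * csqrt (of_real (a \<bullet> a - b \<bullet> b) + 2 * \<i> * of_real (a \<bullet> b)))"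
proof -
  define W where "W = complex_of_real (a \<bullet> a - b \<bullet> b) + 2 * \<i> * of_real (a \<bullet> b)"
  define c where "c q = complex_of_real (a \<bullet> sgn q) + \<i> * of_real (b \<bullet> sgn q)" for q
  have [measurable]: "c \<in> borel_measurable borel" unfolding c_def by measurable
  have s: "s > 0" by (simp add: s_def)
  define B where "B = norm a + norm b"
  have le: "\<bar>w \<bullet> sgn q\<bar> \<le> norm w" for w q :: 'a
    using Cauchy_Schwarz_ineq2[of w "sgn q"] by (simp add: norm_sgn split: if_splits)
  \<comment> \<open>A bound independent of q dominates the exponential series by a numerical one, so
    that it may be integrated term by term.\<close>
  have B: "norm (c q) \<le> B" for q
  proof -
    have "norm (c q) \<le> \<bar>a \<bullet> sgn q\<bar> + \<bar>b \<bullet> sgn q\<bar>"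
      unfolding c_def by (rule order_trans[OF norm_triangle_ineq]) (simp add: norm_mult)
    thus ?thesis using le[of a q] le[of b q] by (simp add: B_def)
  qed
  define f where "f m q = (2 * c q) ^ m /\<^sub>R fact m" for m q
  have f_le: "norm (f m q) \<le> (2 * B) ^ m /\<^sub>R fact m" for m q
    unfolding f_def using B[of q] by (auto simp: norm_mult norm_power intro!: mult_left_mono power_mono)
  have f_meas: "f m \<in> borel_measurable borel" for m unfolding f_def by measurable
  have f_int: "integrable uniform_ball (f m)" for m
    by (rule integrable_uniform_ball_bounded[OF f_meas f_le])
  have fs: "(\<lambda>m. f m q) sums exp (2 * c q)" for q
    unfolding f_def by (rule exp_converges)
  interpret U: prob_space "uniform_ball :: 'a measure" by (rule prob_space_uniform_ball)
  have "(\<lambda>m. integral\<^sup>L uniform_ball (f m)) sums (\<integral>q. (\<Sum>m. f m q) \<partial>uniform_ball)"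
  proof (rule sums_integral[OF f_int])
    have sB: "summable (\<lambda>m. (2 * B) ^ m /\<^sub>R fact m)" by (rule sums_summable[OF exp_converges])
    have "summable (\<lambda>m. norm (f m q))" for q
      using f_le by (intro summable_comparison_test'[OF sB, of 0]) simp
    thus "AE q in uniform_ball. summable (\<lambda>m. norm (f m q))" by simp
    have "(\<integral>q. norm (f m q) \<partial>uniform_ball) \<le> (2 * B) ^ m /\<^sub>R fact m" for m
      by (rule U.integral_le_const[OF integrable_norm[OF f_int] AE_I2[OF f_le]])
    thus "summable (\<lambda>m. \<integral>q. norm (f m q) \<partial>uniform_ball)"
      by (intro summable_comparison_test'[OF sB, of 0]) (simp add: integral_nonneg)
  qed
  also have "(\<lambda>q. \<Sum>m. f m q) = (\<lambda>q. exp (2 * c q))"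
    by (rule ext) (rule sums_unique[OF fs, symmetric])
  finally have sums: "(\<lambda>m. integral\<^sup>L uniform_ball (f m)) sums (\<integral>q. exp (2 * c q) \<partial>uniform_ball)" .
  have f_eq: "integral\<^sup>L uniform_ball (f m) = (2 ^ m / fact m) * (\<integral>q. c q ^ m \<partial>uniform_ball)" for m
  proof -
    have "f m = (\<lambda>q. (2 ^ m / fact m) * c q ^ m)"
      by (simp add: f_def fun_eq_iff power_mult_distrib scaleR_conv_of_real field_simps)
    thus ?thesis by simp
  qed
  have odd: "integral\<^sup>L uniform_ball (f m) = 0" if "odd m" for m
    unfolding f_eq using sphere_moment_odd[OF that, of a b] by (simp add: c_def)
  have even: "integral\<^sup>L uniform_ball (f (2 * n)) =
      of_real (Gamma s) * (W ^ n * rGamma (of_real (s - 1) + of_nat n + 1) / fact n)" for n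
  proof -
    have "complex_of_real (s - 1) + of_nat n + 1 = of_real (s + n)" by simp
    hence rG: "rGamma (complex_of_real (s - 1) + of_nat n + 1) = of_real (inverse (Gamma (s + n)))"
      by (simp only: rGamma_inverse_Gamma Gamma_complex_of_real of_real_inverse)
    have "(\<integral>q. c q ^ (2 * n) \<partial>uniform_ball) =
        of_real (Gamma s / Gamma (s + n) * (fact (2 * n) / (4 ^ n * fact n))) * W ^ n"
      unfolding c_def W_def s_def by (rule sphere_moment_complex)
    moreover have "(2::complex) ^ (2 * n) = 4 ^ n" by (simp add: power_mult)
    ultimately show ?thesis
      by (simp only: f_eq rG) (simp add: field_simps)
  qed
  have "(\<lambda>n. integral\<^sup>L uniform_ball (f (2 * n))) sums (\<integral>q. exp (2 * c q) \<partial>uniform_ball)"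
  proof (subst sums_mono_reindex[of "\<lambda>n. 2 * n"])
    show "strict_mono (\<lambda>n::nat. 2 * n)" by (simp add: strict_mono_def)
    show "integral\<^sup>L uniform_ball (f m) = 0" if "m \<notin> range (\<lambda>n. 2 * n)" for m
      using that by (intro odd) (auto elim!: evenE)
    show "(\<lambda>m. integral\<^sup>L uniform_ball (f m)) sums (\<integral>q. exp (2 * c q) \<partial>uniform_ball)" by (rule sums)
  qed
  hence *: "(\<lambda>n. of_real (Gamma s) * (W ^ n * rGamma (of_real (s - 1) + of_nat n + 1) / fact n))
      sums (\<integral>q. exp (2 * c q) \<partial>uniform_ball)"
    unfolding even .
  have G: "complex_of_real (Gamma s) \<noteq> 0" using Gamma_real_pos[OF s] by simp
  have "(\<lambda>n. W ^ n * rGamma (of_real (s - 1) + of_nat n + 1) / fact n)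
      sums ((\<integral>q. exp (2 * c q) \<partial>uniform_ball) / of_real (Gamma s))"
    using sums_divide[OF *, of "of_real (Gamma s)"] G by simp
  hence "(\<Sum>n. W ^ n * rGamma (of_real (s - 1) + of_nat n + 1) / fact n) =
      (\<integral>q. exp (2 * c q) \<partial>uniform_ball) / of_real (Gamma s)"
    by (rule sums_unique[symmetric])
  moreover have "Bessel_I_tilde (s - 1) (2 * csqrt W) =
      (\<Sum>n. W ^ n * rGamma (of_real (s - 1) + of_nat n + 1) / fact n)"
    unfolding Bessel_I_tilde_series by (simp add: power_mult)
  ultimately show ?thesis using G by (simp add: c_def W_def)
qed

section \<open>Vectors and matrices over the scalars\<close>

text \<open>Bracketing x * fcnj x * x in two ways gives |x|^2 x and |fcnj x|^2 x, so conjugation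
  preserves the norm; polarization extends this to inner products.\<close>

lemma inner_fcnj_fcnj: "fcnj x \<bullet> fcnj y = x \<bullet> y" for x y :: "'f::conj_algebra"
proof -
  have self: "fcnj x \<bullet> fcnj x = x \<bullet> x" for x :: 'f
  proof (cases "x = 0")
    case False
    have "(x \<bullet> x) *\<^sub>R x = x * fcnj x * x" by (simp add: mult_fcnj_self)
    also have "\<dots> = x * (fcnj x * fcnj (fcnj x))" by (simp add: mult.assoc)
    also have "\<dots> = (fcnj x \<bullet> fcnj x) *\<^sub>R x" unfolding mult_fcnj_self by simp
    finally show ?thesis using False by simp
  qed simp
  show ?thesis
    using self[of "x + y"] self[of x] self[of y]
    by (simp add: fcnj_add inner_add_left inner_add_right inner_commute)
qed

lemma fcnj_mult_self: "fcnj x * x = (x \<bullet> x) *\<^sub>R 1" for x :: "'f::conj_algebra"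
  using mult_fcnj_self[of "fcnj x"] by (simp add: inner_fcnj_fcnj)

text \<open>Stands in for commutativity over the quaternions: under the real part factors may be
  permuted cyclically, which makes left multiplication by \<open>fcnj a\<close> the adjoint of left
  multiplication by a.\<close>

lemma fre_mult_commute: "fre (x * y) = fre (y * x)" for x y :: "'f::conj_algebra"
  using inner_eq_fre[of x "fcnj y"] inner_eq_fre[of y "fcnj x"] inner_fcnj_fcnj[of x "fcnj y"]
  by (simp add: inner_commute)

lemma inner_mult_left_fcnj: "(a * x) \<bullet> y = x \<bullet> (fcnj a * y)" for a x y :: "'f::conj_algebra"
  using fre_mult_commute[of a "x * fcnj y"] by (simp add: inner_eq_fre fcnj_mult mult.assoc)

lemma inner_mult_right_fcnj: "(x * a) \<bullet> y = x \<bullet> (y * fcnj a)" for a x y :: "'f::conj_algebra"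
  by (simp add: inner_eq_fre fcnj_mult mult.assoc)

lemma fcnj_sum: "fcnj (sum f S) = (\<Sum>i\<in>S. fcnj (f i))" for f :: "_ \<Rightarrow> 'f::conj_algebra"
  by (induction S rule: infinite_finite_induct) (simp_all add: fcnj_add)

lemma bounded_linear_fcnj: "bounded_linear (fcnj :: 'f::conj_algebra \<Rightarrow> 'f)"
  by (simp add: linear_conv_bounded_linear[symmetric] linear_iff fcnj_add fcnj_scaleR)

lemma bounded_bilinear_conj_algebra_mult: "bounded_bilinear ((*) :: 'f::conj_algebra \<Rightarrow> 'f \<Rightarrow> 'f)"
  by (simp add: bilinear_conv_bounded_bilinear[symmetric] bilinear_def linear_iff algebra_simps)

lemmas continuous_on_conj_algebra [continuous_intros] =
  bounded_linear.continuous_on[OF bounded_linear_fcnj]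
  bounded_bilinear.continuous_on[OF bounded_bilinear_conj_algebra_mult]

text \<open>The scalar x* y. With the conjugated vector on the left it is linear in y for the right
  action of the scalars, also over the quaternions.\<close>

definition hprod :: "('f::conj_algebra)^'k \<Rightarrow> 'f^'k \<Rightarrow> 'f" where
  "hprod x y = (\<Sum>i\<in>UNIV. fcnj (x $ i) * y $ i)"

text \<open>The scalars act from the right, so that they commute with matrices.\<close>

definition rmult :: "('f::conj_algebra)^'k \<Rightarrow> 'f \<Rightarrow> 'f^'k" where
  "rmult x q = (\<chi> i. x $ i * q)"

lemma hprod_self: "hprod x x = (x \<bullet> x) *\<^sub>R 1"
  by (simp add: hprod_def fcnj_mult_self inner_vec_def scaleR_sum_left)

lemma hprod_diff_left: "hprod (x - y) z = hprod x z - hprod y z"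
  by (simp add: hprod_def fcnj_diff left_diff_distrib sum_subtractf)

lemma fcnj_hprod: "fcnj (hprod x y) = hprod y x"
  by (simp add: hprod_def fcnj_sum fcnj_mult)

lemma hprod_rmult_right: "hprod x (rmult y q) = hprod x y * q"
  by (simp add: hprod_def rmult_def sum_distrib_right mult.assoc)

lemma inner_eq_fre_hprod: "x \<bullet> y = fre (hprod x y)" for x y :: "('f::conj_algebra)^'k"
proof -
  have "x $ i \<bullet> y $ i = fre (fcnj (x $ i) * y $ i)" for i
    using inner_eq_fre[of "y $ i" "x $ i"] by (simp add: inner_commute fre_mult_commute)
  thus ?thesis by (simp add: inner_vec_def hprod_def fre_def inner_sum_left)
qed

lemma inner_rmult: "x \<bullet> rmult y q = hprod y x \<bullet> q" for x y :: "('f::conj_algebra)^'k"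
proof -
  have "x $ i \<bullet> (y $ i * q) = (fcnj (y $ i) * x $ i) \<bullet> q" for i
    using inner_mult_left_fcnj[of "y $ i" q "x $ i"] by (simp add: inner_commute)
  thus ?thesis by (simp add: inner_vec_def hprod_def rmult_def inner_sum_left)
qed

lemma outer_rmult: "outer (rmult x q) (rmult x q) = (q \<bullet> q) *\<^sub>R outer x x"
proof -
  have "x $ i * q * fcnj (x $ j * q) = x $ i * (q * fcnj q) * fcnj (x $ j)" for i j
    by (simp add: fcnj_mult mult.assoc)
  thus ?thesis by (simp add: outer_def rmult_def vec_eq_iff mult_fcnj_self)
qed

text \<open>Two different vectors a and b are allowed because the matrices of
  \<open>fold_map_C z\<close> contain mixed products of the real and imaginary part of z. Entrywise,
  the adjoints of left and right multiplication regroup the four factors.\<close>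

lemma inner_outer_outer: "outer a b \<bullet> outer y y = hprod y a \<bullet> hprod y b"
  for a b y :: "('f::conj_algebra)^'k"
proof -
  have "outer a b \<bullet> outer y y = (\<Sum>i\<in>UNIV. \<Sum>j\<in>UNIV. (fcnj (y $ i) * a $ i) \<bullet> (fcnj (y $ j) * b $ j))"
    unfolding inner_vec_def outer_def
  proof (simp, intro sum.cong refl)
    fix i j
    have "(a $ i * fcnj (b $ j)) \<bullet> (y $ i * fcnj (y $ j)) = fcnj (y $ j) \<bullet> (fcnj (y $ i) * a $ i * fcnj (b $ j))"
      by (subst inner_commute) (simp add: inner_mult_left_fcnj mult.assoc)
    also have "\<dots> = (fcnj (y $ i) * a $ i) \<bullet> (fcnj (y $ j) * b $ j)"
      by (subst inner_commute) (simp add: inner_mult_right_fcnj)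
    finally show "(a $ i * fcnj (b $ j)) \<bullet> (y $ i * fcnj (y $ j)) = (fcnj (y $ i) * a $ i) \<bullet> (fcnj (y $ j) * b $ j)" .
  qed
  also have "\<dots> = hprod y a \<bullet> hprod y b"
    by (simp add: hprod_def inner_sum_left inner_sum_right) (rule sum.swap)
  finally show ?thesis .
qed

lemma norm_rmult: "norm (rmult y q) = norm y * norm q" for y :: "('f::conj_algebra)^'k"
proof -
  have "rmult y q \<bullet> rmult y q = (hprod y y * q) \<bullet> q"
    by (simp add: inner_rmult hprod_rmult_right)
  also have "\<dots> = (y \<bullet> y) * (q \<bullet> q)"
    by (simp add: hprod_self)
  finally show ?thesis by (simp add: norm_eq_sqrt_inner real_sqrt_mult)
qed

lemma linear_rmult_left: "linear (\<lambda>y. rmult y q)"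
  by (simp add: linear_iff rmult_def vec_eq_iff algebra_simps)

lemma matrix_mult_scaleR:
  "(t *\<^sub>R A) ** B = t *\<^sub>R (A ** B)" "A ** (t *\<^sub>R B) = t *\<^sub>R (A ** B)"
  for A :: "('f::conj_algebra)^'n^'m" and B :: "'f^'p^'n"
  by (simp_all add: matrix_matrix_mult_def vec_eq_iff scaleR_sum_right)

lemma matrix_mult_distrib:
  "(A + B) ** C = A ** C + B ** C" "D ** (E + F) = D ** E + D ** F"
  "(A - B) ** C = A ** C - B ** C" "D ** (E - F) = D ** E - D ** F"
  for A B :: "('f::conj_algebra)^'n^'m" and E F :: "'f^'n^'m"
  by (simp_all add: matrix_matrix_mult_def vec_eq_iff algebra_simps sum.distrib sum_subtractf)

lemma ctranspose_ctranspose [simp]: "ctranspose (ctranspose A) = A"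
  by (simp add: ctranspose_def vec_eq_iff)

lemma inner_matrix_mult_left: "(A ** B) \<bullet> C = B \<bullet> (ctranspose A ** C)"
  for A B C :: "('f::conj_algebra)^'k^'k"
proof -
  have "(A ** B) \<bullet> C = (\<Sum>i\<in>UNIV. \<Sum>j\<in>UNIV. \<Sum>k\<in>UNIV. (A $ i $ k * B $ k $ j) \<bullet> C $ i $ j)"
    by (simp add: inner_vec_def matrix_matrix_mult_def inner_sum_left)
  also have "\<dots> = (\<Sum>k\<in>UNIV. \<Sum>j\<in>UNIV. \<Sum>i\<in>UNIV. (A $ i $ k * B $ k $ j) \<bullet> C $ i $ j)"
    by (subst sum.swap, subst (2) sum.swap, subst sum.swap, rule refl)
  also have "\<dots> = B \<bullet> (ctranspose A ** C)"
    by (simp add: inner_vec_def matrix_matrix_mult_def inner_sum_right ctranspose_def inner_mult_left_fcnj)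
  finally show ?thesis .
qed

lemma inner_ctranspose: "ctranspose A \<bullet> ctranspose B = A \<bullet> B" for A B :: "('f::conj_algebra)^'k^'k"
  unfolding inner_vec_def ctranspose_def by (simp add: inner_fcnj_fcnj) (rule sum.swap)

lemma inner_matrix_mult_right: "(B ** A) \<bullet> C = B \<bullet> (C ** ctranspose A)"
  for A B C :: "('f::conj_algebra)^'k^'k"
proof -
  have "(B ** A) \<bullet> C = (ctranspose A ** ctranspose B) \<bullet> ctranspose C"
    by (simp add: inner_ctranspose flip: ctranspose_mult)
  also have "\<dots> = B \<bullet> (C ** ctranspose A)"
    by (simp add: inner_matrix_mult_left inner_ctranspose[of "B" , symmetric] ctranspose_mult)
  finally show ?thesis .
qed

lemma inner_matrix_vector_mult: "(A *v x) \<bullet> y = x \<bullet> (ctranspose A *v y)"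
  for A :: "('f::conj_algebra)^'k^'k"
proof -
  have "(A *v x) \<bullet> y = (\<Sum>i\<in>UNIV. \<Sum>k\<in>UNIV. (A $ i $ k * x $ k) \<bullet> y $ i)"
    by (simp add: inner_vec_def matrix_vector_mult_def inner_sum_left)
  also have "\<dots> = x \<bullet> (ctranspose A *v y)"
    by (subst sum.swap)
       (simp add: inner_vec_def matrix_vector_mult_def inner_sum_right ctranspose_def inner_mult_left_fcnj)
  finally show ?thesis .
qed

lemma matrix_mult_outer: "A ** outer x y = outer (A *v x) y" for A :: "('f::conj_algebra)^'k^'k"
  by (simp add: matrix_matrix_mult_def outer_def matrix_vector_mult_def vec_eq_iff sum_distrib_right mult.assoc)

lemma outer_mult_matrix: "outer x y ** A = outer x (ctranspose A *v y)" for A :: "('f::conj_algebra)^'k^'k"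
proof -
  have "ctranspose (outer x y ** A) = ctranspose (outer x (ctranspose A *v y))"
    by (simp add: ctranspose_mult ctranspose_outer matrix_mult_outer)
  thus ?thesis by (metis ctranspose_ctranspose)
qed

lemma outer_matrix_vector_mult: "outer x y *v z = rmult x (hprod y z)"
  by (simp add: outer_def matrix_vector_mult_def rmult_def hprod_def vec_eq_iff sum_distrib_left mult.assoc)

lemma outer_mult_outer: "outer x y ** outer z w = outer (rmult x (hprod y z)) w"
  by (simp add: matrix_mult_outer outer_matrix_vector_mult)

lemma rmult_of_real: "rmult x (r *\<^sub>R 1) = r *\<^sub>R x"
  by (simp add: rmult_def vec_eq_iff)

text \<open>Reduces the condition defining \<open>Str\<close> to associativity of the matrix
  product: for the congruence by A both of its sides become A x A* y A x A* .\<close>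

lemma mat_of_quadratic_rep: "mat_of (quadratic_rep x y) = mat_of x ** mat_of y ** mat_of x"
  by (simp add: quadratic_rep_def mat_of_jordan_prod matrix_mult_distrib matrix_mult_scaleR
      matrix_mul_assoc scaleR_add_right algebra_simps)
     (simp add: scaleR_add_left[symmetric] algebra_simps)

section \<open>Congruence transformations in the structure group\<close>

definition Ad :: "('f::conj_algebra)^'k^'k \<Rightarrow> ('f, 'k::finite) herm \<Rightarrow>\<^sub>L ('f, 'k) herm" where
  "Ad A = Blinfun (\<lambda>x. herm_of (A ** mat_of x ** ctranspose A))"

lemma mat_of_Ad: "mat_of (blinfun_apply (Ad A) x) = A ** mat_of x ** ctranspose A"
proof -
  define L where "L x = herm_of (A ** mat_of x ** ctranspose A)" for x
  have L: "mat_of (L x) = A ** mat_of x ** ctranspose A" for x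
    unfolding L_def by (rule mat_of_herm_of) (simp add: ctranspose_mult mat_of_herm matrix_mul_assoc)
  have "linear L"
    by (simp add: linear_iff mat_of_inject[symmetric] L matrix_mult_distrib matrix_mult_scaleR)
  hence "bounded_linear L" by (simp add: linear_conv_bounded_linear)
  thus ?thesis by (simp add: Ad_def bounded_linear_Blinfun_apply L flip: L_def)
qed

lemma Ad_fold_map: "blinfun_apply (Ad A) (fold_map x) = fold_map (A *v x)"
  by (simp add: mat_of_inject[symmetric] mat_of_Ad mat_of_fold_map matrix_mult_outer outer_mult_matrix)

lemma Ad_mult: "blinfun_apply (Ad A) (blinfun_apply (Ad B) x) = blinfun_apply (Ad (A ** B)) x"
  by (simp add: mat_of_inject[symmetric] mat_of_Ad ctranspose_mult matrix_mul_assoc)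

lemma Ad_one: "Ad (mat 1) = id_blinfun"
  by (rule blinfun_eqI) (simp add: mat_of_inject[symmetric] mat_of_Ad ctranspose_mat_1)

text \<open>The adjoint for the trace form is the congruence by \<open>ctranspose A\<close>, and the
  inverse is the congruence by B.\<close>

lemma Ad_in_Str:
  assumes "A ** B = mat 1" "B ** A = mat 1"
  shows "Ad A \<in> Str"
proof -
  have "bij (blinfun_apply (Ad A))"
    by (rule bij_betw_byWitness[where f' = "blinfun_apply (Ad B)"]) (simp_all add: Ad_mult assms Ad_one)
  moreover have "trace_form (blinfun_apply (Ad A) x) y = trace_form x (blinfun_apply (Ad (ctranspose A)) y)" for x y
    unfolding trace_form_eq_inner inner_herm_def mat_of_Ad
    by (subst inner_matrix_mult_right, subst inner_matrix_mult_left) (simp add: matrix_mul_assoc)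
  moreover have "quadratic_rep (blinfun_apply (Ad A) x) y =
      blinfun_apply (Ad A) (quadratic_rep x (blinfun_apply (Ad (ctranspose A)) y))" for x y
    by (simp add: mat_of_inject[symmetric] mat_of_Ad mat_of_quadratic_rep matrix_mul_assoc)
  ultimately show ?thesis
    unfolding Str_def by (intro CollectI conjI exI[of _ "blinfun_apply (Ad (ctranspose A))"]) blast+
qed

lemma norm_herm_eq: "norm x = norm (mat_of x)"
  by (simp add: norm_herm_def inner_herm_def norm_eq_sqrt_inner)

text \<open>\<open>mat_of\<close> preserves distances, so continuity of maps into
  \<open>herm\<close> can be checked on matrices.\<close>

lemma continuous_on_herm_iff: "continuous_on S f \<longleftrightarrow> continuous_on S (\<lambda>x. mat_of (f x))"
proof -
  have "dist (f x) (f y) = dist (mat_of (f x)) (mat_of (f y))" for x y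
    by (simp add: dist_norm norm_herm_eq)
  thus ?thesis by (simp only: continuous_on_def tendsto_iff)
qed

lemma continuous_on_matrix_mult [continuous_intros]:
  fixes f :: "'a::topological_space \<Rightarrow> ('f::conj_algebra)^'n^'m" and g :: "'a \<Rightarrow> 'f^'p^'n"
  assumes "continuous_on S f" "continuous_on S g"
  shows "continuous_on S (\<lambda>x. f x ** g x)"
  unfolding matrix_matrix_mult_def using assms by (intro continuous_intros)

lemma continuous_on_ctranspose [continuous_intros]:
  assumes "continuous_on S f"
  shows "continuous_on S (\<lambda>x. ctranspose (f x))"
  unfolding ctranspose_def using assms by (intro continuous_intros)

lemma continuous_on_outer [continuous_intros]:
  assumes "continuous_on S f" "continuous_on S g"
  shows "continuous_on S (\<lambda>x. outer (f x) (g x))"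
  unfolding outer_def using assms by (intro continuous_intros)

lemma continuous_on_fold_map: "continuous_on S fold_map"
  unfolding continuous_on_herm_iff mat_of_fold_map by (intro continuous_intros)

text \<open>In finite dimension continuity in the operator norm follows from continuity at each
  vector. This turns connected sets of matrices into connected subsets of
  \<open>Str\<close>.\<close>

lemma continuous_on_Ad [continuous_intros]:
  fixes f :: "'a::t2_space \<Rightarrow> ('f::conj_algebra)^'k^'k"
  assumes "continuous_on S f"
  shows "continuous_on S (\<lambda>x. Ad (f x))"
  by (rule continuous_on_blinfun_componentwise)
     (simp add: continuous_on_herm_iff mat_of_Ad assms continuous_intros)

text \<open>For a unit vector w this is the Householder reflection: it negates the right multiples
  of w and fixes every x with \<open>hprod w x = 0\<close>.\<close>

definition refl_mat :: "('f::conj_algebra)^'k \<Rightarrow> 'f^'k^'k" where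
  "refl_mat w = mat 1 - 2 *\<^sub>R outer w w"

lemma continuous_on_refl_mat [continuous_intros]:
  assumes "continuous_on S f"
  shows "continuous_on S (\<lambda>x. refl_mat (f x))"
  unfolding refl_mat_def using assms by (intro continuous_intros)

lemma ctranspose_refl_mat: "ctranspose (refl_mat w) = refl_mat w"
  by (simp add: refl_mat_def ctranspose_linear ctranspose_outer ctranspose_mat_1)

lemma refl_mat_involution:
  assumes "norm w = 1"
  shows "refl_mat w ** refl_mat w = mat 1"
proof -
  have "w \<bullet> w = 1" using assms by (simp add: dot_square_norm)
  hence "outer w w ** outer w w = outer w w"
    unfolding outer_mult_outer hprod_self rmult_of_real by simp
  thus ?thesis
    by (simp add: refl_mat_def matrix_mult_distrib matrix_mult_scaleR algebra_simps)
       (simp add: scaleR_add_left[symmetric] scaleR_2[symmetric])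
qed

lemma refl_mat_apply: "refl_mat w *v x = x - 2 *\<^sub>R rmult w (hprod w x)"
proof -
  have "(t *\<^sub>R A) *v y = t *\<^sub>R (A *v y)" for t and A :: "'a^'b^'b" and y
    by (simp add: matrix_vector_mult_def vec_eq_iff scaleR_sum_right)
  thus ?thesis
    by (simp add: refl_mat_def matrix_vector_mult_diff_rdistrib outer_matrix_vector_mult)
qed

text \<open>Reflections are self-adjoint, so the second product is the adjoint of the first: this is
  unitarity, by which the congruence fixes the identity matrix.\<close>

lemma refl_mat_product:
  assumes "norm w = 1" "norm w' = 1"
  shows "(refl_mat w ** refl_mat w') ** (refl_mat w' ** refl_mat w) = mat 1"
proof -
  have "(refl_mat w ** refl_mat w') ** (refl_mat w' ** refl_mat w) =
      refl_mat w ** (refl_mat w' ** refl_mat w') ** refl_mat w"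
    by (simp only: matrix_mul_assoc)
  thus ?thesis by (simp add: refl_mat_involution assms)
qed

lemma norm_refl_mat_product:
  assumes "norm w = 1" "norm w' = 1"
  shows "norm ((refl_mat w ** refl_mat w') *v x) = norm x"
proof -
  have "norm (refl_mat w *v x) = norm x" if "norm w = 1" for w x :: "'a^'b"
  proof -
    have "(refl_mat w *v x) \<bullet> (refl_mat w *v x) = x \<bullet> x"
      by (simp add: inner_matrix_vector_mult ctranspose_refl_mat matrix_vector_mul_assoc
          refl_mat_involution[OF that])
    thus ?thesis by (simp add: norm_eq_sqrt_inner)
  qed
  thus ?thesis using assms by (simp flip: matrix_vector_mul_assoc)
qed

text \<open>This is where \<^term>\<open>CARD('k) \<ge> 2\<close> enters: the unit sphere has to be connected.\<close>

lemma Ad_refl_in_K_L: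
  fixes w w' :: "('f::conj_algebra)^'k"
  assumes k: "CARD('k) \<ge> 2" and w: "norm w = 1" "norm w' = 1"
  shows "Ad (refl_mat w ** refl_mat w') \<in> K_L"
proof -
  define \<phi> where "\<phi> = (\<lambda>p :: ('f^'k) \<times> ('f^'k). Ad (refl_mat (fst p) ** refl_mat (snd p)))"
  define S where "S = sphere (0::'f^'k) 1 \<times> sphere (0::'f^'k) 1"
  have "DIM('f^'k) \<ge> 2"
  proof -
    have "DIM('f^'k) = CARD('k) * DIM('f)" by simp
    moreover have "CARD('k) * 1 \<le> CARD('k) * DIM('f)"
      by (intro mult_le_mono2) (simp add: Suc_leI)
    ultimately show ?thesis using k by linarith
  qed
  hence "connected S" unfolding S_def by (intro connected_Times connected_sphere)
  moreover have "continuous_on S \<phi>" unfolding \<phi>_def by (intro continuous_intros)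
  ultimately have "connected (\<phi> ` S)" by (rule connected_continuous_image[rotated])
  moreover have "\<phi> ` S \<subseteq> Str"
    by (auto simp: S_def \<phi>_def intro!: Ad_in_Str refl_mat_product)
  \<comment> \<open>Two equal reflections cancel. Products of two are used so that the family
    contains the identity.\<close>
  moreover have "id_blinfun \<in> \<phi> ` S"
    using w by (intro image_eqI[of _ _ "(w, w)"]) (simp_all add: S_def \<phi>_def refl_mat_involution Ad_one)
  moreover have "Ad (refl_mat w ** refl_mat w') \<in> \<phi> ` S"
    using w by (intro image_eqI[of _ _ "(w, w')"]) (simp_all add: S_def \<phi>_def)
  ultimately have "Ad (refl_mat w ** refl_mat w') \<in> Str0"
    unfolding Str0_def connected_component_def mem_Collect_eq by blast
  moreover have "blinfun_apply (Ad (refl_mat w ** refl_mat w')) herm_one = herm_one"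
    using refl_mat_product[OF w]
    by (simp add: mat_of_inject[symmetric] mat_of_Ad mat_of_herm_one ctranspose_mult ctranspose_refl_mat)
  ultimately show ?thesis by (simp add: K_L_def)
qed

lemma fold_map_scaleR: "fold_map (r *\<^sub>R x) = r\<^sup>2 *\<^sub>R fold_map x"
  using outer_rmult[of x "r *\<^sub>R 1"]
  by (simp add: mat_of_inject[symmetric] mat_of_fold_map rmult_of_real inner_one_one power2_eq_square)

lemma fold_map_rmult: "fold_map (rmult x q) = (q \<bullet> q) *\<^sub>R fold_map x"
  by (simp add: mat_of_inject[symmetric] mat_of_fold_map outer_rmult)

text \<open>Over a noncommutative skew field a reflection maps a unit vector u to a unit vector v only if
  the Hermitian product of u and v is real; this is achieved by a scalar factor on v, which does not
  change the projection.\<close>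

lemma K_L_transitive:
  fixes u v :: "('f::conj_algebra)^'k"
  assumes u: "norm u = 1" and v: "norm v = 1"
  obtains w w' where "norm w = 1" "norm w' = 1"
    "blinfun_apply (Ad (refl_mat w ** refl_mat w')) (fold_map u) = fold_map v"
proof -
  define \<alpha> where "\<alpha> = hprod v u"
  \<comment> \<open>The phase of v* u: it makes the product of u with v q equal to the real number
    |v* u|. If v* u = 0 the product is real for any unit q, and 1 is taken.\<close>
  define q where "q = (if \<alpha> = 0 then 1 else \<alpha> /\<^sub>R norm \<alpha>)"
  define v' where "v' = rmult v q"
  have nq: "q \<bullet> q = 1"
  proof (cases "\<alpha> = 0")
    case False
    thus ?thesis by (simp add: q_def dot_square_norm[of \<alpha>] power2_eq_square field_simps)
  qed (simp add: q_def inner_one_one)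
  have fv: "fold_map v' = fold_map v" by (simp add: v'_def fold_map_rmult nq)
  have "norm q = 1" using nq by (simp add: norm_eq_sqrt_inner)
  hence v': "v' \<bullet> v' = 1" using v by (simp add: v'_def dot_square_norm norm_rmult)
  have u': "u \<bullet> u = 1" using u by (simp add: dot_square_norm)
  have "hprod u v' = norm \<alpha> *\<^sub>R 1"
    using fcnj_mult_self[of \<alpha>]
    by (simp add: v'_def hprod_rmult_right fcnj_hprod[of v u, symmetric] flip: \<alpha>_def)
       (simp add: q_def dot_square_norm power2_eq_square)
  hence h: "hprod v' u = norm \<alpha> *\<^sub>R 1" using fcnj_hprod[of u v'] by (simp add: fcnj_scaleR)
  show ?thesis
  proof (cases "v' = u")
    case True
    show ?thesis
      by (rule that[OF u u]) (use True fv u in \<open>simp add: refl_mat_involution Ad_one\<close>)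
  next
    case False
    define n where "n = norm (u - v')"
    \<comment> \<open>Once the product of u and v' is real, the reflection along their normalized
      difference maps u to v'.\<close>
    define w where "w = (u - v') /\<^sub>R n"
    have n: "n > 0" using False by (simp add: n_def)
    have w: "norm w = 1" using n by (simp add: w_def n_def)
    have "u \<bullet> v' = norm \<alpha>"
      by (subst inner_commute) (simp add: inner_eq_fre_hprod h fre_def inner_one_one)
    hence n2: "n\<^sup>2 = 2 * (1 - norm \<alpha>)"
      unfolding n_def power2_norm_eq_inner
      by (simp add: inner_diff_left inner_diff_right u' v' inner_commute)
    have hw: "hprod w u = ((1 - norm \<alpha>) / n) *\<^sub>R 1"
    proof -
      have "hprod w u = (1 / n) *\<^sub>R hprod (u - v') u"
        by (simp add: w_def hprod_def fcnj_scaleR scaleR_sum_right divide_inverse)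
      also have "hprod (u - v') u = (1 - norm \<alpha>) *\<^sub>R 1"
        by (simp add: hprod_diff_left hprod_self u' h scaleR_diff_left)
      finally show ?thesis by simp
    qed
    have one: "2 * ((1 - norm \<alpha>) / n) / n = 1"
      using n n2 by (simp add: power2_eq_square field_simps)
    have "2 *\<^sub>R rmult w (hprod w u) = (2 * ((1 - norm \<alpha>) / n) / n) *\<^sub>R (u - v')"
      unfolding hw rmult_of_real by (simp add: w_def divide_inverse mult.assoc)
    hence "2 *\<^sub>R rmult w (hprod w u) = u - v'" unfolding one by simp
    hence rw: "refl_mat w *v u = v'" by (simp add: refl_mat_apply)
    \<comment> \<open>The second factor completes the pair of reflections; it changes u by a sign,
      which the folding map does not see.\<close>
    have "refl_mat u *v u = - u"
      by (simp add: refl_mat_apply hprod_self u' rmult_of_real[of u 1, simplified] scaleR_2)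
    hence "(refl_mat w ** refl_mat u) *v u = (- 1) *\<^sub>R v'"
      using linear_neg[OF matrix_vector_mul_linear, of "refl_mat w" u]
      by (simp add: matrix_vector_mul_assoc[symmetric] rw)
    hence "blinfun_apply (Ad (refl_mat w ** refl_mat u)) (fold_map u) = fold_map v"
      by (simp add: Ad_fold_map fold_map_scaleR[of "-1", simplified] fv)
    thus ?thesis by (rule that[OF w u])
  qed
qed

section \<open>Primitive idempotents\<close>

lemma jordan_prod_commute: "x \<bullet>\<^sub>J y = y \<bullet>\<^sub>J x"
  by (simp add: mat_of_inject[symmetric] mat_of_jordan_prod add.commute)

lemma jordan_prod_add:
  "(x + y) \<bullet>\<^sub>J z = x \<bullet>\<^sub>J z + y \<bullet>\<^sub>J z" "z \<bullet>\<^sub>J (x + y) = z \<bullet>\<^sub>J x + z \<bullet>\<^sub>J y"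
  by (simp_all add: mat_of_inject[symmetric] mat_of_jordan_prod matrix_mult_distrib algebra_simps)

lemma mat_of_jordan_square: "mat_of (x \<bullet>\<^sub>J x) = mat_of x ** mat_of x"
  by (simp add: mat_of_jordan_prod flip: scaleR_2)

text \<open>The adjoint h' fixes the identity e as well: h (h' e) = P(h e) e = e = h e. Since P(x) e
  = x^2, the identity of the structure group, evaluated at e, says that h respects squares;
  polarization passes to the Jordan product.\<close>

lemma K_L_D:
  assumes "h \<in> K_L"
  shows "bij (blinfun_apply h)"
    and "blinfun_apply h (x \<bullet>\<^sub>J y) = blinfun_apply h x \<bullet>\<^sub>J blinfun_apply h y"
proof -
  have "h \<in> Str" and one: "blinfun_apply h herm_one = herm_one"
    using assms by (auto simp: K_L_def Str0_def dest: connected_component_in)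
  then obtain h' where bij: "bij (blinfun_apply h)"
    and q: "\<And>x y. quadratic_rep (blinfun_apply h x) y = blinfun_apply h (quadratic_rep x (h' y))"
    by (auto simp: Str_def)
  show "bij (blinfun_apply h)" by (rule bij)
  have q1: "quadratic_rep herm_one y = y" for y :: "('a, 'b) herm"
    by (simp add: mat_of_inject[symmetric] mat_of_quadratic_rep mat_of_herm_one)
  have "blinfun_apply h (h' herm_one) = blinfun_apply h herm_one"
    using q[of herm_one herm_one] by (simp add: one q1)
  hence h': "h' herm_one = herm_one" using bij by (simp add: bij_def inj_eq)
  have qe: "quadratic_rep x herm_one = x \<bullet>\<^sub>J x" for x :: "('a, 'b) herm"
    by (simp add: mat_of_inject[symmetric] mat_of_quadratic_rep mat_of_herm_one mat_of_jordan_square)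
  have sq: "blinfun_apply h (x \<bullet>\<^sub>J x) = blinfun_apply h x \<bullet>\<^sub>J blinfun_apply h x" for x
    using q[of x herm_one] by (simp add: h' qe)
  have "2 *\<^sub>R blinfun_apply h (x \<bullet>\<^sub>J y) = 2 *\<^sub>R (blinfun_apply h x \<bullet>\<^sub>J blinfun_apply h y)"
    using sq[of "x + y"]
    by (simp add: jordan_prod_add blinfun.add_right sq scaleR_2 jordan_prod_commute[of y x]
        jordan_prod_commute[of "blinfun_apply h y" "blinfun_apply h x"])
  thus "blinfun_apply h (x \<bullet>\<^sub>J y) = blinfun_apply h x \<bullet>\<^sub>J blinfun_apply h y" by simp
qed

text \<open>Together with \<open>primitive_idempotent_fold_map\<close> this places the whole orbit
  of c under \<open>K_L\<close> among the rank-one projections.\<close>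

lemma primitive_idempotent_K_L:
  assumes h: "h \<in> K_L" and c: "primitive_idempotent c"
  shows "primitive_idempotent (blinfun_apply h c)"
proof -
  note bij = K_L_D(1)[OF h] and hom = K_L_D(2)[OF h]
  have inj: "blinfun_apply h x = blinfun_apply h y \<longleftrightarrow> x = y" for x y
    using bij by (simp add: bij_def inj_eq)
  have inj0: "blinfun_apply h x = 0 \<longleftrightarrow> x = 0" for x
    using inj[of x 0] by (simp add: blinfun.zero_right)
  have sur: "\<exists>y. x = blinfun_apply h y" for x using bij by (metis bij_pointE)
  show ?thesis
    unfolding primitive_idempotent_def
  proof (intro conjI notI)
    show "blinfun_apply h c = 0 \<Longrightarrow> False" using c by (simp add: inj0 primitive_idempotent_def)
    show "blinfun_apply h c \<bullet>\<^sub>J blinfun_apply h c = blinfun_apply h c"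
      using c by (simp add: primitive_idempotent_def flip: hom)
    assume "\<exists>a b. a \<noteq> 0 \<and> b \<noteq> 0 \<and> a \<bullet>\<^sub>J a = a \<and> b \<bullet>\<^sub>J b = b \<and> a \<bullet>\<^sub>J b = 0 \<and> blinfun_apply h c = a + b"
    then obtain a b where ab: "a \<noteq> 0" "b \<noteq> 0" "a \<bullet>\<^sub>J a = a" "b \<bullet>\<^sub>J b = b" "a \<bullet>\<^sub>J b = 0"
      "blinfun_apply h c = a + b" by blast
    obtain a' b' where a'b': "a = blinfun_apply h a'" "b = blinfun_apply h b'" using sur by blast
    have "a' \<noteq> 0" "b' \<noteq> 0" "a' \<bullet>\<^sub>J a' = a'" "b' \<bullet>\<^sub>J b' = b'" "a' \<bullet>\<^sub>J b' = 0" "c = a' + b'"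
      using ab unfolding a'b' hom[symmetric] blinfun.add_right[symmetric] inj inj0 by auto
    thus False using c unfolding primitive_idempotent_def by blast
  qed
qed

text \<open>A nonzero column v of an idempotent c satisfies c v = v, so that the projection onto its span
  can be split off from c.\<close>

lemma primitive_idempotent_fold_map:
  fixes c :: "('f::conj_algebra, 'k::finite) herm"
  assumes c: "primitive_idempotent c"
  obtains u where "norm u = 1" "c = fold_map u"
proof -
  define C where "C = mat_of c"
  have C: "C \<noteq> 0" "C ** C = C" "ctranspose C = C"
  proof -
    show "C \<noteq> 0" using c mat_of_inject[of c 0] by (simp add: primitive_idempotent_def C_def)
    show "C ** C = C" unfolding C_def mat_of_jordan_square[symmetric]
      using c by (simp add: primitive_idempotent_def)
    show "ctranspose C = C" unfolding C_def by (rule mat_of_herm)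
  qed
  obtain i j where ij: "C $ i $ j \<noteq> 0" using C(1) by (auto simp: vec_eq_iff)
  define v where "v = (\<chi> i. C $ i $ j)"
  have "v \<noteq> 0" using ij by (auto simp: v_def vec_eq_iff)
  have "C *v v = (\<chi> i. (C ** C) $ i $ j)"
    by (simp add: v_def matrix_vector_mult_def matrix_matrix_mult_def)
  hence Cv: "C *v v = v" by (simp add: C v_def)
  define u where "u = v /\<^sub>R norm v"
  have nu: "norm u = 1" using \<open>v \<noteq> 0\<close> by (simp add: u_def)
  have "C *v u = u" unfolding u_def
    by (subst linear_scale[OF matrix_vector_mul_linear]) (simp add: Cv)
  define A where "A = outer u u"
  have "u \<bullet> u = 1" using nu by (simp add: dot_square_norm)
  hence AA: "A ** A = A"
    unfolding A_def outer_mult_outer hprod_self rmult_of_real by simp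
  have CA: "C ** A = A" by (simp add: A_def matrix_mult_outer \<open>C *v u = u\<close>)
  have AC: "A ** C = A" by (simp add: A_def outer_mult_matrix C \<open>C *v u = u\<close>)
  define a where "a = fold_map u"
  have a: "mat_of a = A" by (simp add: a_def A_def mat_of_fold_map)
  have "A \<noteq> 0"
  proof
    assume "A = 0"
    hence "outer u u *v u = 0" by (simp add: A_def)
    thus False using nu by (simp add: outer_matrix_vector_mult hprod_self rmult_of_real)
  qed
  hence "a \<noteq> 0" using a by auto
  moreover have "a \<bullet>\<^sub>J a = a"
    by (simp add: mat_of_inject[symmetric] mat_of_jordan_square a AA)
  moreover have "(c - a) \<bullet>\<^sub>J (c - a) = c - a"
    by (simp add: mat_of_inject[symmetric] mat_of_jordan_square a matrix_mult_distrib AA CA AC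
        C C_def[symmetric])
  moreover have "a \<bullet>\<^sub>J (c - a) = 0"
    by (simp add: mat_of_inject[symmetric] mat_of_jordan_prod a matrix_mult_distrib AA CA AC
        C_def[symmetric])
  \<comment> \<open>Otherwise c would be the sum of the nonzero orthogonal idempotents a and c -
    a.\<close>
  ultimately have "c - a = 0"
    using c unfolding primitive_idempotent_def by (metis add_diff_cancel_left' diff_add_cancel add.commute)
  hence "c = fold_map u" by (simp add: a_def)
  thus ?thesis using nu that by blast
qed

section \<open>The measure on the orbit\<close>

lemma Str_compose:
  assumes "g \<in> Str" "h \<in> Str"
  shows "g o\<^sub>L h \<in> Str"
proof -
  obtain g' where g: "bij (blinfun_apply g)"
    "\<And>x y. trace_form (blinfun_apply g x) y = trace_form x (g' y)"
    "\<And>x y. quadratic_rep (blinfun_apply g x) y = blinfun_apply g (quadratic_rep x (g' y))"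
    using assms(1) by (auto simp: Str_def)
  obtain h' where h: "bij (blinfun_apply h)"
    "\<And>x y. trace_form (blinfun_apply h x) y = trace_form x (h' y)"
    "\<And>x y. quadratic_rep (blinfun_apply h x) y = blinfun_apply h (quadratic_rep x (h' y))"
    using assms(2) by (auto simp: Str_def)
  have "bij (blinfun_apply (g o\<^sub>L h))"
  proof -
    have "blinfun_apply (g o\<^sub>L h) = blinfun_apply g \<circ> blinfun_apply h" by (simp add: fun_eq_iff)
    thus ?thesis using bij_comp[OF h(1) g(1)] by simp
  qed
  thus ?thesis
    unfolding Str_def
    by (intro CollectI conjI exI[of _ "\<lambda>y. h' (g' y)"]) (simp_all add: g(2,3) h(2,3))
qed

text \<open>Left composition with g carries a connected set joining the identity to h inside
  \<open>Str\<close> to one joining g to the composite. The result makes left translation a map of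
  \<open>K_L\<close> into itself, for which the invariance of \<open>dh\<close> is stated.\<close>

lemma K_L_compose:
  assumes "g \<in> K_L" "h \<in> K_L"
  shows "g o\<^sub>L h \<in> K_L"
proof -
  have cc: "connected_component Str id_blinfun g" "connected_component Str id_blinfun h"
    using assms by (simp_all add: K_L_def Str0_def)
  hence "g \<in> Str" by (auto dest: connected_component_in)
  from cc(2) obtain T where T: "connected T" "T \<subseteq> Str" "id_blinfun \<in> T" "h \<in> T"
    unfolding connected_component_def by blast
  have "connected ((\<lambda>x. g o\<^sub>L x) ` T)"
    by (intro connected_continuous_image continuous_intros T(1))
  moreover have "(\<lambda>x. g o\<^sub>L x) ` T \<subseteq> Str" using T(2) Str_compose[OF \<open>g \<in> Str\<close>] by auto
  moreover have "g \<in> (\<lambda>x. g o\<^sub>L x) ` T"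
    using T(3) by (intro image_eqI[of _ _ id_blinfun]) (auto intro!: blinfun_eqI)
  moreover have "g o\<^sub>L h \<in> (\<lambda>x. g o\<^sub>L x) ` T" using T(4) by blast
  ultimately have "connected_component Str g (g o\<^sub>L h)"
    unfolding connected_component_def by blast
  with cc(1) have "connected_component Str id_blinfun (g o\<^sub>L h)"
    by (rule connected_component_trans)
  thus ?thesis using assms by (simp add: K_L_def Str0_def)
qed

lemma borel_measurable_fold_map [measurable]: "fold_map \<in> borel_measurable borel"
  by (rule borel_measurable_continuous_onI) (rule continuous_on_fold_map)

lemma measurable_apply_haar:
  fixes dh :: "(('f::conj_algebra, 'k::finite) herm \<Rightarrow>\<^sub>L ('f, 'k) herm) measure"
  assumes "normalized_haar K_L dh"
  shows "(\<lambda>h. blinfun_apply h c) \<in> dh \<rightarrow>\<^sub>M borel"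
proof -
  have "(\<lambda>h. blinfun_apply h c) \<in> borel \<rightarrow>\<^sub>M borel"
    by (intro borel_measurable_continuous_onI continuous_intros)
  hence "(\<lambda>h. blinfun_apply h c) \<in> restrict_space borel K_L \<rightarrow>\<^sub>M borel"
    by (rule measurable_restrict_space1)
  thus ?thesis using assms by (simp add: normalized_haar_def cong: measurable_cong_sets)
qed

text \<open>Under both distributions all balls of the same radius centred at a rank-one projection have the
  same measure.\<close>

lemma distr_haar_eq:
  fixes c :: "('f::conj_algebra, 'k::finite) herm"
  assumes k: "CARD('k) \<ge> 2" and c: "primitive_idempotent c" and dh: "normalized_haar K_L dh"
  shows "distr dh borel (\<lambda>h. blinfun_apply h c) = distr uniform_ball borel (\<lambda>q::'f^'k. fold_map (sgn q))"
proof -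
  define X where "X = fold_map ` sphere (0 :: 'f^'k) 1"
  define M where "M = distr dh borel (\<lambda>h. blinfun_apply h c)"
  define N where "N = distr uniform_ball borel (\<lambda>q::'f^'k. fold_map (sgn q))"
  have ps: "prob_space dh" and spdh: "space dh = K_L"
    and setsdh: "sets dh = sets (restrict_space borel K_L)"
    and inv: "\<And>g. g \<in> K_L \<Longrightarrow> distr dh dh (\<lambda>h. g o\<^sub>L h) = dh"
    using dh by (auto simp: normalized_haar_def)
  note ev = measurable_apply_haar[OF dh, of c]
  have ps': "prob_space (uniform_ball :: ('f^'k) measure)" by (rule prob_space_uniform_ball)
  have sgn_meas [measurable]: "(sgn :: 'f^'k \<Rightarrow> _) \<in> borel_measurable borel"
    unfolding sgn_div_norm[abs_def] by measurable
  have fm: "(\<lambda>q::'f^'k. fold_map (sgn q)) \<in> uniform_ball \<rightarrow>\<^sub>M borel" by measurable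
  have X: "closed X" unfolding X_def
    by (intro compact_imp_closed compact_continuous_image continuous_on_fold_map compact_sphere)
  have "M = N"
  proof (rule measure_eq_of_equal_balls)
    show "prob_space M" unfolding M_def by (rule prob_space.prob_space_distr[OF ps ev])
    show "prob_space N" unfolding N_def by (rule prob_space.prob_space_distr[OF ps' fm])
    show "sets M = sets borel" "sets N = sets borel" by (simp_all add: M_def N_def)
    have Xm: "{x \<in> space borel. x \<in> X} \<in> sets borel" using X by simp
    show "AE x in M. x \<in> X"
      unfolding M_def AE_distr_iff[OF ev Xm]
    proof (rule AE_I2)
      fix h assume "h \<in> space dh"
      hence "primitive_idempotent (blinfun_apply h c)"
        using c by (simp add: spdh primitive_idempotent_K_L)
      then obtain u where "norm u = 1" "blinfun_apply h c = fold_map u"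
        by (rule primitive_idempotent_fold_map)
      thus "blinfun_apply h c \<in> X" by (simp add: X_def)
    qed
    show "AE x in N. x \<in> X"
      unfolding N_def AE_distr_iff[OF fm Xm]
      using AE_uniform_ball_nonzero by eventually_elim (simp add: X_def norm_sgn)
    fix x y r assume "x \<in> X" "y \<in> X"
    then obtain u v :: "'f^'k" where uv: "norm u = 1" "norm v = 1" "x = fold_map u" "y = fold_map v"
      by (auto simp: X_def)
    obtain w w' where w: "norm w = 1" "norm w' = 1"
      "blinfun_apply (Ad (refl_mat w ** refl_mat w')) (fold_map u) = fold_map v"
      using K_L_transitive[OF uv(1,2)] by blast
    define A where "A = refl_mat w ** refl_mat w'"
    define g where "g = Ad A"
    have gK: "g \<in> K_L" unfolding g_def A_def using k w(1,2) by (rule Ad_refl_in_K_L)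
    have gx: "blinfun_apply g x = y" using w(3) uv by (simp add: g_def A_def)
    have AA: "A ** ctranspose A = mat 1" "ctranspose A ** A = mat 1"
      using refl_mat_product[OF w(1,2)] refl_mat_product[OF w(2,1)]
      by (simp_all add: A_def ctranspose_mult ctranspose_refl_mat)
    have "norm (blinfun_apply g z) = norm z" for z
    proof -
      have "blinfun_apply g z \<bullet> blinfun_apply g z = mat_of z \<bullet> (ctranspose A ** (A ** mat_of z ** (ctranspose A ** A)))"
        unfolding inner_herm_def g_def mat_of_Ad
        by (subst (1) inner_matrix_mult_right, subst (1) inner_matrix_mult_left) (simp add: matrix_mul_assoc)
      also have "\<dots> = z \<bullet> z"
        by (simp add: AA matrix_mul_assoc inner_herm_def)
      finally show ?thesis by (simp add: norm_eq_sqrt_inner)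
    qed
    hence iso: "dist (blinfun_apply g z) (blinfun_apply g z') = dist z z'" for z z'
      by (simp add: dist_norm flip: blinfun.diff_right)
    have ball: "blinfun_apply g z \<in> ball y r \<longleftrightarrow> z \<in> ball x r" for z
      by (simp add: iso flip: gx)
    have g_meas: "blinfun_apply g \<in> borel \<rightarrow>\<^sub>M borel"
      by (intro borel_measurable_continuous_onI continuous_intros)
    have vim: "blinfun_apply g -` ball y r \<inter> space borel = ball x r" using ball by auto
    \<comment> \<open>The isometry g carries x to y, so the preimage of the ball at y is the ball at
      x, and invariance under g suffices.\<close>
    have *: "emeasure L (ball x r) = emeasure L (ball y r)"
      if "distr L borel (blinfun_apply g) = L" "sets L = sets borel" for L
    proof -
      have "emeasure L (ball y r) = emeasure (distr L borel (blinfun_apply g)) (ball y r)"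
        by (simp add: that(1))
      also have "\<dots> = emeasure L (ball x r)"
        using g_meas vim that(2) sets_eq_imp_space_eq[OF that(2)]
        by (subst emeasure_distr) (simp_all cong: measurable_cong_sets)
      finally show ?thesis ..
    qed
    show "emeasure M (ball x r) = emeasure M (ball y r)"
    proof (rule *)
      have gh: "(\<lambda>h. g o\<^sub>L h) \<in> dh \<rightarrow>\<^sub>M dh"
      proof -
        have "(\<lambda>h. g o\<^sub>L h) \<in> borel \<rightarrow>\<^sub>M borel"
          by (intro borel_measurable_continuous_onI continuous_intros)
        hence "(\<lambda>h. g o\<^sub>L h) \<in> restrict_space borel K_L \<rightarrow>\<^sub>M restrict_space borel K_L"
          by (intro measurable_restrict_space3) (auto intro: K_L_compose gK)
        thus ?thesis using setsdh by (simp cong: measurable_cong_sets)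
      qed
      have "distr M borel (blinfun_apply g) = distr dh borel (blinfun_apply g \<circ> (\<lambda>h. blinfun_apply h c))"
        unfolding M_def by (rule distr_distr[OF g_meas ev])
      \<comment> \<open>Evaluation at c turns left translation by g into the action of g, so left
        invariance of \<open>dh\<close> gives invariance of M.\<close>
      also have "\<dots> = distr dh borel ((\<lambda>h. blinfun_apply h c) \<circ> (\<lambda>h. g o\<^sub>L h))"
        by (simp add: o_def)
      also have "\<dots> = distr (distr dh dh (\<lambda>h. g o\<^sub>L h)) borel (\<lambda>h. blinfun_apply h c)"
        by (rule distr_distr[OF ev gh, symmetric])
      finally show "distr M borel (blinfun_apply g) = M" by (simp add: inv[OF gK] M_def)
    qed (simp add: M_def)
    show "emeasure N (ball x r) = emeasure N (ball y r)"
    proof (rule *)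
      define T where "T = (\<lambda>q. A *v q)"
      have lin: "linear T" unfolding T_def by simp
      have nT: "norm (T q) = norm q" for q unfolding T_def A_def by (rule norm_refl_mat_product[OF w(1,2)])
      have T_meas: "T \<in> uniform_ball \<rightarrow>\<^sub>M borel"
      proof -
        have "T \<in> borel_measurable borel"
          using lin by (intro borel_measurable_continuous_onI linear_continuous_on)
            (simp add: linear_conv_bounded_linear)
        thus ?thesis by (simp cong: measurable_cong_sets)
      qed
      have sg: "sgn (T q) = T (sgn q)" for q
        by (simp add: sgn_div_norm nT linear_scale[OF lin])
      have "distr N borel (blinfun_apply g) = distr uniform_ball borel (blinfun_apply g \<circ> (\<lambda>q::'f^'k. fold_map (sgn q)))"
        unfolding N_def by (rule distr_distr[OF g_meas fm])
      \<comment> \<open>The congruence by A acts on x x* as A acts on x, and A commutes with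
        \<open>sgn\<close> because it is linear and preserves norms; so N inherits the invariance of
        the ball.\<close>
      also have "\<dots> = distr uniform_ball borel ((\<lambda>q. fold_map (sgn q)) \<circ> T)"
        by (simp add: o_def sg g_def Ad_fold_map) (simp add: T_def)
      also have "\<dots> = distr (distr uniform_ball borel T) borel (\<lambda>q. fold_map (sgn q))"
        by (rule distr_distr[OF _ T_meas, symmetric]) measurable
      finally show "distr N borel (blinfun_apply g) = N"
        by (simp add: distr_uniform_ball_isometry[OF lin nT] N_def)
    qed (simp add: N_def)
  qed
  thus ?thesis by (simp add: M_def N_def)
qed

text \<open>\<open>K_L\<close> reaches the projection onto the line of x, and multiplication by
  |x|^2 > 0 stays in \<open>Str0\<close>.\<close>

lemma fold_map_in_orbit:
  fixes c :: "('f::conj_algebra, 'k::finite) herm" and x :: "'f^'k"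
  assumes k: "CARD('k) \<ge> 2" and c: "primitive_idempotent c" and x: "x \<noteq> 0"
  shows "fold_map x \<in> orbit_Xi c"
proof -
  obtain u where u: "norm u = 1" "c = fold_map u"
    using primitive_idempotent_fold_map[OF c] by blast
  have "norm (sgn x) = 1" using x by (simp add: norm_sgn)
  then obtain w w' where w: "norm w = 1" "norm w' = 1"
    "blinfun_apply (Ad (refl_mat w ** refl_mat w')) (fold_map u) = fold_map (sgn x)"
    using K_L_transitive[OF u(1)] by blast
  define g where "g = Ad (refl_mat w ** refl_mat w')"
  have "g \<in> Str0" using Ad_refl_in_K_L[OF k w(1,2)] by (simp add: g_def K_L_def)
  hence "(norm x)\<^sup>2 *\<^sub>R g \<in> Str0" using x by (intro Str0_scaleR) auto
  moreover have "blinfun_apply ((norm x)\<^sup>2 *\<^sub>R g) c = fold_map x"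
    using x w(3) u(2) by (simp add: g_def blinfun.scaleR_left sgn_div_norm flip: fold_map_scaleR)
  ultimately show ?thesis unfolding orbit_Xi_def by (metis image_eqI)
qed

lemma scaleR_K_L_in_orbit:
  assumes "h \<in> K_L" "t > 0"
  shows "t *\<^sub>R blinfun_apply h c \<in> orbit_Xi c"
proof -
  have "t *\<^sub>R h \<in> Str0" using assms by (intro Str0_scaleR) (auto simp: K_L_def)
  thus ?thesis unfolding orbit_Xi_def by (intro image_eqI[of _ _ "t *\<^sub>R h"]) (simp_all add: blinfun.scaleR_left)
qed

text \<open>The value at 0 only serves to make this a map into the orbit.\<close>

definition fold_orbit :: "('f, 'k) herm \<Rightarrow> ('f::conj_algebra)^('k::finite) \<Rightarrow> ('f, 'k) herm" where
  "fold_orbit c x = (if x = 0 then c else fold_map x)"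

lemma measurable_fold_orbit:
  fixes c :: "('f::conj_algebra, 'k::finite) herm"
  assumes k: "CARD('k) \<ge> 2" and c: "primitive_idempotent c"
  shows "fold_orbit c \<in> borel \<rightarrow>\<^sub>M restrict_space borel (orbit_Xi c)"
proof (rule measurable_restrict_space2)
  have "id_blinfun \<in> Str" using Ad_in_Str[of "mat 1" "mat 1"] by (simp add: Ad_one)
  hence "id_blinfun \<in> Str0" by (simp add: Str0_def)
  hence "c \<in> orbit_Xi c" unfolding orbit_Xi_def by (intro image_eqI[of _ _ id_blinfun]) simp_all
  thus "fold_orbit c \<in> space borel \<rightarrow> orbit_Xi c"
    using fold_map_in_orbit[OF k c] by (auto simp: fold_orbit_def)
  show "fold_orbit c \<in> borel_measurable borel"
    unfolding fold_orbit_def[abs_def] by measurable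
qed

text \<open>The exponent r lambda = dk/2 is half the real dimension of F^k, so the radial density
  t^(s-1) is that of Lebesgue measure in t = |x|^2, up to a constant. There remains the angular
  part, which \<open>distr_haar_eq\<close> settles.\<close>

lemma orbit_measure_eq:
  fixes c :: "('f::conj_algebra, 'k::finite) herm"
  assumes k: "CARD('k) \<ge> 2" and c: "primitive_idempotent c" and dh: "normalized_haar K_L dh"
  obtains \<kappa> where "\<kappa> > 0"
    "orbit_measure c dh = density (distr lborel (restrict_space borel (orbit_Xi c)) (fold_orbit c)) (\<lambda>_. ennreal \<kappa>)"
proof -
  define s where "s = real CARD('k) * lam TYPE('f)"
  have s: "s = real DIM('f^'k) / 2" by (simp add: s_def lam_def)
  have "s > 0" by (simp add: s)
  define R where "R = restrict_space borel (orbit_Xi c)"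
  define C where "C = 2 powr s / Gamma s"
  have C: "C > 0" using \<open>s > 0\<close> by (simp add: C_def Gamma_real_pos)
  define V where "V = measure lborel (cball (0::'f^'k) 1)"
  have V: "V > 0" unfolding V_def by (rule measure_lborel_cball_01)
  \<comment> \<open>C is the normalization of the orbit measure and 1 / (s V) the constant of polar
    coordinates. As V = pi^s / Gamma (s + 1), the value is (2 / pi)^s.\<close>
  define \<kappa> where "\<kappa> = C * (1 / (s * V))"
  have k0: "\<kappa> > 0" using C V \<open>s > 0\<close> by (simp add: \<kappa>_def)
  note fo = measurable_fold_orbit[OF k c, folded R_def]
  have fo': "fold_orbit c \<in> lborel \<rightarrow>\<^sub>M R" using fo by simp
  have spdh: "space dh = K_L" using dh by (simp add: normalized_haar_def)
  have "orbit_measure c dh = density (distr lborel R (fold_orbit c)) (\<lambda>_. ennreal \<kappa>)"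
  proof (rule measure_eqI)
    show sets_eq: "sets (orbit_measure c dh) = sets (density (distr lborel R (fold_orbit c)) (\<lambda>_. ennreal \<kappa>))"
      by (simp add: orbit_measure_def Let_def R_def)
    fix B0 assume "B0 \<in> sets (orbit_measure c dh)"
    hence B0R: "B0 \<in> sets R" by (simp add: sets_eq)
    then obtain B where B [measurable]: "B \<in> sets borel" and B0: "B0 = B \<inter> orbit_Xi c"
      by (auto simp: R_def sets_restrict_space)
    \<comment> \<open>The radial integral along the ray through x. As a function on all of V it can
      be integrated against either distribution of projections.\<close>
    define G where "G x = (\<integral>\<^sup>+t. indicator {0<..} t * (indicator B (t *\<^sub>R x) * ennreal (t powr (s - 1))) \<partial>lborel)"
      for x :: "('f, 'k) herm"
    have [measurable]: "G \<in> borel_measurable borel" unfolding G_def by measurable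
    note ev = measurable_apply_haar[OF dh, of c]
    have [measurable]: "(\<lambda>q::'f^'k. fold_map (sgn q)) \<in> borel \<rightarrow>\<^sub>M borel"
      unfolding sgn_div_norm[abs_def] by measurable
    have fm: "(\<lambda>q::'f^'k. fold_map (sgn q)) \<in> uniform_ball \<rightarrow>\<^sub>M borel" by measurable
    have "emeasure (orbit_measure c dh) B0 = (\<integral>\<^sup>+x. indicator B0 x \<partial>orbit_measure c dh)"
      using B0R by (subst nn_integral_indicator) (simp_all add: sets_eq)
    also have "\<dots> = ennreal C *
      (\<integral>\<^sup>+h. (\<integral>\<^sup>+t\<in>{0<..}. indicator B0 (blinfun_apply h (t *\<^sub>R c)) * ennreal (t powr (s - 1)) \<partial>lborel) \<partial>dh)"
      unfolding C_def s_def
      by (rule nn_integral_orbit_measure[OF dh]) (use B0R in \<open>simp add: R_def\<close>)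
    also have "(\<integral>\<^sup>+h. (\<integral>\<^sup>+t\<in>{0<..}. indicator B0 (blinfun_apply h (t *\<^sub>R c)) * ennreal (t powr (s - 1)) \<partial>lborel) \<partial>dh)
        = (\<integral>\<^sup>+h. G (blinfun_apply h c) \<partial>dh)"
      unfolding G_def
    proof (intro nn_integral_cong)
      fix h t assume "h \<in> space dh"
      hence "t > 0 \<Longrightarrow> t *\<^sub>R blinfun_apply h c \<in> orbit_Xi c"
        by (intro scaleR_K_L_in_orbit) (simp_all add: spdh)
      thus "indicator B0 (blinfun_apply h (t *\<^sub>R c)) * ennreal (t powr (s - 1)) * indicator {0<..} t =
          indicator {0<..} t * (indicator B (t *\<^sub>R blinfun_apply h c) * ennreal (t powr (s - 1)))"
        by (auto simp: indicator_def B0 blinfun.scaleR_right)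
    qed
    also have "\<dots> = (\<integral>\<^sup>+x. G x \<partial>distr dh borel (\<lambda>h. blinfun_apply h c))"
      by (subst nn_integral_distr[OF ev]) simp_all
    also have "\<dots> = (\<integral>\<^sup>+x. G x \<partial>distr uniform_ball borel (\<lambda>q::'f^'k. fold_map (sgn q)))"
      by (simp only: distr_haar_eq[OF k c dh])
    also have "\<dots> = (\<integral>\<^sup>+q. G (fold_map (sgn (q::'f^'k))) \<partial>uniform_ball)"
      by (subst nn_integral_distr[OF fm]) simp_all
    \<comment> \<open>The folding map is quadratic, so scaling a projection by t amounts to scaling
      the vector by sqrt t; hence the square of the radius as coordinate.\<close>
    also have "\<dots> = (\<integral>\<^sup>+q. (\<integral>\<^sup>+t. indicator {0<..} t *
        (indicator B (fold_map (sqrt t *\<^sub>R sgn (q::'f^'k))) * ennreal (t powr (real DIM('f^'k) / 2 - 1))) \<partial>lborel) \<partial>uniform_ball)"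
      unfolding G_def s by (intro nn_integral_cong) (auto simp: indicator_def fold_map_scaleR)
    also have "\<dots> = ennreal (1 / (s * V)) * (\<integral>\<^sup>+x. indicator B (fold_map (x::'f^'k)) \<partial>lborel)"
      unfolding s V_def by (rule nn_integral_polar) measurable
    also have "(\<integral>\<^sup>+x. indicator B (fold_map (x::'f^'k)) \<partial>lborel) = (\<integral>\<^sup>+x. indicator B0 (fold_orbit c x) \<partial>lborel)"
    proof (rule nn_integral_cong_AE)
      have "AE x in lborel. (x :: 'f^'k) \<noteq> 0" by (rule AE_lborel_singleton)
      thus "AE x in lborel. indicator B (fold_map (x::'f^'k)) = (indicator B0 (fold_orbit c x) :: ennreal)"
        by eventually_elim (auto simp: indicator_def B0 fold_orbit_def fold_map_in_orbit[OF k c])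
    qed
    also have "\<dots> = (\<integral>\<^sup>+x. indicator B0 x \<partial>distr lborel R (fold_orbit c))"
      using B0R by (subst nn_integral_distr[OF fo']) simp_all
    also have "\<dots> = emeasure (distr lborel R (fold_orbit c)) B0"
      using B0R by (subst nn_integral_indicator) simp_all
    also have "ennreal C * (ennreal (1 / (s * V)) * \<dots>) = ennreal \<kappa> * \<dots>"
    proof -
      have "ennreal \<kappa> = ennreal C * ennreal (1 / (s * V))"
        unfolding \<kappa>_def using C V \<open>s > 0\<close> by (intro ennreal_mult) auto
      thus ?thesis by (simp only: mult.assoc)
    qed
    also have "\<dots> = emeasure (density (distr lborel R (fold_orbit c)) (\<lambda>_. ennreal \<kappa>)) B0"
      using B0R by (subst emeasure_density_const) simp_all
    finally show "emeasure (orbit_measure c dh) B0 = \<dots>" .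
  qed
  thus ?thesis using that k0 by (simp add: R_def)
qed

section \<open>The transforms\<close>

text \<open>The right-hand side is w . w for w = y* z = w1 + i w2 with w1 =
  \<open>hprod y (fst z)\<close> and w2 = \<open>hprod y (snd z)\<close>, in the form that stands
  under the root in \<open>spherical_average_exp\<close>.\<close>

lemma cbilinear_form_fold_map_C:
  "cbilinear_form trace_form (fold_map_C z) (cplx_of (fold_map y)) =
    of_real (hprod y (fst z) \<bullet> hprod y (fst z) - hprod y (snd z) \<bullet> hprod y (snd z)) +
    2 * \<i> * of_real (hprod y (fst z) \<bullet> hprod y (snd z))"
proof -
  have m: "mat_of (fst (fold_map_C z)) = outer (fst z) (fst z) - outer (snd z) (snd z)"
    "mat_of (snd (fold_map_C z)) = outer (fst z) (snd z) + outer (snd z) (fst z)"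
    using mat_of_fold_map_C[of z] by (cases "fold_map_C z"; simp add: cbilinear_def)+
  show ?thesis
    by (simp add: cbilinear_form_def cplx_of_def trace_form_eq_inner inner_herm_def m mat_of_fold_map
        inner_diff_left inner_add_left inner_outer_outer complex_eq_iff inner_commute[of "hprod y (snd z)" "hprod y (fst z)"])
qed

text \<open>This makes the exponential prefactors of the two transforms coincide.\<close>

lemma clinear_form_fold_map_C:
  "clinear_form jordan_tr (fold_map_C z) = cbilinear_form (\<bullet>) z z"
proof -
  have m: "mat_of (fst (fold_map_C z)) = outer (fst z) (fst z) - outer (snd z) (snd z)"
    "mat_of (snd (fold_map_C z)) = outer (fst z) (snd z) + outer (snd z) (fst z)"
    using mat_of_fold_map_C[of z] by (cases "fold_map_C z"; simp add: cbilinear_def)+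
  have tr: "(\<Sum>i\<in>UNIV. fre (outer a b $ i $ i)) = a \<bullet> b" for a b :: "'a^'b"
    by (simp add: outer_def inner_vec_def inner_eq_fre)
  have "fre (x + y) = fre x + fre y" "fre (x - y) = fre x - fre y" for x y :: 'a
    by (simp_all add: fre_def inner_add_left inner_diff_left)
  thus ?thesis
    by (simp add: clinear_form_def cbilinear_form_def jordan_tr_def m sum.distrib sum_subtractf tr)
qed

lemma jordan_tr_fold_map: "jordan_tr (fold_map x) = x \<bullet> x"
  by (simp add: jordan_tr_def mat_of_fold_map outer_def inner_vec_def inner_eq_fre)

lemma cbilinear_form_cplx_of:
  "cbilinear_form (\<bullet>) z (cplx_of x) = of_real (fst z \<bullet> x) + \<i> * of_real (snd z \<bullet> x)"
  by (simp add: cbilinear_form_def cplx_of_def complex_eq_iff)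

text \<open>The series contains only even powers of the square root, hence powers of its radicand,
  which is continuous in x. The branch cut of \<open>csqrt\<close> thus never enters.\<close>

lemma borel_measurable_Bessel_kernel:
  "(\<lambda>x. Bessel_I_tilde \<alpha> (2 * csqrt (cbilinear_form trace_form z (cplx_of x)))) \<in> borel_measurable borel"
proof -
  have W: "cbilinear_form trace_form z (cplx_of x) = of_real (fst z \<bullet> x) + \<i> * of_real (snd z \<bullet> x)" for x
    by (simp add: cbilinear_form_def cplx_of_def trace_form_eq_inner complex_eq_iff)
  show ?thesis
    unfolding Bessel_I_tilde_series W by (simp add: power_mult)
qed

text \<open>The kernel of the transform on the orbit is the average of the classical kernel over the fibre of
  the folding map.\<close>

lemma Bessel_kernel_average:
  fixes z :: "(('f::conj_algebra)^('k::finite)) cplx"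
  shows "of_real (Gamma (lam TYPE('f))) * Bessel_I_tilde (lam TYPE('f) - 1)
      (2 * csqrt (cbilinear_form trace_form (fold_map_C z) (cplx_of (fold_map x)))) =
    (\<integral>q. exp (2 * cbilinear_form (\<bullet>) z (cplx_of (rmult x (sgn q)))) \<partial>uniform_ball)"
  unfolding cbilinear_form_fold_map_C cbilinear_form_cplx_of inner_rmult lam_def
  by (rule spherical_average_exp[symmetric])

text \<open>The inequality 2 a b <= a^2 + b^2 takes the place of Cauchy-Schwarz: squaring the kernel
  doubles c, and half of the doubled Gaussian exponent is given away so that
  \<open>integrable_gaussian\<close> applies.\<close>

lemma integrable_segal_bargmann:
  fixes u :: "'e::euclidean_space \<Rightarrow> complex"
  assumes [measurable]: "u \<in> borel_measurable borel" and u: "integrable lborel (\<lambda>x. (cmod (u x))\<^sup>2)"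
  shows "integrable lborel (\<lambda>x. exp (c * norm x - x \<bullet> x) * cmod (u x))"
proof (rule Bochner_Integration.integrable_bound)
  show "integrable lborel (\<lambda>x. exp (2 * c * norm x - x \<bullet> x) + (cmod (u x))\<^sup>2)"
    by (intro Bochner_Integration.integrable_add integrable_gaussian u)
  show "AE x in lborel. norm (exp (c * norm x - x \<bullet> x) * cmod (u x)) \<le>
      norm (exp (2 * c * norm x - x \<bullet> x) + (cmod (u x))\<^sup>2)"
  proof (rule AE_I2)
    fix x :: 'e
    define a where "a = exp (c * norm x - x \<bullet> x)"
    have "a\<^sup>2 = exp (2 * (c * norm x - x \<bullet> x))" by (simp only: a_def exp_double)
    also have "\<dots> \<le> exp (2 * c * norm x - x \<bullet> x)" by simp
    finally have "a\<^sup>2 \<le> exp (2 * c * norm x - x \<bullet> x)" .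
    moreover have "0 \<le> (a - cmod (u x))\<^sup>2" by simp
    hence "2 * (a * cmod (u x)) \<le> a\<^sup>2 + (cmod (u x))\<^sup>2" by (simp add: power2_diff)
    moreover have "0 \<le> a * cmod (u x)" by (simp add: a_def)
    ultimately have "a * cmod (u x) \<le> exp (2 * c * norm x - x \<bullet> x) + (cmod (u x))\<^sup>2" by linarith
    thus "norm (exp (c * norm x - x \<bullet> x) * cmod (u x)) \<le> norm (exp (2 * c * norm x - x \<bullet> x) + (cmod (u x))\<^sup>2)"
      by (simp add: a_def[symmetric] abs_mult) (simp add: a_def)
  qed
qed measurable

text \<open>After Fubini, for each nonzero q the isometry x -> x sgn q leaves |x| and u unchanged.
  The inner integral is therefore the same for almost all q, and the average runs over a probability
  measure.\<close>

lemma segal_bargmann_average: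
  fixes u :: "('f::conj_algebra)^('k::finite) \<Rightarrow> complex"
  assumes um [measurable]: "u \<in> borel_measurable borel"
    and u2: "integrable lborel (\<lambda>x. (cmod (u x))\<^sup>2)"
    and inv: "\<And>x q. norm q = 1 \<Longrightarrow> u (rmult x q) = u x"
  shows "(\<integral>x. (\<integral>q. exp (2 * cbilinear_form (\<bullet>) z (cplx_of (rmult x (sgn q)))) \<partial>uniform_ball)
        * of_real (exp (- (x \<bullet> x))) * u x \<partial>lborel) =
    (\<integral>x. exp (2 * cbilinear_form (\<bullet>) z (cplx_of x)) * of_real (exp (- (x \<bullet> x))) * u x \<partial>lborel)"
proof -
  interpret U: prob_space "uniform_ball :: 'f measure" by (rule prob_space_uniform_ball)
  interpret pair_sigma_finite "lborel :: ('f^'k) measure" "uniform_ball :: 'f measure" ..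
  define h where "h y = exp (2 * cbilinear_form (\<bullet>) z (cplx_of y)) * of_real (exp (- (y \<bullet> y))) * u y" for y
  define H where "H x q = exp (2 * cbilinear_form (\<bullet>) z (cplx_of (rmult x (sgn q)))) * of_real (exp (- (x \<bullet> x))) * u x"
    for x :: "'f^'k" and q :: 'f
  have [measurable]: "h \<in> borel_measurable borel"
    unfolding h_def cbilinear_form_cplx_of by measurable
  have [measurable]: "(\<lambda>x. hprod x v) \<in> borel_measurable borel" for v :: "'f^'k"
    unfolding hprod_def by (intro borel_measurable_continuous_onI continuous_intros)
  have Hm: "(\<lambda>(x, q). H x q) \<in> borel_measurable (lborel \<Otimes>\<^sub>M uniform_ball)"
    unfolding H_def cbilinear_form_cplx_of inner_rmult by measurable
  \<comment> \<open>A majorant free of q, which justifies Fubini: as |sgn q| <= 1, the real part of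
    the bilinear product of z with x sgn q is at most |fst z| |x|.\<close>
  define \<phi> where "\<phi> x = exp (2 * norm (fst z) * norm x - x \<bullet> x) * cmod (u x)" for x
  have "integrable lborel \<phi>" unfolding \<phi>_def by (rule integrable_segal_bargmann[OF um u2])
  hence \<phi>: "integrable (lborel \<Otimes>\<^sub>M (uniform_ball :: 'f measure)) (\<lambda>p. \<phi> (fst p))"
    using integrable_distr_eq[of fst "lborel \<Otimes>\<^sub>M (uniform_ball :: 'f measure)" lborel \<phi>]
    by (simp add: U.distr_pair_fst borel_measurable_integrable)
  have H_le: "norm (H x q) \<le> \<phi> x" for x q
  proof -
    have "fst z \<bullet> rmult x (sgn q) \<le> norm (fst z) * norm (rmult x (sgn q))" by (rule norm_cauchy_schwarz)
    also have "\<dots> \<le> norm (fst z) * norm x"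
      by (intro mult_left_mono) (simp_all add: norm_rmult norm_sgn)
    finally have "exp (2 * (fst z \<bullet> rmult x (sgn q))) \<le> exp (2 * norm (fst z) * norm x)" by simp
    hence "exp (2 * (fst z \<bullet> rmult x (sgn q))) * exp (- (x \<bullet> x)) * cmod (u x) \<le>
        exp (2 * norm (fst z) * norm x) * exp (- (x \<bullet> x)) * cmod (u x)"
      by (intro mult_right_mono) auto
    also have "\<dots> = \<phi> x" by (simp add: \<phi>_def flip: exp_add)
    finally show ?thesis by (simp add: H_def norm_mult cbilinear_form_cplx_of)
  qed
  have Hi: "integrable (lborel \<Otimes>\<^sub>M uniform_ball) (\<lambda>(x, q). H x q)"
    by (rule Bochner_Integration.integrable_bound[OF \<phi> Hm])
       (use H_le in \<open>auto intro!: AE_I2 order_trans[OF H_le]\<close>)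
  have "(\<integral>x. (\<integral>q. exp (2 * cbilinear_form (\<bullet>) z (cplx_of (rmult x (sgn q)))) \<partial>uniform_ball)
        * of_real (exp (- (x \<bullet> x))) * u x \<partial>lborel) = (\<integral>x. (\<integral>q. H x q \<partial>uniform_ball) \<partial>lborel)"
    by (simp add: H_def)
  also have "\<dots> = (\<integral>q. (\<integral>x. H x q \<partial>lborel) \<partial>uniform_ball)"
    by (rule Fubini_integral[OF Hi, symmetric])
  also have "\<dots> = (\<integral>q. (\<integral>x. h x \<partial>lborel) \<partial>(uniform_ball :: 'f measure))"
  proof (rule integral_cong_AE)
    show "(\<lambda>q. \<integral>x. H x q \<partial>lborel) \<in> borel_measurable uniform_ball"
      using integrable_snd[OF Hi] by (rule borel_measurable_integrable)
    show "AE q in uniform_ball. (\<integral>x. H x q \<partial>lborel) = (\<integral>x. h x \<partial>lborel)"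
      using AE_uniform_ball_nonzero
    proof eventually_elim
      case (elim q)
      hence nq: "norm (sgn q) = 1" by (simp add: norm_sgn)
      define T where "T = (\<lambda>x :: 'f^'k. rmult x (sgn q))"
      have lin: "linear T" unfolding T_def by (rule linear_rmult_left)
      have nT: "norm (T x) = norm x" for x by (simp add: T_def norm_rmult nq)
      have [measurable]: "T \<in> borel_measurable borel"
        using lin by (intro borel_measurable_continuous_onI linear_continuous_on)
          (simp add: linear_conv_bounded_linear)
      have "(\<integral>x. h x \<partial>lborel) = (\<integral>x. h x \<partial>distr lborel borel T)"
        by (simp add: lborel_distr_isometry[OF lin nT])
      also have "\<dots> = (\<integral>x. h (T x) \<partial>lborel)" by (subst integral_distr) auto
      also have "(\<lambda>x. h (T x)) = (\<lambda>x. H x q)"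
      proof (rule ext)
        show "h (T x) = H x q" for x
          using nT[of x] inv[OF nq, of x] by (simp add: h_def H_def T_def dot_square_norm)
      qed
      finally show ?case ..
    qed
  qed simp
  also have "\<dots> = (\<integral>x. h x \<partial>lborel)" by (simp add: U.prob_space del: measure_uniform_measure space_uniform_measure)
  finally show ?thesis by (simp add: h_def)
qed

text \<open>The argument is uniform in the scalars, and the theorem instantiates it three times. The
  constant, chosen before f, is the density \<open>\<kappa>\<close> of the orbit measure relative to
  the image of Lebesgue measure; the factor Gamma(lambda) of the transform is used up by the
  spherical average.\<close>

lemma segal_bargmann_Xi_fold_map:
  fixes c :: "('f::conj_algebra, 'k::finite) herm"
  assumes k: "CARD('k) \<ge> 2" and c: "primitive_idempotent c" and dh: "normalized_haar K_L dh"
  shows "\<exists>C::complex. \<forall>f \<in> L2 (orbit_measure c dh).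
    segal_bargmann_Xi (orbit_measure c dh) f \<circ> fold_map_C =
      (\<lambda>z. C * segal_bargmann (f \<circ> fold_map) z)"
proof -
  define R where "R = restrict_space borel (orbit_Xi c)"
  obtain \<kappa> where \<kappa>: "\<kappa> > 0" and om: "orbit_measure c dh = density (distr lborel R (fold_orbit c)) (\<lambda>_. ennreal \<kappa>)"
    unfolding R_def using orbit_measure_eq[OF k c dh] by blast
  have fo: "fold_orbit c \<in> lborel \<rightarrow>\<^sub>M R" using measurable_fold_orbit[OF k c] by (simp add: R_def)
  have AE0: "AE x in lborel. (x :: 'f^'k) \<noteq> 0" by (rule AE_lborel_singleton)
  show ?thesis
  proof (intro exI[of _ "of_real \<kappa>"] ballI ext)
    fix f z assume "f \<in> L2 (orbit_measure c dh)"
    hence f: "f \<in> borel_measurable R" and f2: "integrable (orbit_measure c dh) (\<lambda>x. (cmod (f x))\<^sup>2)"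
      by (simp_all add: L2_def om)
    define u where "u = f \<circ> fold_map"
    have fp: "(\<lambda>x. f (fold_orbit c x)) \<in> borel_measurable borel"
      using measurable_compose[OF fo f] by simp
    \<comment> \<open>Measurability of f is known on the orbit only, and at x = 0 the function u
      takes the value of f at the zero matrix, outside the orbit. Changing one value keeps
      measurability.\<close>
    have "u = (\<lambda>x. if x = 0 then f (fold_map 0) else f (fold_orbit c x))"
      by (auto simp: u_def fold_orbit_def)
    hence um: "u \<in> borel_measurable borel" using fp by simp
    have ueq: "AE x in lborel. f (fold_orbit c x) = u x"
      using AE0 by eventually_elim (simp add: u_def fold_orbit_def)
    have "integrable (distr lborel R (fold_orbit c)) (\<lambda>x. \<kappa> *\<^sub>R (cmod (f x))\<^sup>2)"
      using f2 \<kappa> f unfolding om by (subst (asm) integrable_density) auto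
    hence "integrable (distr lborel R (fold_orbit c)) (\<lambda>x. (cmod (f x))\<^sup>2)"
      using \<kappa> by simp
    hence "integrable lborel (\<lambda>x. (cmod (f (fold_orbit c x)))\<^sup>2)"
      using f by (subst (asm) integrable_distr_eq[OF fo]) auto
    moreover have "integrable lborel (\<lambda>x. (cmod (f (fold_orbit c x)))\<^sup>2) \<longleftrightarrow> integrable lborel (\<lambda>x. (cmod (u x))\<^sup>2)"
      using fp um ueq by (intro integrable_cong_AE) (auto elim!: eventually_mono)
    ultimately have u2: "integrable lborel (\<lambda>x. (cmod (u x))\<^sup>2)" by simp
    have inv: "u (rmult x q) = u x" if "norm q = 1" for x and q :: 'f
      using that by (simp add: u_def fold_map_rmult dot_square_norm)
    define J where "J x = Bessel_I_tilde (lam TYPE('f) - 1)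
        (2 * csqrt (cbilinear_form trace_form (fold_map_C z) (cplx_of x)))
        * of_real (exp (- jordan_tr x))" for x :: "('f, 'k) herm"
    have [measurable]: "(jordan_tr :: ('f, 'k) herm \<Rightarrow> real) \<in> borel_measurable borel"
    proof -
      have "jordan_tr x = trace_form x herm_one" for x :: "('f, 'k) herm"
        by (simp add: jordan_tr_def trace_form_def mat_of_herm_one)
      hence "(jordan_tr :: ('f, 'k) herm \<Rightarrow> real) = (\<lambda>x. x \<bullet> herm_one)"
        by (simp add: fun_eq_iff trace_form_eq_inner)
      thus ?thesis by (rule ssubst) measurable
    qed
    have J: "J \<in> borel_measurable borel"
      unfolding J_def using borel_measurable_Bessel_kernel by measurable
    hence JR: "J \<in> borel_measurable R" by (simp add: R_def measurable_restrict_space1)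
    have Jf: "(\<lambda>x. J (fold_map x)) \<in> borel_measurable borel"
      using measurable_compose[OF borel_measurable_fold_map J] .
    have "(\<integral>x. J x * f x \<partial>orbit_measure c dh) = (\<integral>x. \<kappa> *\<^sub>R (J x * f x) \<partial>distr lborel R (fold_orbit c))"
      unfolding om using \<kappa> f JR by (subst integral_density) auto
    also have "\<dots> = (\<integral>x. \<kappa> *\<^sub>R (J (fold_orbit c x) * f (fold_orbit c x)) \<partial>lborel)"
      using f JR by (subst integral_distr[OF fo]) auto
    also have "\<dots> = (\<integral>x. \<kappa> *\<^sub>R (J (fold_map x) * u x) \<partial>lborel)"
    proof (rule integral_cong_AE)
      show "(\<lambda>x. \<kappa> *\<^sub>R (J (fold_orbit c x) * f (fold_orbit c x))) \<in> borel_measurable lborel"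
        using fp measurable_compose[OF fo JR] by simp
      show "(\<lambda>x. \<kappa> *\<^sub>R (J (fold_map x) * u x)) \<in> borel_measurable lborel"
        using Jf um by simp
      show "AE x in lborel. \<kappa> *\<^sub>R (J (fold_orbit c x) * f (fold_orbit c x)) = \<kappa> *\<^sub>R (J (fold_map x) * u x)"
        using AE0 by eventually_elim (simp add: u_def fold_orbit_def)
    qed
    also have "\<dots> = of_real \<kappa> * (\<integral>x. J (fold_map x) * u x \<partial>lborel)"
      by (simp add: scaleR_conv_of_real)
    finally have I: "(\<integral>x. J x * f x \<partial>orbit_measure c dh) = of_real \<kappa> * (\<integral>x. J (fold_map x) * u x \<partial>lborel)" .
    have "of_real (Gamma (lam TYPE('f))) * (\<integral>x. J (fold_map x) * u x \<partial>lborel) =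
      (\<integral>x. (of_real (Gamma (lam TYPE('f))) * Bessel_I_tilde (lam TYPE('f) - 1)
        (2 * csqrt (cbilinear_form trace_form (fold_map_C z) (cplx_of (fold_map x)))))
        * of_real (exp (- (x \<bullet> x))) * u x \<partial>lborel)"
      by (simp add: J_def jordan_tr_fold_map mult.assoc flip: integral_mult_right_zero)
    also have "\<dots> = (\<integral>x. exp (2 * cbilinear_form (\<bullet>) z (cplx_of x)) * of_real (exp (- (x \<bullet> x))) * u x \<partial>lborel)"
      unfolding Bessel_kernel_average by (rule segal_bargmann_average[OF um u2 inv])
    finally have II: "of_real (Gamma (lam TYPE('f))) * (\<integral>x. J (fold_map x) * u x \<partial>lborel) = \<dots>" .
    have "segal_bargmann_Xi (orbit_measure c dh) f (fold_map_C z) =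
      exp (- cbilinear_form (\<bullet>) z z / 2) * (of_real (Gamma (lam TYPE('f))) * (\<integral>x. J x * f x \<partial>orbit_measure c dh))"
      unfolding segal_bargmann_Xi_def J_def clinear_form_fold_map_C by (simp only: mult_ac)
    also have "\<dots> = of_real \<kappa> * (exp (- cbilinear_form (\<bullet>) z z / 2) *
        (of_real (Gamma (lam TYPE('f))) * (\<integral>x. J (fold_map x) * u x \<partial>lborel)))"
      unfolding I by (simp only: mult_ac)
    also have "\<dots> = of_real \<kappa> * segal_bargmann u z"
      unfolding II segal_bargmann_def ..
    finally show "(segal_bargmann_Xi (orbit_measure c dh) f \<circ> fold_map_C) z =
        of_real \<kappa> * segal_bargmann (f \<circ> fold_map) z"
      by (simp add: u_def)
  qed
qed

theorem theorem3p10: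
  assumes "CARD('k::finite) \<ge> 2"
  shows "(\<forall>(c\<^sub>1 :: (real, 'k) herm) dh. primitive_idempotent c\<^sub>1 \<and> normalized_haar K_L dh \<longrightarrow>
           (\<exists>c::complex. \<forall>f \<in> L2 (orbit_measure c\<^sub>1 dh).
              segal_bargmann_Xi (orbit_measure c\<^sub>1 dh) f \<circ> fold_map_C =
              (\<lambda>z. c * segal_bargmann (f \<circ> fold_map) z))) \<and>
         (\<forall>(c\<^sub>1 :: (complex, 'k) herm) dh. primitive_idempotent c\<^sub>1 \<and> normalized_haar K_L dh \<longrightarrow>
           (\<exists>c::complex. \<forall>f \<in> L2 (orbit_measure c\<^sub>1 dh).
              segal_bargmann_Xi (orbit_measure c\<^sub>1 dh) f \<circ> fold_map_C =
              (\<lambda>z. c * segal_bargmann (f \<circ> fold_map) z))) \<and>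
         (\<forall>(c\<^sub>1 :: (quat, 'k) herm) dh. primitive_idempotent c\<^sub>1 \<and> normalized_haar K_L dh \<longrightarrow>
           (\<exists>c::complex. \<forall>f \<in> L2 (orbit_measure c\<^sub>1 dh).
              segal_bargmann_Xi (orbit_measure c\<^sub>1 dh) f \<circ> fold_map_C =
              (\<lambda>z. c * segal_bargmann (f \<circ> fold_map) z)))"
  using assms by (intro conjI allI impI; elim conjE; intro segal_bargmann_Xi_fold_map)

end
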